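(* Consider the interconnected system $$\dot x_i=A_ix_i+f_i(x_1,\dots,x_n,u),\qquad x_i(t)\in X_i,\ u(t)\in U,\quad i=1,\dots,n, \qquad (\ast)$$ where each $X_i$ is a Banach space, $A_i$ generates a $C_0$-semigroup on $X_i$, $U$ is a Banach space, and inputs are taken from $U_c=PC(\mathbb{R}_+,U)$. Suppose that for each $i$ the $i$-th subsystem has an ISS-Lyapunov function $V_i:X_i\to\mathbb{R}_+$ with corresponding gains $\chi_{ij}$ ($j=1,\dots,n$) and $\chi_i$. If the gain operator $$\Gamma:\mathbb{R}_+^n\to\mathbb{R}_+^n,\qquad \Gamma(s)=\Big(\max_{j=1}^n\chi_{1j}(s_j),\dots,\max_{j=1}^n\chi_{nj}(s_j)\Big)$$ satisfies the small-gain condition $$\forall s\in\mathbb{R}_+^n\setminus\{0\}\ \ \exists i:\ (\Gamma(s))_i<s_i,$$ then the whole system $(\ast)$, with state space $X=X_1\times\dots\times X_n$, is input-to-state stable (ISS). Moreover, it possesses the ISS-Lyapunov function $$V(x):=\max_{i}\{\sigma_i^{-1}(V_i(x_i))\},$$ where $\sigma=(\sigma_1,\dots,\sigma_n)^T$ is an $\Omega$-path for $\Gamma$ (an $\Omega$-path exists, and $\sigma$ may be any $\Omega$-path), and the Lyapunov gain of the whole system is $$\chi(r):=\max_i\sigma_i^{-1}(\chi_i(r)).$$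
   Context: $\mathcal K$: continuous strictly increasing $\gamma:\mathbb{R}_+\to\mathbb{R}_+$ with $\gamma(0)=0$; $\mathcal K_\infty$: unbounded elements of $\mathcal K$; $\mathcal{KL}$: functions $\beta:\mathbb{R}_+^2\to\mathbb{R}_+$ with $\beta(\cdot,t)\in\mathcal K$ for each $t\ge0$ and $\beta(r,\cdot)$ continuous, decreasing, tending to $0$ at infinity for each $r>0$. A positive definite function is a continuous $\alpha:\mathbb{R}_+\to\mathbb{R}_+$ with $\alpha(0)=0$, $\alpha(r)>0$ for $r>0$. $PC(\mathbb{R}_+,Y)$ is the space of (bounded) piecewise right-continuous functions $\mathbb{R}_+\to Y$ with the sup-norm. $X$ is normed by $\|x\|_X=\|x_1\|_{X_1}+\dots+\|x_n\|_{X_n}$. The $i$-th subsystem has state space $X_i$ and input values $\tilde x_i=(x_1,\dots,x_{i-1},x_{i+1},\dots,x_n,u)\in\tilde X_i:=X_1\times\dots\times X_{i-1}\times X_{i+1}\times\dots\times X_n\times U$, normed by the sum of the norms; its inputs are $v\in PC(\mathbb{R}_+,\tilde X_i)$ and its transition map (state at time $t$ from $x_i$ at time $0$ under input $v$) is $\phi_i(t,x_i,v)$. The transition map of the whole system is $\phi(t,x,u)$, $u\in PC(\mathbb{R}_+,U)$. Standing assumptions: the subsystems and the whole system are time-invariant control systems in the sense that (mild) solutions exist locally in time and are unique, are continuous in $t$, depend on the input only through its values up to the current time, satisfy the semigroup (cocycle) property, and the BIC property holds (if the maximal existence time is finite, the norm of the solution is unbounded on the existence interval). ISS-Lyapunov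 function of the $i$-th subsystem with gains $\chi_{ij},\chi_i$: a continuous $V_i:X_i\to\mathbb{R}_+$ for which there exist $\psi_{i1},\psi_{i2}\in\mathcal K_\infty$ and a positive definite $\alpha_i$ with $\psi_{i1}(\|x_i\|_{X_i})\le V_i(x_i)\le\psi_{i2}(\|x_i\|_{X_i})$ for all $x_i\in X_i$, such that, with $\chi_{ij}\in\mathcal K$ for $j\ne i$, $\chi_{ii}:=0$ and $\chi_i\in\mathcal K$, for all $x_i\in X_i$, all $\tilde x_i=(x_1,\dots,x_{i-1},x_{i+1},\dots,x_n,u)\in\tilde X_i$ and all $v\in PC(\mathbb{R}_+,\tilde X_i)$ with $v(0)=\tilde x_i$: $$V_i(x_i)\ge\max\Big\{\max_{j=1}^n\chi_{ij}(V_j(x_j)),\ \chi_i(\|u\|_U)\Big\}\ \Rightarrow\ \dot V_i(x_i)\le-\alpha_i(V_i(x_i)),$$ where $\dot V_i(x_i)=\limsup_{t\to+0}\frac1t\big(V_i(\phi_i(t,x_i,v))-V_i(x_i)\big)$. $\Omega$-path for $\Gamma$: a function $\sigma=(\sigma_1,\dots,\sigma_n)^T:\mathbb{R}_+\to\mathbb{R}_+^n$ with $\sigma_i\in\mathcal K_\infty$ such that: (1) each $\sigma_i^{-1}$ is locally Lipschitz continuous on $(0,\infty)$; (2) for every compact $P\subset(0,\infty)$ there are constants $0<K_1<K_2$ with $K_1\le(\sigma_i^{-1})'(r)\le K_2$ for all $i$ and all points $r\in P$ of differentiability of $\sigma_i^{-1}$; (3) $\Gamma(\sigma(r))<\sigma(r)$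 for all $r>0$, where $<$ on $\mathbb{R}^n$ is componentwise strict inequality in all components. ISS of the whole system: there exist $\beta\in\mathcal{KL}$, $\gamma\in\mathcal K$ such that for all $x_0\in X$, $u\in U_c$, $t\ge0$, $\phi(t,x_0,u)$ is defined and $\|\phi(t,x_0,u)\|_X\le\beta(\|x_0\|_X,t)+\gamma(\|u\|_{U_c})$. ISS-Lyapunov function of the whole system with Lyapunov gain $\chi\in\mathcal K$: a continuous $V:X\to\mathbb{R}_+$ for which there exist $\psi_1,\psi_2\in\mathcal K_\infty$ and a positive definite $\alpha$ with $\psi_1(\|x\|_X)\le V(x)\le\psi_2(\|x\|_X)$ for all $x\in X$, and for all $x\in X$, $u\in U_c$: $V(x)\ge\chi(\|u\|_{U_c})$ implies $\dot V_u(x)\le-\alpha(V(x))$, where $\dot V_u(x)=\limsup_{t\to+0}\frac1t\big(V(\phi(t,x,u))-V(x)\big)$. *)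

theory Defs
  imports "HOL-Analysis.Analysis"
begin

section \<open>Comparison functions\<close>

text \<open>Functions on the nonnegative reals are total functions on the reals of which only the values
  on \<open>{0..}\<close> matter.\<close>

definition class_K :: "(real \<Rightarrow> real) \<Rightarrow> bool" where
  "class_K \<gamma> \<longleftrightarrow> continuous_on {0..} \<gamma> \<and> strict_mono_on {0..} \<gamma> \<and> \<gamma> 0 = 0"

definition class_Kinf :: "(real \<Rightarrow> real) \<Rightarrow> bool" where
  "class_Kinf \<gamma> \<longleftrightarrow> class_K \<gamma> \<and> \<not> bounded (\<gamma> ` {0..})"

definition class_KL :: "(real \<Rightarrow> real \<Rightarrow> real) \<Rightarrow> bool" where
  "class_KL \<beta> \<longleftrightarrow>
     (\<forall>t\<ge>0. class_K (\<lambda>r. \<beta> r t)) \<and>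
     (\<forall>r>0. continuous_on {0..} (\<beta> r) \<and> strict_antimono_on {0..} (\<beta> r) \<and>
            (\<beta> r \<longlongrightarrow> 0) at_top)"

definition pos_def :: "(real \<Rightarrow> real) \<Rightarrow> bool" where
  "pos_def \<alpha> \<longleftrightarrow> continuous_on {0..} \<alpha> \<and> \<alpha> 0 = 0 \<and> (\<forall>r>0. \<alpha> r > 0)"


section \<open>Inputs\<close>

text \<open>Piecewise continuous means: finitely many discontinuities on each bounded interval, with
  one-sided limits there. Values at negative times are irrelevant.\<close>

definition PC :: "'y::real_normed_vector set \<Rightarrow> (real \<Rightarrow> 'y) set" where
  "PC Y = {w. (\<forall>t\<ge>0. w t \<in> Y) \<and> bounded (w ` {0..}) \<and>
              (\<forall>t\<ge>0. continuous (at_right t) w) \<and>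
              (\<forall>t>0. \<exists>l. (w \<longlongrightarrow> l) (at_left t)) \<and>
              (\<forall>\<tau>. finite {t \<in> {0<..\<tau>}. \<not> isCont w t})}"

definition sup_norm :: "(real \<Rightarrow> 'y::real_normed_vector) \<Rightarrow> real" where
  "sup_norm w = (SUP t\<in>{0..}. norm (w t))"


section \<open>Strongly continuous semigroups\<close>

text \<open>Operators on a closed subspace \<open>Z\<close> are total functions of which only the values on \<open>Z\<close>
  matter.\<close>

definition C0_semigroup :: "'a::real_normed_vector set \<Rightarrow> (real \<Rightarrow> 'a \<Rightarrow> 'a) \<Rightarrow> bool" where
  "C0_semigroup Z T \<longleftrightarrow>
     (\<forall>t\<ge>0. (\<forall>x\<in>Z. T t x \<in> Z) \<and>
            (\<forall>x\<in>Z. \<forall>y\<in>Z. T t (x + y) = T t x + T t y) \<and>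
            (\<forall>c. \<forall>x\<in>Z. T t (c *\<^sub>R x) = c *\<^sub>R T t x) \<and>
            (\<exists>M. \<forall>x\<in>Z. norm (T t x) \<le> M * norm x)) \<and>
     (\<forall>x\<in>Z. T 0 x = x) \<and>
     (\<forall>s\<ge>0. \<forall>t\<ge>0. \<forall>x\<in>Z. T (s + t) x = T s (T t x)) \<and>
     (\<forall>x\<in>Z. ((\<lambda>t. T t x) \<longlongrightarrow> x) (at_right 0))"

text \<open>\<open>A\<close>, with domain \<open>dom_A\<close>, is the infinitesimal generator of the semigroup \<open>T\<close> on \<open>Z\<close>.\<close>

definition generates_C0 ::
  "'a::real_normed_vector set \<Rightarrow> 'a set \<Rightarrow> ('a \<Rightarrow> 'a) \<Rightarrow> (real \<Rightarrow> 'a \<Rightarrow> 'a) \<Rightarrow> bool" where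
  "generates_C0 Z dom_A A T \<longleftrightarrow>
     C0_semigroup Z T \<and>
     dom_A = {x\<in>Z. \<exists>y. ((\<lambda>h. (T h x - x) /\<^sub>R h) \<longlongrightarrow> y) (at_right 0)} \<and>
     (\<forall>x\<in>dom_A. ((\<lambda>h. (T h x - x) /\<^sub>R h) \<longlongrightarrow> A x) (at_right 0))"


section \<open>Mild solutions and transition maps\<close>

text \<open>A mild solution on \<open>[0,\<tau>]\<close> of \<open>x' = A x + F(x,w)\<close>, \<open>x(0) = x0\<close>, where \<open>A\<close> generates \<open>T\<close> on
  the state space \<open>Z\<close>. The variation-of-constants integral is the gauge integral because the
  Bochner integral of the library is restricted to separable spaces; for piecewise continuous
  integrands the two agree. The equation at \<open>t = 0\<close> says \<open>\<xi> 0 = x0\<close>.\<close>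

definition mild_solution ::
  "(real \<Rightarrow> 'a::real_normed_vector \<Rightarrow> 'a) \<Rightarrow> 'a set \<Rightarrow> ('a \<Rightarrow> 'w \<Rightarrow> 'a) \<Rightarrow>
     'a \<Rightarrow> (real \<Rightarrow> 'w) \<Rightarrow> real \<Rightarrow> (real \<Rightarrow> 'a) \<Rightarrow> bool" where
  "mild_solution T Z F x0 w \<tau> \<xi> \<longleftrightarrow>
     continuous_on {0..\<tau>} \<xi> \<and>
     (\<forall>t\<in>{0..\<tau>}. \<xi> t \<in> Z \<and>
        ((\<lambda>s. T (t - s) (F (\<xi> s) (w s))) has_integral (\<xi> t - T t x0)) {0..t})"

definition exists_until ::
  "(real \<Rightarrow> 'a::real_normed_vector \<Rightarrow> 'a) \<Rightarrow> 'a set \<Rightarrow> ('a \<Rightarrow> 'w \<Rightarrow> 'a) \<Rightarrow>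
     real \<Rightarrow> 'a \<Rightarrow> (real \<Rightarrow> 'w) \<Rightarrow> bool" where
  "exists_until T Z F t x w \<longleftrightarrow> 0 \<le> t \<and> (\<exists>\<xi>. mild_solution T Z F x w t \<xi>)"

text \<open>Meaningful only where \<open>exists_until\<close> holds, and then well defined by uniqueness of mild
  solutions, which is part of \<open>well_posed\<close> below.\<close>

definition transition_map ::
  "(real \<Rightarrow> 'a::real_normed_vector \<Rightarrow> 'a) \<Rightarrow> 'a set \<Rightarrow> ('a \<Rightarrow> 'w \<Rightarrow> 'a) \<Rightarrow>
     real \<Rightarrow> 'a \<Rightarrow> (real \<Rightarrow> 'w) \<Rightarrow> 'a" where
  "transition_map T Z F t x w = (THE y. \<exists>\<xi>. mild_solution T Z F x w t \<xi> \<and> \<xi> t = y)"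

definition unique_mild_solutions ::
  "(real \<Rightarrow> 'a::real_normed_vector \<Rightarrow> 'a) \<Rightarrow> 'a set \<Rightarrow> ('a \<Rightarrow> 'w \<Rightarrow> 'a) \<Rightarrow>
     'w::real_normed_vector set \<Rightarrow> bool" where
  "unique_mild_solutions T Z F W \<longleftrightarrow>
     (\<forall>x\<in>Z. \<forall>w\<in>PC W. \<forall>\<tau>\<ge>0. \<forall>\<xi> \<eta>.
        mild_solution T Z F x w \<tau> \<xi> \<longrightarrow> mild_solution T Z F x w \<tau> \<eta> \<longrightarrow>
        (\<forall>t\<in>{0..\<tau>}. \<xi> t = \<eta> t))"

text \<open>Time-invariant control systems with state space \<open>Z\<close>, inputs \<open>PC W\<close> and transition map \<open>\<phi>\<close>,
  where \<open>D t x w\<close> says that \<open>\<phi> t x w\<close> is defined. The conjuncts are local existence, identity,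
  continuity, causality and the semigroup (cocycle) property.\<close>

definition control_system ::
  "'a::real_normed_vector set \<Rightarrow> 'w::real_normed_vector set \<Rightarrow>
     (real \<Rightarrow> 'a \<Rightarrow> (real \<Rightarrow> 'w) \<Rightarrow> bool) \<Rightarrow> (real \<Rightarrow> 'a \<Rightarrow> (real \<Rightarrow> 'w) \<Rightarrow> 'a) \<Rightarrow> bool" where
  "control_system Z W D \<phi> \<longleftrightarrow>
     (\<forall>x\<in>Z. \<forall>w\<in>PC W.
        (\<exists>t>0. D t x w) \<and>
        \<phi> 0 x w = x \<and>
        continuous_on {t. D t x w} (\<lambda>t. \<phi> t x w) \<and>
        (\<forall>w'\<in>PC W. \<forall>t. D t x w \<and> (\<forall>s\<in>{0..t}. w s = w' s) \<longrightarrow>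
           D t x w' \<and> \<phi> t x w' = \<phi> t x w) \<and>
        (\<forall>t\<ge>0. \<forall>h\<ge>0. D (t + h) x w \<longrightarrow>
           D t x w \<and> D h (\<phi> t x w) (\<lambda>s. w (t + s)) \<and>
           \<phi> h (\<phi> t x w) (\<lambda>s. w (t + s)) = \<phi> (t + h) x w))"

text \<open>Boundedness implies continuation. The norm \<open>N\<close> of the state space is a parameter because
  the product space carries the sum norm rather than the Euclidean norm of the type of vectors;
  the two are equivalent, so topological notions can be taken from the type.\<close>

definition BIC ::
  "('a \<Rightarrow> real) \<Rightarrow> 'a::real_normed_vector set \<Rightarrow> 'w::real_normed_vector set \<Rightarrow>
     (real \<Rightarrow> 'a \<Rightarrow> (real \<Rightarrow> 'w) \<Rightarrow> bool) \<Rightarrow> (real \<Rightarrow> 'a \<Rightarrow> (real \<Rightarrow> 'w) \<Rightarrow> 'a) \<Rightarrow> bool" where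
  "BIC N Z W D \<phi> \<longleftrightarrow>
     (\<forall>x\<in>Z. \<forall>w\<in>PC W. bdd_above {t. D t x w} \<longrightarrow> (\<forall>M. \<exists>t. D t x w \<and> N (\<phi> t x w) > M))"

definition well_posed ::
  "('a \<Rightarrow> real) \<Rightarrow> (real \<Rightarrow> 'a::real_normed_vector \<Rightarrow> 'a) \<Rightarrow> 'a set \<Rightarrow> ('a \<Rightarrow> 'w \<Rightarrow> 'a) \<Rightarrow>
     'w::real_normed_vector set \<Rightarrow> bool" where
  "well_posed N T Z F W \<longleftrightarrow>
     unique_mild_solutions T Z F W \<and>
     control_system Z W (exists_until T Z F) (transition_map T Z F) \<and>
     BIC N Z W (exists_until T Z F) (transition_map T Z F)"


section \<open>ISS and ISS-Lyapunov functions\<close>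

definition ISS ::
  "('a \<Rightarrow> real) \<Rightarrow> 'a::real_normed_vector set \<Rightarrow> 'w::real_normed_vector set \<Rightarrow>
     (real \<Rightarrow> 'a \<Rightarrow> (real \<Rightarrow> 'w) \<Rightarrow> bool) \<Rightarrow> (real \<Rightarrow> 'a \<Rightarrow> (real \<Rightarrow> 'w) \<Rightarrow> 'a) \<Rightarrow> bool" where
  "ISS N Z W D \<phi> \<longleftrightarrow>
     (\<exists>\<beta> \<gamma>. class_KL \<beta> \<and> class_K \<gamma> \<and>
        (\<forall>x\<in>Z. \<forall>u\<in>PC W. \<forall>t\<ge>0.
           D t x u \<and> N (\<phi> t x u) \<le> \<beta> (N x) t + \<gamma> (sup_norm u)))"

definition lie_derivative ::
  "(real \<Rightarrow> 'a \<Rightarrow> (real \<Rightarrow> 'w) \<Rightarrow> 'a) \<Rightarrow> ('a \<Rightarrow> real) \<Rightarrow> 'a \<Rightarrow> (real \<Rightarrow> 'w) \<Rightarrow> ereal" where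
  "lie_derivative \<phi> V x w = Limsup (at_right 0) (\<lambda>t. ereal ((V (\<phi> t x w) - V x) / t))"

definition ISS_Lyapunov ::
  "('a \<Rightarrow> real) \<Rightarrow> 'a::real_normed_vector set \<Rightarrow> 'w::real_normed_vector set \<Rightarrow>
     (real \<Rightarrow> 'a \<Rightarrow> (real \<Rightarrow> 'w) \<Rightarrow> 'a) \<Rightarrow> ('a \<Rightarrow> real) \<Rightarrow> (real \<Rightarrow> real) \<Rightarrow> bool" where
  "ISS_Lyapunov N Z W \<phi> V gain \<longleftrightarrow>
     class_K gain \<and> continuous_on Z V \<and> (\<forall>x\<in>Z. 0 \<le> V x) \<and>
     (\<exists>\<psi>1 \<psi>2 \<alpha>. class_Kinf \<psi>1 \<and> class_Kinf \<psi>2 \<and> pos_def \<alpha> \<and>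
        (\<forall>x\<in>Z. \<psi>1 (N x) \<le> V x \<and> V x \<le> \<psi>2 (N x)) \<and>
        (\<forall>x\<in>Z. \<forall>u\<in>PC W. V x \<ge> gain (sup_norm u) \<longrightarrow>
           lie_derivative \<phi> V x u \<le> ereal (- \<alpha> (V x))))"


section \<open>Interconnected systems\<close>

text \<open>The spaces \<open>X i\<close> are closed subspaces of one ambient Banach space. This is no loss of
  generality: finitely many Banach spaces embed isometrically as closed subspaces of their direct
  sum with the sum norm.\<close>

definition product_space :: "('n::finite \<Rightarrow> 'a set) \<Rightarrow> ('a ^ 'n) set" where
  "product_space X = {x. \<forall>i. x $ i \<in> X i}"

definition sum_of_norms :: "'a::real_normed_vector ^ 'n::finite \<Rightarrow> real" where
  "sum_of_norms x = (\<Sum>i\<in>UNIV. norm (x $ i))"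

definition product_semigroup ::
  "('n::finite \<Rightarrow> real \<Rightarrow> 'a \<Rightarrow> 'a) \<Rightarrow> real \<Rightarrow> 'a ^ 'n \<Rightarrow> 'a ^ 'n" where
  "product_semigroup T t x = (\<chi> i. T i t (x $ i))"

definition whole_rhs :: "('n::finite \<Rightarrow> 'a ^ 'n \<Rightarrow> 'u \<Rightarrow> 'a) \<Rightarrow> 'a ^ 'n \<Rightarrow> 'u \<Rightarrow> 'a ^ 'n" where
  "whole_rhs f x u = (\<chi> i. f i x u)"

text \<open>An input value of the \<open>i\<close>-th subsystem, a tuple of the \<open>x_j\<close> for \<open>j \<noteq> i\<close> and of \<open>u\<close>, is
  a pair of a vector with \<open>i\<close>-th entry \<open>0\<close> and of \<open>u\<close>.\<close>

definition sub_input_space ::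
  "('n::finite \<Rightarrow> 'a::real_normed_vector set) \<Rightarrow> 'n \<Rightarrow> (('a ^ 'n) \<times> 'u) set" where
  "sub_input_space X i = {z. fst z $ i = 0 \<and> (\<forall>j. j \<noteq> i \<longrightarrow> fst z $ j \<in> X j)}"

definition fill_in :: "'n::finite \<Rightarrow> 'a \<Rightarrow> 'a ^ 'n \<Rightarrow> 'a ^ 'n" where
  "fill_in i x y = (\<chi> j. if j = i then x else y $ j)"

definition sub_rhs ::
  "('n::finite \<Rightarrow> 'a ^ 'n \<Rightarrow> 'u \<Rightarrow> 'a) \<Rightarrow> 'n \<Rightarrow> 'a \<Rightarrow> ('a ^ 'n) \<times> 'u \<Rightarrow> 'a" where
  "sub_rhs f i x z = f i (fill_in i x (fst z)) (snd z)"

text \<open>\<open>V i\<close> is an ISS-Lyapunov function of the \<open>i\<close>-th subsystem with internal gains \<open>\<gamma> i j\<close> and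
  external gain \<open>\<gamma>u i\<close>.\<close>

definition sub_ISS_Lyapunov ::
  "('n::finite \<Rightarrow> 'a::real_normed_vector set) \<Rightarrow> ('n \<Rightarrow> real \<Rightarrow> 'a \<Rightarrow> 'a) \<Rightarrow>
     ('n \<Rightarrow> 'a ^ 'n \<Rightarrow> 'u::real_normed_vector \<Rightarrow> 'a) \<Rightarrow> ('n \<Rightarrow> 'a \<Rightarrow> real) \<Rightarrow>
     ('n \<Rightarrow> 'n \<Rightarrow> real \<Rightarrow> real) \<Rightarrow> ('n \<Rightarrow> real \<Rightarrow> real) \<Rightarrow> 'n \<Rightarrow> bool" where
  "sub_ISS_Lyapunov X T f V \<gamma> \<gamma>u i \<longleftrightarrow>
     continuous_on (X i) (V i) \<and> (\<forall>x\<in>X i. 0 \<le> V i x) \<and>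
     (\<forall>j. j \<noteq> i \<longrightarrow> class_K (\<gamma> i j)) \<and> (\<forall>r\<ge>0. \<gamma> i i r = 0) \<and> class_K (\<gamma>u i) \<and>
     (\<exists>\<psi>1 \<psi>2 \<alpha>. class_Kinf \<psi>1 \<and> class_Kinf \<psi>2 \<and> pos_def \<alpha> \<and>
        (\<forall>x\<in>X i. \<psi>1 (norm x) \<le> V i x \<and> V i x \<le> \<psi>2 (norm x)) \<and>
        (\<forall>x\<in>X i. \<forall>z\<in>sub_input_space X i. \<forall>v\<in>PC (sub_input_space X i). v 0 = z \<longrightarrow>
           V i x \<ge> max (MAX j. \<gamma> i j (V j (fill_in i x (fst z) $ j))) (\<gamma>u i (norm (snd z))) \<longrightarrow>
           lie_derivative (transition_map (T i) (X i) (sub_rhs f i)) (V i) x v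
             \<le> ereal (- \<alpha> (V i x))))"


section \<open>Small-gain condition and \<open>\<Omega>\<close>-paths\<close>

definition gain_operator :: "('n::finite \<Rightarrow> 'n \<Rightarrow> real \<Rightarrow> real) \<Rightarrow> real ^ 'n \<Rightarrow> real ^ 'n" where
  "gain_operator \<gamma> s = (\<chi> i. MAX j. \<gamma> i j (s $ j))"

definition small_gain :: "(real ^ 'n \<Rightarrow> real ^ 'n::finite) \<Rightarrow> bool" where
  "small_gain \<Gamma> \<longleftrightarrow> (\<forall>s. (\<forall>i. 0 \<le> s $ i) \<and> s \<noteq> 0 \<longrightarrow> (\<exists>i. \<Gamma> s $ i < s $ i))"

text \<open>The inverse of a class-\<open>K\<^sub>\<infinity>\<close> function, which maps \<open>{0..}\<close> bijectively onto itself.\<close>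

abbreviation Kinv :: "(real \<Rightarrow> real) \<Rightarrow> real \<Rightarrow> real" where
  "Kinv \<equiv> inv_into {0..}"

definition Omega_path ::
  "(real ^ 'n \<Rightarrow> real ^ 'n::finite) \<Rightarrow> ('n \<Rightarrow> real \<Rightarrow> real) \<Rightarrow> bool" where
  "Omega_path \<Gamma> \<sigma> \<longleftrightarrow>
     (\<forall>i. class_Kinf (\<sigma> i)) \<and>
     (\<forall>i. \<forall>r>0. \<exists>\<delta>>0. \<exists>L. L-lipschitz_on (ball r \<delta> \<inter> {0<..}) (Kinv (\<sigma> i))) \<and>
     (\<forall>P. compact P \<and> P \<subseteq> {0<..} \<longrightarrow>
        (\<exists>K1 K2. 0 < K1 \<and> K1 < K2 \<and>
           (\<forall>i. \<forall>r\<in>P. Kinv (\<sigma> i) differentiable (at r) \<longrightarrow>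
              K1 \<le> deriv (Kinv (\<sigma> i)) r \<and> deriv (Kinv (\<sigma> i)) r \<le> K2))) \<and>
     (\<forall>r>0. \<forall>i. \<Gamma> (\<chi> j. \<sigma> j r) $ i < \<sigma> i r)"

end

theory Submission imports Defs begin

text \<open>Along the path \<open>\<sigma>\<close>, a subsystem attaining the maximum in \<open>V(x) = r\<close> has \<open>V_i(x_i) = \<sigma>_i(r)\<close>,
  which by \<open>\<Gamma>(\<sigma>(r)) < \<sigma>(r)\<close> exceeds all its gains, so \<open>V_i\<close> decays; a lower bound for the slope of
  \<open>\<sigma>_i\<inverse>\<close> turns this into decay of \<open>V\<close>. The bound on \<open>(\<sigma>_i\<inverse>)'\<close> is only assumed where the derivative
  exists and is converted into a bound for chords by Radon-Nikodym and Lebesgue differentiation.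

  For the existence of an \<open>\<Omega>\<close>-path, the rows of \<open>\<Gamma>\<close> are enlarged one by one to \<open>\<eta>_i \<circ> \<Gamma>_i\<close> with
  \<open>\<eta>_i > id\<close>, keeping the small-gain condition. The least solution \<open>q(r)\<close> of
  \<open>q = max(r, \<eta>(\<Gamma>(q)))\<close> then satisfies \<open>\<Gamma>(q(r)) < q(r)\<close>. In a time scale in which \<open>\<Gamma>(q(t + 1)) < q(t)\<close>,
  the average of \<open>q\<close> over \<open>[t, t + 1]\<close> is a continuously differentiable path.\<close>

section \<open>Comparison functions\<close>

text \<open>The small-gain condition excludes nonzero s \<ge> 0 with s \<le> \<Gamma>(s) but names
  no margin, and the path needs one that survives smoothing. It comes from closed loops: a value
  placed at index i returns to row i strictly smaller, so the row can be enlarged by the inverse of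
  a function strictly between the returned value and the identity. The resulting q is a finite
  iteration of maxima, hence continuous, but it may have corners; averaging removes them, and one
  averaging length for all r is possible only in a suitable time scale.

  One scalar equation x' = c(x) on (0, \<infinity>) serves twice: it rescales time on the path, and
  run backwards it is the KL function. The bound c(x) \<le> x keeps solutions from reaching 0 or
  infinity in finite time.

  Where a positive continuous minorant is wanted, of chord slopes or of the margin, it is taken as a
  distance to a set, which is continuous without further work. Upper right derivatives appear as
  estimates for all small h > 0 with an arbitrary slack e. The zero set of V is treated apart,
  because \<Gamma>(\<sigma>(r)) < \<sigma>(r) is available for r > 0 only.\<close>

lemma continuous_on_Max_image:
  fixes f :: "'i \<Rightarrow> 'b::topological_space \<Rightarrow> real"
  assumes "finite I" "I \<noteq> {}" "\<And>i. i \<in> I \<Longrightarrow> continuous_on S (f i)"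
  shows "continuous_on S (\<lambda>x. MAX i\<in>I. f i x)"
  using assms
proof (induction I rule: finite_ne_induct)
  case (insert i I)
  then have "(\<lambda>x. MAX j\<in>insert i I. f j x) = (\<lambda>x. max (f i x) (MAX j\<in>I. f j x))"
    by (auto simp: fun_eq_iff)
  with insert show ?case by (simp add: continuous_on_max)
qed auto

lemma continuous_on_Min_image:
  fixes f :: "'i \<Rightarrow> 'b::topological_space \<Rightarrow> real"
  assumes "finite I" "I \<noteq> {}" "\<And>i. i \<in> I \<Longrightarrow> continuous_on S (f i)"
  shows "continuous_on S (\<lambda>x. MIN i\<in>I. f i x)"
  using assms
proof (induction I rule: finite_ne_induct)
  case (insert i I)
  then have "(\<lambda>x. MIN j\<in>insert i I. f j x) = (\<lambda>x. min (f i x) (MIN j\<in>I. f j x))"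
    by (auto simp: fun_eq_iff)
  with insert show ?case by (simp add: continuous_on_min)
qed auto

lemma Max_range_le_iff: "(MAX i. f i) \<le> (y::real) \<longleftrightarrow> (\<forall>i. f i \<le> y)" for f :: "'n::finite \<Rightarrow> real"
  by (subst Max_le_iff) auto

lemma Max_range_less_iff: "(MAX i. f i) < (y::real) \<longleftrightarrow> (\<forall>i. f i < y)" for f :: "'n::finite \<Rightarrow> real"
  by (subst Max_less_iff) auto

lemma le_Max_range_iff: "(y::real) \<le> (MAX i. f i) \<longleftrightarrow> (\<exists>i. y \<le> f i)" for f :: "'n::finite \<Rightarrow> real"
  by (subst Max_ge_iff) auto

lemma Max_range_ge: "f i \<le> (MAX i. f i)" for f :: "'n::finite \<Rightarrow> real"
  by (rule Max_ge) auto

lemma Max_range_attained: "\<exists>i. (MAX i. f i) = f i" for f :: "'n::finite \<Rightarrow> real"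
proof -
  have "(MAX i. f i) \<in> range f" by (rule Max_in) auto
  then show ?thesis by blast
qed

lemma Min_range_attained: "\<exists>i. (MIN i. f i) = f i" for f :: "'n::finite \<Rightarrow> real"
proof -
  have "(MIN i. f i) \<in> range f" by (rule Min_in) auto
  then show ?thesis by blast
qed

lemma Min_range_le: "(MIN i. f i) \<le> f i" for f :: "'n::finite \<Rightarrow> real"
  by (rule Min_le) auto

lemma class_K_continuous: "class_K g \<Longrightarrow> continuous_on {0..} g"
  and class_K_zero: "class_K g \<Longrightarrow> g 0 = 0"
  and class_K_less: "class_K g \<Longrightarrow> 0 \<le> x \<Longrightarrow> x < y \<Longrightarrow> g x < g y"
  by (auto simp: class_K_def strict_mono_on_def)

lemma class_K_le: "class_K g \<Longrightarrow> 0 \<le> x \<Longrightarrow> x \<le> y \<Longrightarrow> g x \<le> g y"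
  using class_K_less[of g x y] by (cases "x = y") auto

lemma class_K_pos: "class_K g \<Longrightarrow> 0 < x \<Longrightarrow> 0 < g x"
  using class_K_less[of g 0 x] class_K_zero[of g] by auto

lemma class_K_nonneg: "class_K g \<Longrightarrow> 0 \<le> x \<Longrightarrow> 0 \<le> g x"
  using class_K_le[of g 0 x] class_K_zero[of g] by auto

lemma class_K_le_iff: "class_K g \<Longrightarrow> 0 \<le> x \<Longrightarrow> 0 \<le> y \<Longrightarrow> g x \<le> g y \<longleftrightarrow> x \<le> y"
  using class_K_le[of g x y] class_K_less[of g y x] by linarith

lemma class_KI:
  assumes "continuous_on {0..} g" "\<And>x y. 0 \<le> x \<Longrightarrow> x < y \<Longrightarrow> g x < g y" "g 0 = 0"
  shows "class_K g"
  using assms by (auto simp: class_K_def strict_mono_on_def)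

lemma class_K_compose:
  assumes "class_K f" "class_K g" shows "class_K (\<lambda>r. f (g r))"
proof (rule class_KI)
  show "continuous_on {0..} (\<lambda>r. f (g r))"
    by (rule continuous_on_compose2[OF class_K_continuous[OF assms(1)] class_K_continuous[OF assms(2)]])
      (use class_K_nonneg[OF assms(2)] in auto)
  show "f (g x) < f (g y)" if "0 \<le> x" "x < y" for x y
    by (rule class_K_less[OF assms(1) class_K_nonneg[OF assms(2)] class_K_less[OF assms(2)]]) fact+
qed (use assms in \<open>simp add: class_K_zero\<close>)

lemma class_Kinf_imp_K: "class_Kinf g \<Longrightarrow> class_K g"
  by (simp add: class_Kinf_def)

lemma class_KinfI:
  assumes "class_K g" "\<And>M. \<exists>r\<ge>0. M \<le> g r"
  shows "class_Kinf g"
  unfolding class_Kinf_def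
proof (intro conjI notI)
  assume "bounded (g ` {0..})"
  then obtain B where B: "\<And>r. r \<ge> 0 \<Longrightarrow> \<bar>g r\<bar> \<le> B"
    by (auto simp: bounded_iff)
  then show False using assms(2)[of "B+1"] by fastforce
qed fact

lemma class_Kinf_unbounded:
  assumes "class_Kinf g" shows "\<exists>r\<ge>0. M \<le> g r"
proof (rule ccontr)
  assume *: "\<not> ?thesis"
  then have "\<bar>g r\<bar> \<le> M" if "r \<ge> 0" for r
    using class_K_nonneg[OF class_Kinf_imp_K[OF assms] that] that by force
  then have "bounded (g ` {0..})" by (auto simp: bounded_iff)
  with assms show False by (simp add: class_Kinf_def)
qed

lemma class_Kinf_compose:
  assumes "class_Kinf f" "class_Kinf g" shows "class_Kinf (\<lambda>r. f (g r))"
proof (rule class_KinfI)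
  show "class_K (\<lambda>r. f (g r))"
    by (rule class_K_compose[OF assms[THEN class_Kinf_imp_K]])
  fix M
  obtain a where a: "a \<ge> 0" "M \<le> f a" using class_Kinf_unbounded[OF assms(1)] by blast
  obtain r where r: "r \<ge> 0" "a \<le> g r" using class_Kinf_unbounded[OF assms(2)] by blast
  have "M \<le> f (g r)"
    using class_K_le[OF class_Kinf_imp_K[OF assms(1)] a(1) r(2)] a(2) by simp
  with r show "\<exists>r\<ge>0. M \<le> f (g r)" by blast
qed

lemma class_Kinf_image: "class_Kinf g \<Longrightarrow> g ` {0..} = {0..}"
proof (intro equalityI subsetI)
  assume g: "class_Kinf g"
  note K = class_Kinf_imp_K[OF g]
  { fix y assume "y \<in> g ` {0..}" then show "y \<in> {0..}" using class_K_nonneg[OF K] by auto }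
  fix y :: real assume y: "y \<in> {0..}"
  obtain r where r: "r \<ge> 0" "y \<le> g r" using class_Kinf_unbounded[OF g] by blast
  have "\<exists>x\<ge>0. x \<le> r \<and> g x = y"
    by (rule IVT') (use r y class_K_zero[OF K] in
      \<open>auto intro: continuous_on_subset[OF class_K_continuous[OF K]]\<close>)
  then show "y \<in> g ` {0..}" by auto
qed

section \<open>Inverses of unbounded comparison functions\<close>

lemma Kinv_nonneg: "class_Kinf g \<Longrightarrow> 0 \<le> y \<Longrightarrow> 0 \<le> Kinv g y"
  using inv_into_into[of y g "{0..}"] class_Kinf_image[of g] by auto

lemma Kinv_right: "class_Kinf g \<Longrightarrow> 0 \<le> y \<Longrightarrow> g (Kinv g y) = y"
  using f_inv_into_f[of y g "{0..}"] class_Kinf_image[of g] by auto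

lemma Kinv_left: "class_Kinf g \<Longrightarrow> 0 \<le> x \<Longrightarrow> Kinv g (g x) = x"
  by (rule inv_into_f_f)
    (auto simp: class_Kinf_def class_K_def intro: strict_mono_on_imp_inj_on)

lemma Kinv_le_iff: "class_Kinf g \<Longrightarrow> 0 \<le> x \<Longrightarrow> 0 \<le> y \<Longrightarrow> Kinv g y \<le> x \<longleftrightarrow> y \<le> g x"
  using class_K_le_iff[of g "Kinv g y" x] Kinv_right[of g y] Kinv_nonneg[of g y] class_Kinf_imp_K
  by auto

lemma le_Kinv_iff: "class_Kinf g \<Longrightarrow> 0 \<le> x \<Longrightarrow> 0 \<le> y \<Longrightarrow> x \<le> Kinv g y \<longleftrightarrow> g x \<le> y"
  using class_K_le_iff[of g x "Kinv g y"] Kinv_right[of g y] Kinv_nonneg[of g y] class_Kinf_imp_K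
  by auto

lemma Kinv_less_iff: "class_Kinf g \<Longrightarrow> 0 \<le> x \<Longrightarrow> 0 \<le> y \<Longrightarrow> Kinv g y < x \<longleftrightarrow> y < g x"
  using le_Kinv_iff[of g x y] by auto

lemma less_Kinv_iff: "class_Kinf g \<Longrightarrow> 0 \<le> x \<Longrightarrow> 0 \<le> y \<Longrightarrow> x < Kinv g y \<longleftrightarrow> g x < y"
  using Kinv_le_iff[of g x y] by auto

lemma class_Kinf_Kinv:
  assumes g: "class_Kinf g" shows "class_Kinf (Kinv g)"
proof (rule class_KinfI[OF class_KI])
  note K = class_Kinf_imp_K[OF g]
  show "Kinv g 0 = 0"
    using Kinv_left[OF g, of 0] class_K_zero[OF K] by simp
  show "Kinv g x < Kinv g y" if "0 \<le> x" "x < y" for x y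
    using that Kinv_less_iff[OF g, of "Kinv g y" x] Kinv_right[OF g, of y] Kinv_nonneg[OF g, of y] by auto
  show "\<exists>r\<ge>0. M \<le> Kinv g r" for M
    using Kinv_left[OF g, of "max M 0"] class_K_nonneg[OF K, of "max M 0"] by (intro exI[of _ "g (max M 0)"]) auto
  show "continuous_on {0..} (Kinv g)"
    unfolding continuous_on_iff
  proof (intro ballI allI impI)
    fix y e :: real assume y: "y \<in> {0..}" and e: "0 < e"
    define x where "x = Kinv g y"
    have x: "0 \<le> x" "g x = y" using y Kinv_nonneg[OF g] Kinv_right[OF g] by (auto simp: x_def)
    have up: "y < g (x + e)" using class_K_less[OF K, of x "x+e"] x e by auto
    \<comment> \<open>For x < e the lower estimate holds because \<open>Kinv g\<close> is
      nonnegative, so any positive default does.\<close>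
    define d where "d = min (g (x + e) - y) (if x - e \<ge> 0 then y - g (x - e) else 1)"
    have d: "d > 0" using up class_K_less[OF K, of "x-e" x] x e by (auto simp: d_def)
    show "\<exists>d>0. \<forall>y'\<in>{0..}. dist y' y < d \<longrightarrow> dist (Kinv g y') (Kinv g y) < e"
    proof (intro exI conjI ballI impI)
      fix y' :: real assume y': "y' \<in> {0..}" "dist y' y < d"
      have "Kinv g y' < x + e"
        using y' x e by (subst Kinv_less_iff[OF g]) (auto simp: d_def dist_real_def)
      moreover have "x - e < Kinv g y'"
      proof (cases "x - e \<ge> 0")
        case True
        then show ?thesis using y'
          by (subst less_Kinv_iff[OF g]) (auto simp: d_def dist_real_def)
      qed (use Kinv_nonneg[OF g, of y'] y' in auto)
      ultimately show "dist (Kinv g y') (Kinv g y) < e" by (auto simp: x_def dist_real_def)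
    qed fact
  qed
qed

section \<open>Finite maxima and minima of comparison functions\<close>

lemma class_K_Max:
  fixes g :: "'n::finite \<Rightarrow> real \<Rightarrow> real"
  assumes g: "\<And>i. class_K (g i)" shows "class_K (\<lambda>r. MAX i. g i r)"
proof (rule class_KI)
  show "continuous_on {0..} (\<lambda>r. MAX i. g i r)"
    by (rule continuous_on_Max_image) (auto simp: class_K_continuous[OF g])
  show "(MAX i. g i x) < (MAX i. g i y)" if "0 \<le> x" "x < y" for x y
  proof (subst Max_range_less_iff, rule allI)
    fix i show "g i x < (MAX i. g i y)"
      by (rule order_less_le_trans[OF class_K_less[OF g that] Max_range_ge])
  qed
qed (simp add: class_K_zero[OF g])

lemma class_Kinf_Max:
  fixes g :: "'n::finite \<Rightarrow> real \<Rightarrow> real"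
  assumes g: "\<And>i. class_Kinf (g i)" shows "class_Kinf (\<lambda>r. MAX i. g i r)"
proof (rule class_KinfI)
  show "class_K (\<lambda>r. MAX i. g i r)" by (rule class_K_Max[OF class_Kinf_imp_K[OF g]])
  show "\<exists>r\<ge>0. M \<le> (MAX i. g i r)" for M
  proof -
    obtain r where r: "r \<ge> 0" "M \<le> g undefined r" using class_Kinf_unbounded[OF g] by blast
    have "M \<le> (MAX i. g i r)" using r(2) by (rule order_trans[OF _ Max_range_ge])
    with r(1) show ?thesis by blast
  qed
qed

lemma class_Kinf_Min:
  fixes g :: "'n::finite \<Rightarrow> real \<Rightarrow> real"
  assumes g: "\<And>i. class_Kinf (g i)" shows "class_Kinf (\<lambda>r. MIN i. g i r)"
proof (rule class_KinfI[OF class_KI])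
  note K = class_Kinf_imp_K[OF g]
  show "continuous_on {0..} (\<lambda>r. MIN i. g i r)"
    by (rule continuous_on_Min_image) (auto simp: class_K_continuous[OF K])
  show "(MIN i. g i x) < (MIN i. g i y)" if "0 \<le> x" "x < y" for x y
  proof -
    obtain i where i: "(MIN i. g i y) = g i y" using Min_range_attained[of "\<lambda>i. g i y"] by blast
    have "(MIN i. g i x) \<le> g i x" by (rule Min_range_le)
    also have "\<dots> < g i y" by (rule class_K_less[OF K that])
    finally show ?thesis using i by simp
  qed
  show "(MIN i. g i 0) = 0" by (simp add: class_K_zero[OF K])
  fix M
  have "\<forall>i. \<exists>r\<ge>0. M \<le> g i r" using class_Kinf_unbounded[OF g] by blast
  then obtain r where r: "\<And>i. r i \<ge> 0" "\<And>i. M \<le> g i (r i)" by metis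
  define R where "R = (MAX i. r i)"
  have rR: "r i \<le> R" for i unfolding R_def by (rule Max_range_ge)
  have "R \<ge> 0" by (rule order_trans[OF r(1) rR])
  have MR: "M \<le> g i R" for i by (rule order_trans[OF r(2) class_K_le[OF K r(1) rR]])
  obtain j where "(MIN i. g i R) = g j R" using Min_range_attained[of "\<lambda>i. g i R"] by blast
  with MR \<open>R \<ge> 0\<close> show "\<exists>r\<ge>0. M \<le> (MIN i. g i r)" by auto
qed

section \<open>Time change for a scalar autonomous equation\<close>

text \<open>\<open>p\<close> is the flow of p' = c(p) and \<open>H\<close> the time along it. Since
  c x \<le> x, the integrand 1 / c x is at least 1 / x, whose integral diverges at 0 and at
  infinity; so \<open>H\<close> maps onto the whole line and \<open>p\<close> is defined for all
  times.\<close>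

lemma time_change:
  fixes c :: "real \<Rightarrow> real"
  assumes cont: "continuous_on {0<..} c" and pos: "\<And>x. 0 < x \<Longrightarrow> 0 < c x"
    and le: "\<And>x. 0 < x \<Longrightarrow> c x \<le> x"
  obtains H p where
    "\<And>x. 0 < x \<Longrightarrow> (H has_real_derivative 1 / c x) (at x)"
    "\<And>x. 0 < x \<Longrightarrow> p (H x) = x" "\<And>t. 0 < p t" "\<And>t. H (p t) = t"
    "continuous_on UNIV p" "strict_mono p" "strict_mono_on {0<..} H"
proof -
  have "isCont (\<lambda>x. 1 / c x) x" if "0 < x" for x
    using cont that pos[OF that] continuous_on_interior[OF cont, of x]
    by (intro continuous_intros) (auto simp: interior_open)
  then obtain H where "\<forall>x::real. (0::ereal) < x \<longrightarrow> x < \<infinity> \<longrightarrow> (H has_vector_derivative 1 / c x) (at x)"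
    using einterval_antiderivative[of 0 \<infinity> "\<lambda>x. 1 / c x"] by (auto simp: zero_ereal_def)
  then have H: "(H has_real_derivative 1 / c x) (at x)" if "0 < x" for x
    using that by (auto simp: zero_ereal_def has_real_derivative_iff_has_vector_derivative)
  have smono: "H x < H y" if "0 < x" "x < y" for x y
  proof (rule DERIV_pos_imp_increasing[OF \<open>x < y\<close>])
    fix z assume "x \<le> z" "z \<le> y"
    then show "\<exists>D. (H has_real_derivative D) (at z) \<and> 0 < D"
      using H[of z] pos[of z] that by (intro exI[of _ "1 / c z"]) auto
  qed
  have ln_le: "H x - ln x \<le> H y - ln y" if "0 < x" "x \<le> y" for x y
  proof (rule DERIV_nonneg_imp_nondecreasing[OF \<open>x \<le> y\<close>])
    fix z assume z: "x \<le> z" "z \<le> y"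
    then have "0 < z" using that by simp
    then have "((\<lambda>x. H x - ln x) has_real_derivative 1 / c z - 1 / z) (at z)"
      by (auto intro!: derivative_eq_intros H simp: field_simps)
    moreover have "0 \<le> 1 / c z - 1 / z"
      using le[OF \<open>0 < z\<close>] pos[OF \<open>0 < z\<close>] \<open>0 < z\<close> by (auto simp: field_simps)
    ultimately show "\<exists>D. ((\<lambda>x. H x - ln x) has_real_derivative D) (at z) \<and> 0 \<le> D" by blast
  qed
  have Hcont: "continuous_on {0<..} H"
    using H by (auto intro!: continuous_at_imp_continuous_on DERIV_isCont)
  have surj: "\<exists>x>0. H x = t" for t
  proof -
    \<comment> \<open>\<open>H - ln\<close> is nondecreasing, so moving from 1 to exp d raises
      \<open>H\<close> by at least d, and moving to exp (- d) lowers it by at least d. With d =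
      \<open>\<bar>t - H 1\<bar>\<close> the value t is enclosed.\<close>
    define a where "a = exp (- \<bar>t - H 1\<bar>)"
    define b where "b = exp \<bar>t - H 1\<bar>"
    have ab: "0 < a" "a \<le> 1" "1 \<le> b" by (auto simp: a_def b_def)
    have "H a \<le> t" using ln_le[of a 1] ab by (auto simp: a_def)
    moreover have "t \<le> H b" using ln_le[of 1 b] ab by (auto simp: b_def)
    moreover have "continuous_on {a..b} H"
      by (rule continuous_on_subset[OF Hcont]) (use ab in auto)
    ultimately obtain x where "a \<le> x" "H x = t"
      using IVT'[of H a t b] ab by force
    then show ?thesis using ab(1) by (intro exI[of _ x]) auto
  qed
  define p where "p t = (SOME x. 0 < x \<and> H x = t)" for t
  have p: "0 < p t" "H (p t) = t" for t
    using someI_ex[of "\<lambda>x. 0 < x \<and> H x = t"] surj[of t] by (auto simp: p_def)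
  have pH: "p (H x) = x" if "0 < x" for x
    using smono[of x "p (H x)"] smono[of "p (H x)" x] p[of "H x"] that by (cases x "p (H x)" rule: linorder_cases) auto
  have pmono: "p s < p t" if "s < t" for s t
    using smono[of "p t" "p s"] p[of s] p[of t] that by (cases "p s" "p t" rule: linorder_cases) auto
  \<comment> \<open>A monotone function with open image has no jumps.\<close>
  have "range p = {0<..}"
    using p(1) pH by (metis (no_types, lifting) greaterThan_iff image_eqI rangeE UNIV_I subsetI subset_antisym)
  then have "continuous_on UNIV p"
    using pmono by (intro continuous_onI_mono) (auto simp: order_le_less)
  moreover have "strict_mono p" "strict_mono_on {0<..} H"
    using pmono smono by (auto simp: strict_mono_def strict_mono_on_def)
  ultimately show thesis
    using that[of H p] H pH p by blast
qed

section \<open>Slopes of Lipschitz functions\<close>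

text \<open>Subtracting \<open>G\<close> from a line of slope at least \<open>L\<close> leaves a
  nondecreasing function \<open>K\<close>, and the measures of \<open>G\<close> and \<open>K\<close>
  add up to a multiple of Lebesgue measure. A Lebesgue null set is therefore null for each
  summand.\<close>

lemma interval_measure_absolutely_continuous:
  fixes G :: "real \<Rightarrow> real"
  assumes mono: "mono G" and lip: "\<And>x y. x \<le> y \<Longrightarrow> G y - G x \<le> L * (y - x)"
  shows "absolutely_continuous lborel (interval_measure G)"
proof -
  \<comment> \<open>The maximum with 1 makes the slope positive, so that one can divide by
    it.\<close>
  define L' where "L' = max L 1"
  have L': "0 < L'" by (simp add: L'_def)
  have lip': "G y - G x \<le> L' * (y - x)" if "x \<le> y" for x y
  proof -
    have "L * (y - x) \<le> L' * (y - x)" using that by (intro mult_right_mono) (auto simp: L'_def)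
    with lip[OF that] show ?thesis by simp
  qed
  define K where "K x = L' * x - G x" for x
  have monoK: "K x \<le> K y" if "x \<le> y" for x y
    using lip'[OF that] by (simp add: K_def algebra_simps)
  have Gmono: "G x \<le> G y" if "x \<le> y" for x y using mono that by (rule monoD)
  have "L'-lipschitz_on UNIV G"
  proof (rule lipschitz_onI)
    fix x y :: real
    show "dist (G x) (G y) \<le> L' * dist x y"
      using lip'[of x y] lip'[of y x] Gmono[of x y] Gmono[of y x]
      by (cases "x \<le> y") (auto simp: dist_real_def)
  qed (use L' in simp)
  then have contG: "continuous_on UNIV G" by (rule lipschitz_on_continuous_on)
  then have contK: "continuous_on UNIV K" unfolding K_def by (intro continuous_intros)
  \<comment> \<open>Lebesgue measure is recognized by its values on open boxes, while interval
    measures are given on half-open intervals; continuity removes the end point.\<close>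
  have Ioo: "emeasure (interval_measure F) {l<..<u} = ennreal (F u - F l)"
    if "l \<le> u" "\<And>x y. x \<le> y \<Longrightarrow> F x \<le> F y" "continuous_on UNIV F" for F l and u :: real
  proof (cases "l < u")
    case True
    have rc: "continuous (at_right a) F" for a
      using that(3) by (auto intro: continuous_within_subset simp: continuous_on_eq_continuous_within)
    have "{l<..<u} = {l<..u} - {u..u}" using True by auto
    moreover have "emeasure (interval_measure F) {u..u} = 0"
      using emeasure_interval_measure_Icc[of u u F] that by simp
    ultimately show ?thesis
      using True emeasure_interval_measure_Ioc[of l u F] that rc
      by (simp add: emeasure_Diff)
  qed (use that in auto)
  define P where "P = measure_of UNIV (sets borel)
    (\<lambda>A. (emeasure (interval_measure G) A + emeasure (interval_measure K) A) / ennreal L')"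
  have sP: "sets P = sets borel" by (simp add: P_def sets.sigma_sets_eq[of borel, simplified])
  have eP: "emeasure P A = (emeasure (interval_measure G) A + emeasure (interval_measure K) A) / ennreal L'"
    if "A \<in> sets borel" for A
    unfolding P_def
  proof (rule emeasure_measure_of_sigma)
    show "sigma_algebra UNIV (sets (borel :: real measure))"
      using sets.sigma_algebra_axioms[of borel] by simp
    show "countably_additive (sets borel)
      (\<lambda>A. (emeasure (interval_measure G) A + emeasure (interval_measure K) A) / ennreal L')"
    proof (rule countably_additiveI)
      fix A :: "nat \<Rightarrow> real set"
      assume A: "range A \<subseteq> sets borel" "disjoint_family A" "\<Union> (range A) \<in> sets borel"
      have "(\<Sum>i. (emeasure (interval_measure G) (A i) + emeasure (interval_measure K) (A i)) / ennreal L')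
        = (\<Sum>i. emeasure (interval_measure G) (A i) + emeasure (interval_measure K) (A i)) / ennreal L'"
        by (simp add: divide_ennreal_def)
      also have "\<dots> = ((\<Sum>i. emeasure (interval_measure G) (A i)) + (\<Sum>i. emeasure (interval_measure K) (A i))) / ennreal L'"
        by (subst suminf_add) auto
      also have "\<dots> = (emeasure (interval_measure G) (\<Union> (range A)) + emeasure (interval_measure K) (\<Union> (range A))) / ennreal L'"
        using A by (simp add: suminf_emeasure)
      finally show "(\<Sum>i. (emeasure (interval_measure G) (A i) + emeasure (interval_measure K) (A i)) / ennreal L')
        = (emeasure (interval_measure G) (\<Union> (range A)) + emeasure (interval_measure K) (\<Union> (range A))) / ennreal L'" .
    qed
  qed (use that in \<open>auto simp: positive_def\<close>)
  have "lborel = P"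
  proof (rule lborel_eqI)
    fix l u :: real
    assume "\<And>b. b \<in> Basis \<Longrightarrow> l \<bullet> b \<le> u \<bullet> b"
    then have lu: "l \<le> u" by simp
    have "emeasure P (box l u) = (ennreal (G u - G l) + ennreal (K u - K l)) / ennreal L'"
      using lu Gmono monoK contG contK by (simp add: eP Ioo)
    also have "\<dots> = ennreal (L' * (u - l)) / ennreal L'"
      using Gmono[OF lu] monoK[OF lu] by (simp add: ennreal_plus[symmetric] K_def algebra_simps del: ennreal_plus)
    also have "\<dots> = ennreal (u - l)" using lu L' by (subst divide_ennreal) auto
    finally show "emeasure P (box l u) = ennreal (\<Prod>b\<in>Basis. (u - l) \<bullet> b)" by simp
  qed (simp add: sP)
  then have "emeasure (interval_measure G) A = 0" if "A \<in> sets borel" "emeasure lborel A = 0" for A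
    using eP[of A] that L' by (auto simp: ennreal_divide_eq_0_iff)
  then show ?thesis by (auto simp: absolutely_continuous_def null_sets_def)
qed

text \<open>The density is the Radon-Nikodym derivative of the Stieltjes measure of
  \<open>G\<close>. It is finite almost everywhere since that measure is sigma-finite, so replacing
  extended values by reals does not change the integral.\<close>

lemma lipschitz_mono_density:
  fixes G :: "real \<Rightarrow> real"
  assumes mono: "mono G" and lip: "\<And>x y. x \<le> y \<Longrightarrow> G y - G x \<le> L * (y - x)"
    and cont: "continuous_on UNIV G"
  obtains d where "\<And>x y. x \<le> y \<Longrightarrow> (d has_integral (G y - G x)) {x..y}"
proof -
  let ?M = "interval_measure G"
  have Gmono: "G x \<le> G y" if "x \<le> y" for x y using mono that by (rule monoD)
  have rc: "continuous (at_right a) G" for a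
    using cont by (auto intro: continuous_within_subset simp: continuous_on_eq_continuous_within)
  have ac: "absolutely_continuous lborel ?M" by (rule interval_measure_absolutely_continuous[OF assms(1,2)])
  have sf: "sigma_finite_measure ?M" by (rule sigma_finite_interval_measure[OF Gmono rc])
  define f where "f = RN_deriv lborel ?M"
  have [measurable]: "f \<in> borel_measurable borel"
    unfolding f_def using borel_measurable_RN_deriv[of lborel ?M] by simp
  have dens: "density lborel f = ?M"
    unfolding f_def by (rule sigma_finite_measure.density_RN_deriv[OF sigma_finite_lborel ac]) simp
  have fin: "AE x in lborel. f x \<noteq> \<infinity>"
    unfolding f_def by (rule sigma_finite_measure.RN_deriv_finite[OF sigma_finite_lborel sf ac]) simp
  define d where "d x = enn2real (f x)" for x
  have [measurable]: "d \<in> borel_measurable borel" unfolding d_def by measurable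
  have "(d has_integral (G y - G x)) {x..y}" if "x \<le> y" for x y
  proof -
    have "(\<integral>\<^sup>+ t. ennreal (d t * indicator {x..y} t) \<partial>lborel) = (\<integral>\<^sup>+ t. f t * indicator {x..y} t \<partial>lborel)"
      by (rule nn_integral_cong_AE) (use fin in \<open>auto elim!: eventually_mono simp: d_def indicator_def less_top\<close>)
    also have "\<dots> = emeasure (density lborel f) {x..y}"
      by (subst emeasure_density) auto
    also have "\<dots> = ennreal (G y - G x)"
      unfolding dens using emeasure_interval_measure_Icc[OF that Gmono cont] by simp
    finally have "((\<lambda>t. d t * indicator {x..y} t) has_integral (G y - G x)) UNIV"
      using Gmono[OF that] by (intro nn_integral_has_integral) (auto simp: d_def)
    then show ?thesis
      by (subst has_integral_restrict_UNIV[symmetric]) (simp add: indicator_def of_bool_def if_distrib cong: if_cong)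
  qed
  then show thesis by (rule that)
qed

text \<open>A monotone Lipschitz function is the integral of a density, which by Lebesgue
  differentiation is its derivative almost everywhere. Integrating the pointwise bound
  \<open>K\<close> then gives the bound for the chord.\<close>

lemma lipschitz_mono_slope_ge:
  fixes g :: "real \<Rightarrow> real"
  assumes ab: "a < b" and lip: "L-lipschitz_on {a..b} g" and mono: "mono_on {a..b} g"
    and K: "\<And>x. a < x \<Longrightarrow> x < b \<Longrightarrow> g differentiable (at x) \<Longrightarrow> K \<le> deriv g x"
  shows "K * (b - a) \<le> g b - g a"
proof -
  \<comment> \<open>Freezing \<open>g\<close> outside {a..b} gives a function on the whole line that
    is still monotone and Lipschitz.\<close>
  define cl where "cl x = max a (min b x)" for x
  have cl: "cl x \<in> {a..b}" for x using ab by (auto simp: cl_def)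
  have clm: "cl x \<le> cl y" "cl y - cl x \<le> y - x" if "x \<le> y" for x y
    using ab that by (auto simp: cl_def)
  define G where "G x = g (cl x)" for x
  have monoG: "mono G"
    using mono cl clm by (auto simp: G_def mono_on_def intro!: monoI)
  have L0: "0 \<le> L" using lip by (rule lipschitz_on_nonneg)
  have lipG: "G y - G x \<le> L * (y - x)" if "x \<le> y" for x y
  proof -
    have "dist (g (cl y)) (g (cl x)) \<le> L * dist (cl y) (cl x)"
      using lip cl by (auto simp: lipschitz_on_def)
    then have "G y - G x \<le> L * (cl y - cl x)" using clm[OF that] by (auto simp: G_def dist_real_def)
    also have "\<dots> \<le> L * (y - x)" using clm[OF that] L0 by (intro mult_left_mono) auto
    finally show ?thesis .
  qed
  have "continuous_on UNIV (\<lambda>x. g (cl x))"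
    by (rule continuous_on_compose2[OF lipschitz_on_continuous_on[OF lip]])
      (use cl in \<open>auto simp: cl_def intro!: continuous_intros\<close>)
  then have contG: "continuous_on UNIV G" by (simp add: G_def[abs_def])
  obtain d where d: "\<And>x y. x \<le> y \<Longrightarrow> (d has_integral (G y - G x)) {x..y}"
    using lipschitz_mono_density[OF monoG lipG contG] by blast
  \<comment> \<open>The differentiation theorem uses intervals to the right of a point only; left
    difference quotients are right quotients of the reflected density.\<close>
  have d': "((\<lambda>t. d (- t)) has_integral (G (- x) - G (- y))) {x..y}" if "x \<le> y" for x y
    using has_integral_reflect_lemma_real[OF d[of "- y" "- x"]] that by simp
  have int: "d integrable_on cbox x y" for x y :: real
    using d[of x y] by (cases "x \<le> y") auto
  have int': "(\<lambda>t. d (- t)) integrable_on cbox x y" for x y :: real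
    using d'[of x y] by (cases "x \<le> y") auto
  obtain N1 where N1: "negligible N1"
    "\<And>x e. \<lbrakk>x \<notin> N1; 0 < e\<rbrakk> \<Longrightarrow> \<exists>\<delta>>0. \<forall>h. 0 < h \<and> h < \<delta> \<longrightarrow>
       norm (integral (cbox x (x + h *\<^sub>R One)) d /\<^sub>R h ^ DIM(real) - d x) < e"
    using integrable_ccontinuous_explicit[of d] int by blast
  obtain N2 where N2: "negligible N2"
    "\<And>x e. \<lbrakk>x \<notin> N2; 0 < e\<rbrakk> \<Longrightarrow> \<exists>\<delta>>0. \<forall>h. 0 < h \<and> h < \<delta> \<longrightarrow>
       norm (integral (cbox x (x + h *\<^sub>R One)) (\<lambda>t. d (- t)) /\<^sub>R h ^ DIM(real) - d (- x)) < e"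
    using integrable_ccontinuous_explicit[of "\<lambda>t. d (- t)"] int' by blast
  \<comment> \<open>The end points are added because \<open>G\<close> agrees with \<open>g\<close>
    in a neighbourhood of interior points only.\<close>
  define N where "N = N1 \<union> uminus ` N2 \<union> {a, b}"
  have negN: "negligible N"
    unfolding N_def using N1(1) N2(1)
    by (intro negligible_Un negligible_differentiable_image_negligible)
      (auto intro!: derivative_intros simp: differentiable_on_def)
  have deriv: "(G has_real_derivative d x) (at x)" if "x \<notin> N" for x
    unfolding DERIV_def LIM_eq
  proof (intro allI impI)
    fix e :: real assume e: "0 < e"
    from that have "x \<notin> N1" "- x \<notin> N2" by (auto simp: N_def image_iff)
    with N1(2) N2(2) e obtain \<delta>1 \<delta>2 where \<delta>: "\<delta>1 > 0" "\<delta>2 > 0"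
      "\<And>h. 0 < h \<Longrightarrow> h < \<delta>1 \<Longrightarrow> norm (integral (cbox x (x + h *\<^sub>R One)) d /\<^sub>R h ^ DIM(real) - d x) < e"
      "\<And>h. 0 < h \<Longrightarrow> h < \<delta>2 \<Longrightarrow>
         norm (integral (cbox (- x) (- x + h *\<^sub>R One)) (\<lambda>t. d (- t)) /\<^sub>R h ^ DIM(real) - d (- (- x))) < e"
      by metis
    show "\<exists>s>0. \<forall>h. h \<noteq> 0 \<and> norm (h - 0) < s \<longrightarrow> norm ((G (x + h) - G x) / h - d x) < e"
    proof (intro exI[of _ "min \<delta>1 \<delta>2"] conjI allI impI)
      fix h :: real assume h: "h \<noteq> 0 \<and> norm (h - 0) < min \<delta>1 \<delta>2"
      show "norm ((G (x + h) - G x) / h - d x) < e"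
      proof (cases "h > 0")
        case True
        have "integral {x..x + h} d = G (x + h) - G x"
          using d[of x "x + h"] True by (intro integral_unique) auto
        then show ?thesis using \<delta>(3)[of h] True h by (simp add: divide_inverse mult.commute)
      next
        case False
        then have h': "- h > 0" using h by simp
        have "integral {- x..- x + (- h)} (\<lambda>t. d (- t)) = G x - G (x + h)"
          using d'[of "- x" "- x + (- h)"] h' by (intro integral_unique) (auto simp: add.commute)
        then have "norm ((G x - G (x + h)) / (- h) - d x) < e"
          using \<delta>(4)[of "- h"] h' h by (simp add: divide_inverse mult.commute)
        moreover have "(G x - G (x + h)) / (- h) = (G (x + h) - G x) / h"
          using h by (simp add: field_simps)
        ultimately show ?thesis by simp
      qed
    qed (use \<delta> in auto)
  qed
  have dK: "K \<le> d x" if "x \<in> {a..b} - N" for x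
  proof -
    have x: "a < x" "x < b" "x \<notin> N" using that by (auto simp: N_def order_le_less)
    have "(g has_real_derivative d x) (at x)"
      by (rule has_field_derivative_transform_within_open[OF deriv[OF x(3)], of "{a<..<b}"])
        (use x in \<open>auto simp: G_def cl_def\<close>)
    then show ?thesis
      using K[OF x(1,2)] DERIV_imp_deriv[of g "d x" x] real_differentiable_def by metis
  qed
  \<comment> \<open>On the negligible set the density is overwritten by \<open>K\<close>, so that
    the lower bound holds at every point.\<close>
  have "((\<lambda>x. if x \<in> N then K else d x) has_integral (G b - G a)) {a..b}"
    by (rule has_integral_spike[OF negN _ d]) (use ab in auto)
  moreover have "((\<lambda>x. K) has_integral K * (b - a)) {a..b}"
    using has_integral_const_real[of K a b] ab by (simp add: mult.commute)
  ultimately have "K * (b - a) \<le> G b - G a"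
    using has_integral_le[of "\<lambda>_. K" "K * (b - a)" "{a..b}"] dK by force
  then show ?thesis using ab by (simp add: G_def cl_def)
qed

section \<open>Small-gain condition and strict decay\<close>

declare Max.bounded_iff [simp del] Max_less_iff [simp del]

text \<open>Diagonal gains vanish and so are not of class K. With the disjunction all entries of a
  row are treated alike, and the property is stable under composition with class K functions from
  the left.\<close>

definition gain_matrix :: "('n \<Rightarrow> 'n \<Rightarrow> real \<Rightarrow> real) \<Rightarrow> bool" where
  "gain_matrix \<gamma> \<longleftrightarrow> (\<forall>i j. class_K (\<gamma> i j) \<or> (\<forall>r\<ge>0. \<gamma> i j r = 0))"

text \<open>The contrapositive form of \<open>small_gain\<close>, stated for functions of the index
  since these are what the iteration below produces.\<close>

definition no_superfixpoint :: "('n::finite \<Rightarrow> 'n \<Rightarrow> real \<Rightarrow> real) \<Rightarrow> bool" where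
  "no_superfixpoint \<gamma> \<longleftrightarrow>
     (\<forall>s. (\<forall>i. 0 \<le> s i) \<and> (\<forall>i. s i \<le> (MAX j. \<gamma> i j (s j))) \<longrightarrow> (\<forall>i. s i = 0))"

lemma small_gain_imp_no_superfixpoint:
  assumes sg: "small_gain (gain_operator \<gamma>)" shows "no_superfixpoint \<gamma>"
  unfolding no_superfixpoint_def
proof (intro allI impI, rule ccontr)
  fix s i assume s: "(\<forall>i. 0 \<le> s i) \<and> (\<forall>i. s i \<le> (MAX j. \<gamma> i j (s j)))" and i: "s i \<noteq> 0"
  from i have "(\<chi> j. s j) \<noteq> 0" by (auto simp: vec_eq_iff)
  moreover have "\<forall>i. 0 \<le> (\<chi> j. s j) $ i" using conjunct1[OF s] by simp
  ultimately have "\<exists>k. gain_operator \<gamma> (\<chi> j. s j) $ k < (\<chi> j. s j) $ k"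
    by (intro sg[unfolded small_gain_def, THEN spec, THEN mp] conjI)
  then obtain k where "gain_operator \<gamma> (\<chi> j. s j) $ k < (\<chi> j. s j) $ k" by (rule exE)
  then have "(MAX j. \<gamma> k j (s j)) < s k" by (simp add: gain_operator_def)
  with conjunct2[OF s, THEN spec, of k] show False by linarith
qed

lemma gain_matrix_cases:
  assumes "gain_matrix \<gamma>"
  obtains "class_K (\<gamma> i j)" | "\<And>r. 0 \<le> r \<Longrightarrow> \<gamma> i j r = 0"
  using assms[unfolded gain_matrix_def, THEN spec, THEN spec, of i j] by blast

lemma gain_matrix_continuous:
  assumes "gain_matrix \<gamma>" shows "continuous_on {0..} (\<gamma> i j)"
  using assms
proof (cases rule: gain_matrix_cases[of _ i j])
  case 2
  show ?thesis by (subst continuous_on_cong[OF refl, of _ _ "\<lambda>r. 0"]) (simp_all add: 2)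
qed (rule class_K_continuous)

lemma gain_matrix_mono:
  assumes "gain_matrix \<gamma>" "0 \<le> x" "x \<le> y" shows "\<gamma> i j x \<le> \<gamma> i j y"
  using assms(1)
proof (cases rule: gain_matrix_cases[of _ i j])
  case 1
  then show ?thesis by (rule class_K_le) fact+
qed (use assms in simp)

lemma gain_matrix_zero:
  assumes "gain_matrix \<gamma>" shows "\<gamma> i j 0 = 0"
  using assms by (cases rule: gain_matrix_cases[of _ i j]) (simp_all add: class_K_zero[of "\<gamma> i j"])

lemma gain_matrix_nonneg: "gain_matrix \<gamma> \<Longrightarrow> 0 \<le> x \<Longrightarrow> 0 \<le> \<gamma> i j x"
  using gain_matrix_mono[of \<gamma> 0 x i j] gain_matrix_zero[of \<gamma> i j] by simp

lemma gain_matrix_compose: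
  assumes gm: "gain_matrix \<gamma>" and \<eta>: "\<And>i. class_K (\<eta> i)"
  shows "gain_matrix (\<lambda>i j r. \<eta> i (\<gamma> i j r))"
  unfolding gain_matrix_def
proof (intro allI)
  fix i j
  show "class_K (\<lambda>r. \<eta> i (\<gamma> i j r)) \<or> (\<forall>r\<ge>0. \<eta> i (\<gamma> i j r) = 0)"
    using gm
  proof (cases rule: gain_matrix_cases[of _ i j])
    case 1
    show ?thesis by (rule disjI1, rule class_K_compose[OF \<eta> 1])
  next
    case 2
    then show ?thesis using class_K_zero[OF \<eta>] by simp
  qed
qed

lemma gain_row_mono:
  fixes \<gamma> :: "'n::finite \<Rightarrow> 'n \<Rightarrow> real \<Rightarrow> real"
  assumes "gain_matrix \<gamma>" "\<And>j. 0 \<le> s j" "\<And>j. s j \<le> t j"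
  shows "(MAX j. \<gamma> i j (s j)) \<le> (MAX j. \<gamma> i j (t j))"
  unfolding Max_range_le_iff
proof
  fix j
  show "\<gamma> i j (s j) \<le> (MAX j. \<gamma> i j (t j))"
    by (rule order_trans[OF gain_matrix_mono[OF assms(1) assms(2,3)] Max_range_ge])
qed

lemma gain_row_nonneg:
  fixes \<gamma> :: "'n::finite \<Rightarrow> 'n \<Rightarrow> real \<Rightarrow> real"
  assumes "gain_matrix \<gamma>" "\<And>j. 0 \<le> s j"
  shows "0 \<le> (MAX j. \<gamma> i j (s j))"
  by (rule order_trans[OF gain_matrix_nonneg[OF assms] Max_range_ge])

section \<open>Solutions of s = max(b, \<Gamma>(s)) by finite iteration\<close>

fun gain_iter :: "('n::finite \<Rightarrow> 'n \<Rightarrow> real \<Rightarrow> real) \<Rightarrow> ('n \<Rightarrow> real) \<Rightarrow> nat \<Rightarrow> 'n \<Rightarrow> real" where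
  "gain_iter \<gamma> b 0 i = b i"
| "gain_iter \<gamma> b (Suc k) i = max (b i) (MAX j. \<gamma> i j (gain_iter \<gamma> b k j))"

text \<open>The iteration is cut off at the number of indices, which is enough under the small-gain
  condition. Being finite, it is continuous and monotone in \<open>b\<close> without any passage to
  a limit.\<close>

abbreviation gain_hull :: "('n::finite \<Rightarrow> 'n \<Rightarrow> real \<Rightarrow> real) \<Rightarrow> ('n \<Rightarrow> real) \<Rightarrow> 'n \<Rightarrow> real" where
  "gain_hull \<gamma> b \<equiv> gain_iter \<gamma> b CARD('n)"

lemma gain_iter_ge: "b i \<le> gain_iter \<gamma> b k i"
  by (cases k) auto

lemma gain_iter_nonneg: "(\<And>i. 0 \<le> b i) \<Longrightarrow> 0 \<le> gain_iter \<gamma> b k i"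
  by (rule order_trans[OF _ gain_iter_ge])

context
  fixes \<gamma> :: "'n::finite \<Rightarrow> 'n \<Rightarrow> real \<Rightarrow> real"
  assumes gm: "gain_matrix \<gamma>" and nf: "no_superfixpoint \<gamma>"
begin

lemma gain_iter_Suc_ge: "(\<And>i. 0 \<le> b i) \<Longrightarrow> gain_iter \<gamma> b k i \<le> gain_iter \<gamma> b (Suc k) i"
proof (induction k arbitrary: i)
  case (Suc k)
  have "(MAX j. \<gamma> i j (gain_iter \<gamma> b k j)) \<le> (MAX j. \<gamma> i j (gain_iter \<gamma> b (Suc k) j))"
    by (rule gain_row_mono[OF gm gain_iter_nonneg[OF Suc.prems] Suc.IH[OF Suc.prems]])
  then show ?case by (simp only: gain_iter.simps max.mono order_refl)
qed auto

text \<open>The set of indices where \<open>s\<close> is dominated by the \<open>k\<close>-th iterate grows strictly with \<open>k\<close>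
  until it is everything: otherwise \<open>s\<close> restricted to the complement contradicts the small-gain
  condition.\<close>

lemma gain_hull_greatest:
  assumes b: "\<And>i. 0 \<le> b i" and s: "\<And>i. 0 \<le> s i" "\<And>i. s i \<le> max (b i) (MAX j. \<gamma> i j (s j))"
  shows "s i \<le> gain_hull \<gamma> b i"
proof -
  define B where "B k = {j. s j \<le> gain_iter \<gamma> b k j}" for k
  have sub: "B k \<subseteq> B (Suc k)" for k
    using order_trans[OF _ gain_iter_Suc_ge[where b = b and k = k, OF b]] unfolding B_def by blast
  have grow: "B (Suc k) \<noteq> B k" if ne: "B k \<noteq> UNIV" for k
  proof
    assume eq: "B (Suc k) = B k"
    define z where "z j = (if j \<in> B k then 0 else s j)" for j
    have "z j \<le> (MAX l. \<gamma> j l (z l))" for j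
    proof (cases "j \<in> B k")
      case True
      then have "z j = 0" by (simp add: z_def)
      moreover have "0 \<le> (MAX l. \<gamma> j l (z l))"
        by (rule gain_row_nonneg[OF gm]) (simp add: z_def s)
      ultimately show ?thesis by linarith
    next
      case False
      then have "j \<notin> B (Suc k)" using eq by simp
      then have "gain_iter \<gamma> b (Suc k) j < s j" unfolding B_def mem_Collect_eq not_le .
      then have lt: "b j < s j" "(MAX l. \<gamma> j l (gain_iter \<gamma> b k l)) < s j"
        unfolding gain_iter.simps by linarith+
      with s(2)[of j] have "s j \<le> (MAX l. \<gamma> j l (s l))" by linarith
      then obtain l where l: "s j \<le> \<gamma> j l (s l)" unfolding le_Max_range_iff by (rule exE)
      \<comment> \<open>If the index \<open>l\<close> that carries the maximum for \<open>j\<close>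
        were already dominated, \<open>j\<close> would be dominated one round later.\<close>
      have "l \<notin> B k"
      proof
        assume "l \<in> B k"
        then have "\<gamma> j l (s l) \<le> \<gamma> j l (gain_iter \<gamma> b k l)"
          by (intro gain_matrix_mono[OF gm] s) (simp add: B_def)
        also have "\<dots> < s j" using lt(2) unfolding Max_range_less_iff by (rule spec)
        finally show False using l by simp
      qed
      then have "z j \<le> \<gamma> j l (z l)" using l False by (simp add: z_def)
      then show ?thesis unfolding le_Max_range_iff by (rule exI)
    qed
    moreover have "0 \<le> z j" for j using s(1) by (simp add: z_def)
    ultimately have z0: "z j = 0" for j
      using nf[unfolded no_superfixpoint_def, THEN spec, of z] by blast
    obtain j where j: "j \<notin> B k" using ne by blast
    then have "gain_iter \<gamma> b k j < s j" by (simp add: B_def)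
    moreover have "0 \<le> gain_iter \<gamma> b k j" using gain_iter_nonneg[of b] b by blast
    ultimately show False using z0[of j] j by (simp add: z_def)
  qed
  \<comment> \<open>\<open>B 0\<close> may be empty and every round adds an index until none is
    left, hence \<open>CARD('n)\<close> rounds.\<close>
  have "k \<le> card (B k)" if "k \<le> CARD('n)" for k
    using that
  proof (induction k)
    case (Suc k)
    show ?case
    proof (cases "B k = UNIV")
      case True
      then have "B (Suc k) = UNIV" using sub[of k] by auto
      then show ?thesis using Suc.prems by simp
    next
      case False
      then have "card (B k) < card (B (Suc k))"
        using sub[of k] grow[of k] by (intro psubset_card_mono) auto
      then show ?thesis using Suc by simp
    qed
  qed auto
  then have "B CARD('n) = UNIV"
    by (metis card_seteq finite order_refl subset_UNIV)
  then show ?thesis by (auto simp: B_def)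
qed

text \<open>The iterate after the hull is a subsolution because iterates increase, and the hull
  dominates every subsolution; so the iteration has become stationary.\<close>

lemma gain_hull_fixpoint:
  assumes b: "\<And>i. 0 \<le> b i"
  shows "gain_hull \<gamma> b i = max (b i) (MAX j. \<gamma> i j (gain_hull \<gamma> b j))"
proof (rule antisym)
  let ?s = "gain_iter \<gamma> b (Suc CARD('n))"
  show "gain_hull \<gamma> b i \<le> max (b i) (MAX j. \<gamma> i j (gain_hull \<gamma> b j))"
    using gain_iter_Suc_ge[where b = b and k = "CARD('n)" and i = i, OF b] by simp
  have "?s i \<le> max (b i) (MAX j. \<gamma> i j (?s j))" for i
    using gain_iter_Suc_ge[where b = b and k = "Suc CARD('n)" and i = i, OF b] by (simp only: gain_iter.simps)
  then have "?s i \<le> gain_hull \<gamma> b i"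
    by (rule gain_hull_greatest[OF b gain_iter_nonneg[OF b]])
  then show "max (b i) (MAX j. \<gamma> i j (gain_hull \<gamma> b j)) \<le> gain_hull \<gamma> b i" by simp
qed

end

lemma gain_iter_continuous:
  assumes gm: "gain_matrix \<gamma>" and c: "\<And>i. continuous_on S (\<lambda>r. b r i)" and b: "\<And>r i. r \<in> S \<Longrightarrow> 0 \<le> b r i"
  shows "continuous_on S (\<lambda>r. gain_iter \<gamma> (b r) k i)"
proof (induction k arbitrary: i)
  case (Suc k)
  have "continuous_on S (\<lambda>r. \<gamma> i j (gain_iter \<gamma> (b r) k j))" for j
    by (rule continuous_on_compose2[OF gain_matrix_continuous[OF gm] Suc])
      (auto intro: gain_iter_nonneg b)
  then show ?case
    by (simp, intro continuous_on_max continuous_on_Max_image c) auto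
qed (simp add: c)

lemma gain_iter_mono:
  assumes gm: "gain_matrix \<gamma>" and b: "\<And>i. 0 \<le> b i" "\<And>i. b i \<le> b' i"
  shows "gain_iter \<gamma> b k i \<le> gain_iter \<gamma> b' k i"
proof (induction k arbitrary: i)
  case (Suc k)
  have "(MAX j. \<gamma> i j (gain_iter \<gamma> b k j)) \<le> (MAX j. \<gamma> i j (gain_iter \<gamma> b' k j))"
    by (rule gain_row_mono[OF gm _ Suc]) (rule gain_iter_nonneg[OF b(1)])
  then show ?case using b(2)[of i] by (simp only: gain_iter.simps max.mono)
qed (simp add: b)

text \<open>A zero gain is not strictly increasing, but it contributes only 0, which lies strictly
  below the base value \<open>y\<close> that enters every maximum.\<close>

lemma gain_iter_strict_mono:
  assumes gm: "gain_matrix \<gamma>" and xy: "0 \<le> x" "x < y"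
  shows "gain_iter \<gamma> (\<lambda>_. x) k i < gain_iter \<gamma> (\<lambda>_. y) k i"
proof (induction k arbitrary: i)
  case (Suc k)
  have less: "\<gamma> i j (gain_iter \<gamma> (\<lambda>_. x) k j) < max y (MAX j. \<gamma> i j (gain_iter \<gamma> (\<lambda>_. y) k j))" for j
    using gm
  proof (cases rule: gain_matrix_cases[of _ i j])
    case 1
    have "\<gamma> i j (gain_iter \<gamma> (\<lambda>_. x) k j) < \<gamma> i j (gain_iter \<gamma> (\<lambda>_. y) k j)"
      by (rule class_K_less[OF 1 gain_iter_nonneg[OF xy(1)] Suc])
    also have "\<dots> \<le> (MAX j. \<gamma> i j (gain_iter \<gamma> (\<lambda>_. y) k j))" by (rule Max_range_ge)
    finally show ?thesis by linarith
  next
    case 2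
    show ?thesis using 2[OF gain_iter_nonneg[where b = "\<lambda>_. x" and k = k and i = j and \<gamma> = \<gamma>, OF xy(1)]] xy by linarith
  qed
  then have "(MAX j. \<gamma> i j (gain_iter \<gamma> (\<lambda>_. x) k j)) < max y (MAX j. \<gamma> i j (gain_iter \<gamma> (\<lambda>_. y) k j))"
    unfolding Max_range_less_iff by blast
  with xy show ?case unfolding gain_iter.simps by linarith
qed (use xy in simp)

text \<open>Feed the value r into index \<open>i\<close> alone and let the hull spread it:
  \<open>\<kappa> r\<close> is what comes back to row \<open>i\<close>, and the small-gain condition
  forces \<kappa> r < r. An \<eta> whose inverse stays strictly above \<kappa> on (0, \<infinity>)
  preserves the condition.\<close>

lemma perturb_row:
  fixes \<gamma> :: "'n::finite \<Rightarrow> 'n \<Rightarrow> real \<Rightarrow> real"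
  assumes gm: "gain_matrix \<gamma>" and nf: "no_superfixpoint \<gamma>"
  obtains \<eta> where "class_Kinf \<eta>" "\<And>r. 0 < r \<Longrightarrow> r < \<eta> r"
    "no_superfixpoint (\<lambda>k j r. if k = i then \<eta> (\<gamma> k j r) else \<gamma> k j r)"
proof -
  define b where "b r j = (if j = i then r else 0)" for r :: real and j
  have b: "0 \<le> b r j" if "0 \<le> r" for r j using that by (simp add: b_def)
  define \<kappa> where "\<kappa> r = (MAX j. \<gamma> i j (gain_hull \<gamma> (b r) j))" for r
  \<comment> \<open>If the row returns at least r, the base value is absorbed by it: the hull
    satisfies s \<le> \<Gamma>(s) and therefore vanishes.\<close>
  have hull0: "gain_hull \<gamma> (b r) j = 0" if "0 \<le> r" "r \<le> \<kappa> r" for r j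
  proof -
    have "gain_hull \<gamma> (b r) l \<le> (MAX m. \<gamma> l m (gain_hull \<gamma> (b r) m))" for l
    proof (cases "l = i")
      case True
      then show ?thesis
        using gain_hull_fixpoint[where b = "b r" and i = l, OF gm nf b[OF that(1)]] that(2) by (simp add: b_def \<kappa>_def)
    next
      case False
      have "0 \<le> (MAX m. \<gamma> l m (gain_hull \<gamma> (b r) m))"
        by (rule gain_row_nonneg[OF gm gain_iter_nonneg[OF b[OF that(1)]]])
      then show ?thesis
        using gain_hull_fixpoint[where b = "b r" and i = l, OF gm nf b[OF that(1)]] False by (simp add: b_def)
    qed
    moreover have "0 \<le> gain_hull \<gamma> (b r) l" for l by (rule gain_iter_nonneg[OF b[OF that(1)]])
    ultimately show ?thesis
      using nf[unfolded no_superfixpoint_def, THEN spec, of "gain_hull \<gamma> (b r)"] by blast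
  qed
  have \<kappa>_less: "\<kappa> r < r" if "0 < r" for r
  proof (rule ccontr)
    assume "\<not> \<kappa> r < r"
    then have "gain_hull \<gamma> (b r) i = 0" using hull0[of r i] that by simp
    moreover have "b r i \<le> gain_hull \<gamma> (b r) i" by (rule gain_iter_ge)
    ultimately show False using that by (simp add: b_def)
  qed
  have \<kappa>_nonneg: "0 \<le> \<kappa> r" if "0 \<le> r" for r
    unfolding \<kappa>_def by (rule gain_row_nonneg[OF gm gain_iter_nonneg[OF b[OF that]]])
  have hull00: "gain_hull \<gamma> (b 0) j = 0" for j using hull0[of 0] \<kappa>_nonneg[of 0] by simp
  have \<kappa>0: "\<kappa> 0 = 0" by (simp add: \<kappa>_def hull00 gain_matrix_zero[OF gm])
  have \<kappa>_mono: "\<kappa> x \<le> \<kappa> y" if "0 \<le> x" "x \<le> y" for x y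
    unfolding \<kappa>_def
    by (rule gain_row_mono[OF gm gain_iter_nonneg[OF b[OF that(1)]] gain_iter_mono[OF gm b[OF that(1)]]])
      (use that in \<open>auto simp: b_def\<close>)
  have cb: "continuous_on {0..} (\<lambda>r. b r j)" for j
    by (cases "j = i") (auto simp: b_def)
  have "continuous_on {0..} (\<lambda>r. gain_hull \<gamma> (b r) j)" for j
    by (rule gain_iter_continuous[OF gm cb]) (use b in auto)
  then have "continuous_on {0..} (\<lambda>r. \<gamma> i j (gain_hull \<gamma> (b r) j))" for j
    by (rule continuous_on_compose2[OF gain_matrix_continuous[OF gm]])
      (auto intro: gain_iter_nonneg b)
  then have \<kappa>_cont: "continuous_on {0..} \<kappa>"
    unfolding \<kappa>_def by (intro continuous_on_Max_image) auto
  \<comment> \<open>\<open>\<kappa>\<close> itself may be constant or bounded. Its mean with the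
    identity is strictly increasing and unbounded, and for r > 0 it still lies strictly between
    \<open>\<kappa>\<close> and the identity.\<close>
  define \<kappa>' where "\<kappa>' r = (\<kappa> r + r) / 2" for r
  have K': "class_Kinf \<kappa>'"
  proof (rule class_KinfI[OF class_KI])
    show "continuous_on {0..} \<kappa>'" unfolding \<kappa>'_def by (intro continuous_intros \<kappa>_cont) auto
    show "\<kappa>' x < \<kappa>' y" if "0 \<le> x" "x < y" for x y
      using \<kappa>_mono[of x y] that by (simp add: \<kappa>'_def)
    show "\<kappa>' 0 = 0" by (simp add: \<kappa>'_def \<kappa>0)
    show "\<exists>r\<ge>0. M \<le> \<kappa>' r" for M
      using \<kappa>_nonneg[of "2 * \<bar>M\<bar>"] by (intro exI[of _ "2 * \<bar>M\<bar>"]) (auto simp: \<kappa>'_def)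
  qed
  have gt: "r < Kinv \<kappa>' r" if "0 < r" for r
    using that \<kappa>_less[OF that] by (subst less_Kinv_iff[OF K']) (auto simp: \<kappa>'_def)
  have "no_superfixpoint (\<lambda>k j r. if k = i then Kinv \<kappa>' (\<gamma> k j r) else \<gamma> k j r)"
    unfolding no_superfixpoint_def
  proof (intro allI impI)
    fix s k
    assume "(\<forall>k. 0 \<le> s k) \<and>
      (\<forall>k. s k \<le> (MAX j. if k = i then Kinv \<kappa>' (\<gamma> k j (s j)) else \<gamma> k j (s j)))"
    then have s: "\<And>k. 0 \<le> s k"
      "\<And>k. s k \<le> (MAX j. if k = i then Kinv \<kappa>' (\<gamma> k j (s j)) else \<gamma> k j (s j))"
      by blast+
    \<comment> \<open>Only row \<open>i\<close> was enlarged, so with \<open>s i\<close> prescribed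
      at index \<open>i\<close> the vector is a subsolution for the original gains.\<close>
    have "s k \<le> max (b (s i) k) (MAX j. \<gamma> k j (s j))" for k
      using s(2)[of k] by (cases "k = i") (simp_all add: b_def)
    then have le: "s k \<le> gain_hull \<gamma> (b (s i)) k" for k
      by (rule gain_hull_greatest[OF gm nf b[OF s(1)] s(1)])
    have "s i \<le> (MAX j. Kinv \<kappa>' (\<gamma> i j (s j)))" using s(2)[of i] by (simp)
    then obtain j where j: "s i \<le> Kinv \<kappa>' (\<gamma> i j (s j))" unfolding le_Max_range_iff by blast
    then have "\<kappa>' (s i) \<le> \<gamma> i j (s j)"
      by (subst (asm) le_Kinv_iff[OF K' s(1) gain_matrix_nonneg[OF gm s(1)]])
    also have "\<dots> \<le> \<gamma> i j (gain_hull \<gamma> (b (s i)) j)" by (rule gain_matrix_mono[OF gm s(1) le])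
    also have "\<dots> \<le> \<kappa> (s i)" unfolding \<kappa>_def by (rule Max_range_ge)
    finally have "s i \<le> \<kappa> (s i)" by (simp add: \<kappa>'_def)
    then have "gain_hull \<gamma> (b (s i)) k = 0" by (rule hull0[OF s(1)])
    with le[of k] s(1)[of k] show "s k = 0" by simp
  qed
  with class_Kinf_Kinv[OF K'] gt show thesis by (rule that)
qed

text \<open>Each step enlarges one row of the matrix obtained so far, which again is a gain matrix
  without nonzero superfixpoints. The weak inequality \<eta> \<ge> id, carried along for all rows,
  makes the new \<theta> \<circ> \<eta> exceed the identity strictly.\<close>

lemma perturb_rows:
  fixes \<gamma> :: "'n::finite \<Rightarrow> 'n \<Rightarrow> real \<Rightarrow> real"
  assumes gm: "gain_matrix \<gamma>" and nf: "no_superfixpoint \<gamma>"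
  shows "\<exists>\<eta>. (\<forall>i. class_Kinf (\<eta> i)) \<and> (\<forall>i. \<forall>r\<ge>0. r \<le> \<eta> i r) \<and> (\<forall>i\<in>I. \<forall>r>0. r < \<eta> i r) \<and>
    no_superfixpoint (\<lambda>i j r. \<eta> i (\<gamma> i j r))"
proof -
  have "finite I" by simp
  then show ?thesis
  proof (induction I)
    case empty
    have "class_Kinf (\<lambda>r. r)"
    proof (rule class_KinfI[OF class_KI])
      show "\<exists>r\<ge>0. M \<le> r" for M :: real by (intro exI[of _ "\<bar>M\<bar>"]) auto
    qed auto
    with nf show ?case by (intro exI[of _ "\<lambda>i r. r"]) simp
  next
    case (insert i I)
    then obtain \<eta> where \<eta>: "\<And>i. class_Kinf (\<eta> i)" "\<And>i r. r \<ge> 0 \<Longrightarrow> r \<le> \<eta> i r"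
      "\<And>i r. i \<in> I \<Longrightarrow> 0 < r \<Longrightarrow> r < \<eta> i r" "no_superfixpoint (\<lambda>i j r. \<eta> i (\<gamma> i j r))"
      by blast
    have gm': "gain_matrix (\<lambda>i j r. \<eta> i (\<gamma> i j r))"
      by (rule gain_matrix_compose[OF gm class_Kinf_imp_K[OF \<eta>(1)]])
    obtain \<theta> where \<theta>: "class_Kinf \<theta>" "\<And>r. 0 < r \<Longrightarrow> r < \<theta> r"
      "no_superfixpoint (\<lambda>k j r. if k = i then \<theta> (\<eta> k (\<gamma> k j r)) else \<eta> k (\<gamma> k j r))"
      by (rule perturb_row[OF gm' \<eta>(4), of i]) blast
    define \<eta>' where "\<eta>' k = (if k = i then \<lambda>r. \<theta> (\<eta> k r) else \<eta> k)" for k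
    have "class_Kinf (\<eta>' k)" for k
      using class_Kinf_compose[OF \<theta>(1) \<eta>(1)] \<eta>(1) by (simp add: \<eta>'_def)
    moreover have gt: "r < \<theta> (\<eta> k r)" if "0 < r" for k r
      using \<eta>(2)[of r k] \<theta>(2)[of "\<eta> k r"] that by linarith
    have "r \<le> \<eta>' k r" if "r \<ge> 0" for k r
      using gt[of r k] \<eta>(2)[OF that, of k] that class_K_zero[OF class_Kinf_imp_K[OF \<theta>(1)]]
        class_K_zero[OF class_Kinf_imp_K[OF \<eta>(1)], of k]
      by (cases "r = 0") (auto simp: \<eta>'_def)
    moreover have "r < \<eta>' k r" if "k \<in> insert i I" "0 < r" for k r
      using gt[of r k] \<eta>(3)[of k r] that by (auto simp: \<eta>'_def)
    moreover have "(\<lambda>k j r. if k = i then \<theta> (\<eta> k (\<gamma> k j r)) else \<eta> k (\<gamma> k j r)) = (\<lambda>k j r. \<eta>' k (\<gamma> k j r))"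
      by (auto simp: \<eta>'_def fun_eq_iff)
    with \<theta>(3) have "no_superfixpoint (\<lambda>k j r. \<eta>' k (\<gamma> k j r))" by simp
    ultimately show ?case by (intro exI[of _ \<eta>']) blast
  qed
qed

text \<open>The fixed point equation of the enlarged gains gives \<eta>(\<Gamma>(q)) \<le> q, and
  the excess of \<eta> over the identity is the margin. The base value r at every index makes q r
  \<ge> r, whence unboundedness.\<close>

lemma strict_gain_path:
  fixes \<gamma> :: "'n::finite \<Rightarrow> 'n \<Rightarrow> real \<Rightarrow> real"
  assumes gm: "gain_matrix \<gamma>" and nf: "no_superfixpoint \<gamma>"
  obtains q where "\<And>i. class_Kinf (q i)" "\<And>i r. 0 < r \<Longrightarrow> (MAX j. \<gamma> i j (q j r)) < q i r"
proof -
  obtain \<eta> where \<eta>: "\<And>i. class_Kinf (\<eta> i)" "\<And>i r. 0 < r \<Longrightarrow> r < \<eta> i r"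
    "no_superfixpoint (\<lambda>i j r. \<eta> i (\<gamma> i j r))"
    using perturb_rows[OF gm nf, of UNIV] by blast
  define \<gamma>' where "\<gamma>' = (\<lambda>i j r. \<eta> i (\<gamma> i j r))"
  have nf': "no_superfixpoint \<gamma>'" using \<eta>(3) by (simp add: \<gamma>'_def)
  have gm': "gain_matrix \<gamma>'"
    unfolding \<gamma>'_def by (rule gain_matrix_compose[OF gm class_Kinf_imp_K[OF \<eta>(1)]])
  define q where "q i r = gain_hull \<gamma>' (\<lambda>_. r) i" for i r
  have ge: "r \<le> q i r" for i r unfolding q_def by (rule gain_iter_ge)
  have q0: "q i 0 = 0" for i
  proof -
    have "q k 0 \<le> (MAX j. \<gamma>' k j (q j 0))" for k
    proof -
      have "0 \<le> (MAX j. \<gamma>' k j (q j 0))" by (rule gain_row_nonneg[OF gm' ge])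
      then show ?thesis
        using gain_hull_fixpoint[OF gm' nf', where b = "\<lambda>_. 0" and i = k] unfolding q_def by linarith
    qed
    then show ?thesis using nf'[unfolded no_superfixpoint_def, THEN spec, of "\<lambda>i. q i 0"] ge[of 0] by blast
  qed
  have "class_Kinf (q i)" for i
  proof (rule class_KinfI[OF class_KI])
    show "continuous_on {0..} (q i)"
      unfolding q_def by (rule gain_iter_continuous[OF gm']) auto
    show "q i x < q i y" if "0 \<le> x" "x < y" for x y
      unfolding q_def by (rule gain_iter_strict_mono[OF gm' that])
    show "q i 0 = 0" by (rule q0)
    show "\<exists>r\<ge>0. M \<le> q i r" for M
      using ge[of "\<bar>M\<bar>" i] by (intro exI[of _ "\<bar>M\<bar>"]) auto
  qed
  moreover have "(MAX j. \<gamma> i j (q j r)) < q i r" if "0 < r" for i r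
  proof -
    obtain j where j: "(MAX j. \<gamma> i j (q j r)) = \<gamma> i j (q j r)"
      using Max_range_attained[of "\<lambda>j. \<gamma> i j (q j r)"] by blast
    have "\<gamma>' i j (q j r) \<le> (MAX j. \<gamma>' i j (q j r))" by (rule Max_range_ge)
    also have "\<dots> \<le> q i r"
      using gain_hull_fixpoint[OF gm' nf', where b = "\<lambda>_. r" and i = i] that unfolding q_def by linarith
    finally have le: "\<eta> i (\<gamma> i j (q j r)) \<le> q i r" by (simp add: \<gamma>'_def)
    \<comment> \<open>Where the gain term is positive, \<eta> > id gives strictness; where it is
      not, q i r \<ge> r > 0 does.\<close>
    show ?thesis
      using le \<eta>(2)[of "\<gamma> i j (q j r)" i] ge[of r i] that unfolding j by linarith
  qed
  ultimately show thesis by (rule that)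
qed

section \<open>Existence of \<open>\<Omega>\<close>-paths\<close>

text \<open>Points off a closed set have positive distance from it; this makes the speed of the time
  change below positive.\<close>

lemma closed_graph_half_line:
  fixes g :: "real \<Rightarrow> real"
  assumes "continuous_on {0..} g" shows "closed ((\<lambda>r. (r, g r)) ` {0..})"
proof -
  have "closed {z \<in> {0..} \<times> UNIV. g (fst z) = snd z}"
    by (rule continuous_closed_preimage_constant[where f = "\<lambda>z. g (fst z) - snd z" and a = 0, simplified])
      (auto intro!: continuous_intros continuous_on_compose2[OF assms] closed_Times)
  moreover have "(\<lambda>r. (r, g r)) ` {0..} = {z \<in> {0..} \<times> UNIV. g (fst z) = snd z}" by force
  ultimately show ?thesis by simp
qed

text \<open>For the point y reached from x after one unit of time the chain is \<Gamma>(\<sigma>(x))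
  \<le> \<Gamma>(q(y)) \<le> q(\<mu>(y)) \<le> q(x) < \<sigma>(x). It needs \<mu>(y) \<le> x, which
  a slow enough time scale provides.\<close>

lemma smooth_gain_path:
  fixes \<gamma> :: "'n::finite \<Rightarrow> 'n \<Rightarrow> real \<Rightarrow> real"
  assumes gm: "gain_matrix \<gamma>" and nf: "no_superfixpoint \<gamma>"
  obtains \<sigma> \<sigma>' where "\<And>i. class_Kinf (\<sigma> i)"
    "\<And>i r. 0 < r \<Longrightarrow> (\<sigma> i has_real_derivative \<sigma>' i r) (at r)"
    "\<And>i. continuous_on {0<..} (\<sigma>' i)" "\<And>i r. 0 < r \<Longrightarrow> 0 < \<sigma>' i r"
    "\<And>i r. 0 < r \<Longrightarrow> (MAX j. \<gamma> i j (\<sigma> j r)) < \<sigma> i r"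
proof -
  obtain q where q: "\<And>i. class_Kinf (q i)" "\<And>i r. 0 < r \<Longrightarrow> (MAX j. \<gamma> i j (q j r)) < q i r"
    by (rule strict_gain_path[OF gm nf]) blast
  note qK = class_Kinf_imp_K[OF q(1)]
  \<comment> \<open>\<open>\<mu> r\<close> is the least parameter at which the path dominates
    \<Gamma>(q(r)); the margin is thus measured on the parameter axis.\<close>
  define \<mu> where "\<mu> r = (MAX i. Kinv (q i) (MAX j. \<gamma> i j (q j r)))" for r
  have q_nonneg: "0 \<le> q j r" if "0 \<le> r" for j r by (rule class_K_nonneg[OF qK that])
  have row_nonneg: "0 \<le> (MAX j. \<gamma> i j (q j r))" if "0 \<le> r" for i r
    by (rule gain_row_nonneg[OF gm q_nonneg[OF that]])
  have \<mu>_less: "\<mu> r < r" if "0 < r" for r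
    unfolding \<mu>_def Max_range_less_iff
    using q(2)[OF that] that by (auto simp: Kinv_less_iff[OF q(1)] row_nonneg)
  have \<mu>_nonneg: "0 \<le> \<mu> r" if "0 \<le> r" for r
    unfolding \<mu>_def le_Max_range_iff using Kinv_nonneg[OF q(1) row_nonneg[OF that]] by blast
  have \<mu>_row: "(MAX j. \<gamma> i j (q j r)) \<le> q i (\<mu> r)" if "0 \<le> r" for i r
  proof -
    have "Kinv (q i) (MAX j. \<gamma> i j (q j r)) \<le> \<mu> r" unfolding \<mu>_def by (rule Max_range_ge)
    then show ?thesis by (subst (asm) Kinv_le_iff[OF q(1) \<mu>_nonneg[OF that] row_nonneg[OF that]])
  qed
  have "continuous_on {0..} (\<lambda>r. \<gamma> i j (q j r))" for i j
    by (rule continuous_on_compose2[OF gain_matrix_continuous[OF gm] class_K_continuous[OF qK]])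
      (auto intro: q_nonneg)
  then have "continuous_on {0..} (\<lambda>r. MAX j. \<gamma> i j (q j r))" for i
    by (intro continuous_on_Max_image) auto
  then have "continuous_on {0..} (\<lambda>r. Kinv (q i) (MAX j. \<gamma> i j (q j r)))" for i
    by (rule continuous_on_compose2[OF class_K_continuous[OF class_Kinf_imp_K[OF class_Kinf_Kinv[OF q(1)]]]])
      (auto intro: row_nonneg)
  then have \<mu>_cont: "continuous_on {0..} \<mu>"
    unfolding \<mu>_def by (intro continuous_on_Max_image) auto
  \<comment> \<open>The midpoint stays below r and, however small \<open>\<mu> r\<close> is, is at
    least r / 2. So it is positive and \<open>H\<close> may be evaluated there; later this also
    bounds \<open>p (H x + 1)\<close> by 2 * x.\<close>
  define m where "m r = (\<mu> r + r) / 2" for r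
  have m_cont: "continuous_on {0..} m" unfolding m_def by (intro continuous_intros \<mu>_cont) auto
  have m: "\<mu> r < m r" "m r < r" "r / 2 \<le> m r" if "0 < r" for r
    using \<mu>_less[OF that] \<mu>_nonneg[of r] that by (auto simp: m_def)
  define S where "S = (\<lambda>r. (r, m r)) ` {0..}"
  have S: "closed S" "S \<noteq> {}" unfolding S_def using closed_graph_half_line[OF m_cont] by auto
  \<comment> \<open>For z between m r and r the point (z, z) is within r - m r of the graph point
    (r, m r), so \<open>c\<close> is at most half the length of each interval [m r, r] that contains
    z. At this speed crossing such an interval takes at least one unit of time.\<close>
  define c where "c y = infdist (y, y) S / 2" for y
  have c_cont: "continuous_on {0<..} c" unfolding c_def by (intro continuous_intros) auto
  have c_pos: "0 < c y" if "0 < y" for y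
  proof -
    have "(y, y) \<notin> S" using m(2)[OF that] by (auto simp: S_def)
    then show ?thesis using infdist_pos_not_in_closed[OF S, of "(y, y)"] by (simp add: c_def)
  qed
  have c_le: "c z \<le> (r - m r) / 2" if "0 < r" "m r \<le> z" "z \<le> r" for z r
  proof -
    have "infdist (z, z) S \<le> dist (z, z) (r, m r)"
      by (rule infdist_le) (use that in \<open>auto simp: S_def\<close>)
    also have "\<dots> \<le> dist z r + dist z (m r)"
      unfolding dist_Pair_Pair by (rule sqrt_sum_squares_le_sum) auto
    also have "\<dots> = r - m r" using that by (simp add: dist_real_def)
    finally show ?thesis by (simp add: c_def)
  qed
  have c_le': "c y \<le> y" if "0 < y" for y
    using c_le[of y y] m[OF that] that by auto
  obtain H p where H: "\<And>x. 0 < x \<Longrightarrow> (H has_real_derivative 1 / c x) (at x)"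
    and pH: "\<And>x. 0 < x \<Longrightarrow> p (H x) = x" "\<And>t. 0 < p t" "\<And>t. H (p t) = t"
      "continuous_on UNIV p" "strict_mono p" "strict_mono_on {0<..} H"
    by (rule time_change[OF c_cont c_pos c_le'], assumption, assumption, rule that) assumption+
  have Hm: "H (m r) + 1 \<le> H r" if r: "0 < r" for r
  proof -
    have mr: "0 < m r" "m r < r" using m[OF r] r by auto
    have "\<exists>z>m r. z < r \<and> H r - H (m r) = (r - m r) * (1 / c z)"
      by (rule MVT2[OF mr(2)]) (use H mr in auto)
    then obtain z where z: "m r < z" "z < r" "H r - H (m r) = (r - m r) * (1 / c z)" by blast
    have "c z \<le> r - m r" using c_le[OF r, of z] z mr by auto
    then have "1 \<le> (r - m r) * (1 / c z)" using c_pos[of z] z mr by (simp add: field_simps)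
    then show ?thesis using z(3) by linarith
  qed
  define s where "s i t = q i (p t)" for i t
  have s_cont: "continuous_on UNIV (s i)" for i
    unfolding s_def
    by (rule continuous_on_compose2[OF class_K_continuous[OF qK] pH(4)]) (auto intro: less_imp_le pH)
  have s_less: "s i t < s i t'" if "t < t'" for i t t'
    unfolding s_def using pH(2)[of t] strict_monoD[OF pH(5) that] by (intro class_K_less[OF qK]) auto
  have "\<exists>F. \<forall>t. (F has_real_derivative s i t) (at t)" for i
    using einterval_antiderivative[of "-\<infinity>" "\<infinity>" "s i"] s_cont[of i]
    by (auto simp: has_real_derivative_iff_has_vector_derivative continuous_on_eq_continuous_at)
  then obtain F where F: "\<And>i t. (F i has_real_derivative s i t) (at t)" by metis
  \<comment> \<open>The mean of \<open>s\<close> over the unit of time that starts at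
    \<open>H x\<close>, written with an antiderivative. The value 0 is the limit at 0, by the bound
    \<open>\<sigma>_le\<close> below.\<close>
  define \<sigma> where "\<sigma> i x = (if 0 < x then F i (H x + 1) - F i (H x) else 0)" for i x
  define \<sigma>' where "\<sigma>' i x = (s i (H x + 1) - s i (H x)) / c x" for i x
  have deriv: "(\<sigma> i has_real_derivative \<sigma>' i x) (at x)" if x: "0 < x" for i x
  proof -
    have "((\<lambda>x. F i (H x + 1) - F i (H x)) has_real_derivative
      s i (H x + 1) * (1 / c x + 0) - s i (H x) * (1 / c x)) (at x)"
      by (intro DERIV_diff DERIV_chain2[OF F] DERIV_add H x DERIV_const)
    then have "((\<lambda>x. F i (H x + 1) - F i (H x)) has_real_derivative \<sigma>' i x) (at x)"
      by (simp add: \<sigma>'_def diff_divide_distrib)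
    then show ?thesis
      by (rule has_field_derivative_transform_within_open[of _ _ _ "{0<..}"]) (use x in \<open>auto simp: \<sigma>_def\<close>)
  qed
  have \<sigma>'_pos: "0 < \<sigma>' i x" if "0 < x" for i x
    using c_pos[OF that] s_less[of "H x" "H x + 1" i] by (simp add: \<sigma>'_def)
  have H_cont: "continuous_on {0<..} H"
    using H by (auto intro!: continuous_at_imp_continuous_on DERIV_isCont)
  have sH_cont: "continuous_on {0<..} (\<lambda>x. s i (H x + 1))" "continuous_on {0<..} (\<lambda>x. s i (H x))" for i
    by (rule continuous_on_compose2[OF s_cont], auto intro!: continuous_intros H_cont)+
  have \<sigma>'_cont: "continuous_on {0<..} (\<sigma>' i)" for i
    unfolding \<sigma>'_def by (intro continuous_on_divide continuous_on_diff sH_cont c_cont) (use c_pos in force)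
  \<comment> \<open>The mean over a time interval is a value of the increasing curve
    \<open>s\<close> strictly inside it.\<close>
  have bounds: "q i x < \<sigma> i x" "\<sigma> i x < q i (p (H x + 1))" if x: "0 < x" for i x
  proof -
    have "\<exists>z>H x. z < H x + 1 \<and> F i (H x + 1) - F i (H x) = (H x + 1 - H x) * s i z"
      by (rule MVT2) (use F in auto)
    then obtain z where z: "H x < z" "z < H x + 1" "\<sigma> i x = s i z" using x by (auto simp: \<sigma>_def)
    show "q i x < \<sigma> i x" using s_less[OF z(1), of i] z(3) pH(1)[OF x] by (simp add: s_def)
    show "\<sigma> i x < q i (p (H x + 1))" using s_less[OF z(2), of i] z(3) by (simp add: s_def)
  qed
  \<comment> \<open>By \<open>Hm\<close> the map \<open>m\<close> goes back at least one unit of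
    time, so from one unit ahead it leads to \<open>x\<close> or below.\<close>
  have y: "m (p (H x + 1)) \<le> x" if x: "0 < x" for x
  proof -
    have "H (m (p (H x + 1))) \<le> H x" using Hm[OF pH(2), of "H x + 1"] pH(3)[of "H x + 1"] by linarith
    moreover have "0 < m (p (H x + 1))" using m(3)[OF pH(2), of "H x + 1"] pH(2)[of "H x + 1"] by linarith
    ultimately show ?thesis
      using strict_mono_onD[OF pH(6), of x "m (p (H x + 1))"] x by force
  qed
  have \<sigma>_pos: "0 < \<sigma> i x" if "0 < x" for i x
    using bounds(1)[OF that, of i] q_nonneg[of x i] that by linarith
  have \<sigma>_le: "\<sigma> i x \<le> q i (2 * x)" if x: "0 \<le> x" for i x
  proof (cases "x = 0")
    case False
    then have x: "0 < x" using x by simp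
    have "p (H x + 1) \<le> 2 * x" using y[OF x] m(3)[OF pH(2), of "H x + 1"] by linarith
    then have "q i (p (H x + 1)) \<le> q i (2 * x)"
      by (intro class_K_le[OF qK] less_imp_le[OF pH(2)])
    then show ?thesis using bounds(2)[OF x, of i] by linarith
  qed (simp add: \<sigma>_def class_K_zero[OF qK])
  have "class_Kinf (\<sigma> i)" for i
  proof (rule class_KinfI[OF class_KI])
    show "\<sigma> i 0 = 0" by (simp add: \<sigma>_def)
    show "\<exists>r\<ge>0. M \<le> \<sigma> i r" for M
    proof -
      obtain r where r: "0 \<le> r" "M \<le> q i r" using class_Kinf_unbounded[OF q(1)] by blast
      have "q i r \<le> q i (r + 1)" using r by (intro class_K_le[OF qK]) auto
      then show ?thesis using r bounds(1)[of "r + 1" i] by (intro exI[of _ "r + 1"]) auto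
    qed
    show "\<sigma> i x < \<sigma> i y" if xy: "0 \<le> x" "x < y" for x y
    proof (cases "x = 0")
      case True
      then show ?thesis using \<sigma>_pos[of y i] xy by (simp add: \<sigma>_def)
    next
      case False
      show ?thesis
      proof (rule DERIV_pos_imp_increasing[OF xy(2)])
        fix z assume "x \<le> z" "z \<le> y"
        then have "0 < z" using False xy by simp
        then show "\<exists>D. (\<sigma> i has_real_derivative D) (at z) \<and> 0 < D" using deriv \<sigma>'_pos by blast
      qed
    qed
    show "continuous_on {0..} (\<sigma> i)"
      unfolding continuous_on_eq_continuous_within
    proof
      fix x :: real assume "x \<in> {0..}"
      show "continuous (at x within {0..}) (\<sigma> i)"
      proof (cases "x = 0")
        case True
        have "continuous_on {0..} (\<lambda>x. q i (2 * x))"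
          by (rule continuous_on_compose2[OF class_K_continuous[OF qK]]) (auto intro!: continuous_intros)
        then have lim: "((\<lambda>x. q i (2 * x)) \<longlongrightarrow> 0) (at 0 within {0..})"
          by (auto simp: continuous_on_def class_K_zero[OF qK] dest: bspec[of _ _ 0])
        have "(\<sigma> i \<longlongrightarrow> 0) (at 0 within {0..})"
        proof (rule tendsto_sandwich[OF _ _ tendsto_const lim])
          show "\<forall>\<^sub>F x in at 0 within {0..}. 0 \<le> \<sigma> i x"
            by (auto simp: eventually_at_filter intro!: always_eventually less_imp_le \<sigma>_pos)
          show "\<forall>\<^sub>F x in at 0 within {0..}. \<sigma> i x \<le> q i (2 * x)"
            by (auto simp: eventually_at_filter intro!: always_eventually \<sigma>_le)
        qed
        then show ?thesis by (simp add: True continuous_within \<sigma>_def)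
      next
        case False
        then have "0 < x" using \<open>x \<in> {0..}\<close> by simp
        then show ?thesis
          using deriv DERIV_isCont continuous_at_imp_continuous_within by blast
      qed
    qed
  qed
  moreover have "(MAX j. \<gamma> i j (\<sigma> j x)) < \<sigma> i x" if x: "0 < x" for i x
  proof -
    let ?y = "p (H x + 1)"
    have "(MAX j. \<gamma> i j (\<sigma> j x)) \<le> (MAX j. \<gamma> i j (q j ?y))"
      by (rule gain_row_mono[OF gm]) (auto intro: less_imp_le \<sigma>_pos bounds x)
    also have "\<dots> \<le> q i (\<mu> ?y)" by (rule \<mu>_row[OF less_imp_le[OF pH(2)]])
    also have "\<dots> \<le> q i x"
      using y[OF x] m(1)[OF pH(2), of "H x + 1"]
      by (intro class_K_le[OF qK] \<mu>_nonneg less_imp_le[OF pH(2)]) linarith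
    also have "\<dots> < \<sigma> i x" by (rule bounds(1)[OF x])
    finally show ?thesis .
  qed
  ultimately show thesis
    using deriv \<sigma>'_cont \<sigma>'_pos that[of \<sigma> \<sigma>'] by blast
qed

text \<open>The derivative of each inverse is continuous and positive on (0, \<infinity>), hence
  bounded and bounded away from 0 on compact sets; this gives both the Lipschitz property and the
  derivative bounds.\<close>

lemma Omega_path_of_smooth:
  fixes \<sigma> :: "'n::finite \<Rightarrow> real \<Rightarrow> real"
  assumes \<sigma>: "\<And>i. class_Kinf (\<sigma> i)"
    and deriv: "\<And>i r. 0 < r \<Longrightarrow> (\<sigma> i has_real_derivative \<sigma>' i r) (at r)"
    and cont: "\<And>i. continuous_on {0<..} (\<sigma>' i)" and pos: "\<And>i r. 0 < r \<Longrightarrow> 0 < \<sigma>' i r"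
    and less: "\<And>i r. 0 < r \<Longrightarrow> (MAX j. \<gamma> i j (\<sigma> j r)) < \<sigma> i r"
  shows "Omega_path (gain_operator \<gamma>) \<sigma>"
proof -
  define e where "e i y = inverse (\<sigma>' i (Kinv (\<sigma> i) y))" for i y
  have inv_pos: "0 < Kinv (\<sigma> i) y" if "0 < y" for i y
    using that class_K_zero[OF class_Kinf_imp_K[OF \<sigma>]] by (subst less_Kinv_iff[OF \<sigma>]) auto
  have inv_cont: "continuous_on {0<..} (Kinv (\<sigma> i))" for i
    by (rule continuous_on_subset[OF class_K_continuous[OF class_Kinf_imp_K[OF class_Kinf_Kinv[OF \<sigma>]]]]) auto
  have e_deriv: "(Kinv (\<sigma> i) has_real_derivative e i y) (at y)" if y: "0 < y" for i y
    unfolding e_def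
  proof (rule DERIV_inverse_function[where f = "\<sigma> i" and a = 0 and b = "y + 1"])
    show "(\<sigma> i has_real_derivative \<sigma>' i (Kinv (\<sigma> i) y)) (at (Kinv (\<sigma> i) y))"
      by (rule deriv[OF inv_pos[OF y]])
    show "\<sigma>' i (Kinv (\<sigma> i) y) \<noteq> 0" using pos[OF inv_pos[OF y]] by (metis less_irrefl)
    show "\<sigma> i (Kinv (\<sigma> i) z) = z" if "0 < z" for z by (rule Kinv_right[OF \<sigma>]) (use that in auto)
    show "isCont (Kinv (\<sigma> i)) y"
      using continuous_on_interior[OF inv_cont, of y i] y by (simp add: interior_open)
  qed (use y in auto)
  have e_pos: "0 < e i y" if "0 < y" for i y using pos[OF inv_pos[OF that]] by (simp add: e_def)
  have "continuous_on {0<..} (\<lambda>y. \<sigma>' i (Kinv (\<sigma> i) y))" for i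
    by (rule continuous_on_compose2[OF cont inv_cont]) (use inv_pos in auto)
  then have e_cont: "continuous_on {0<..} (e i)" for i
    unfolding e_def by (rule continuous_on_inverse) (metis pos inv_pos greaterThan_iff less_irrefl)
  have e_bounds: "\<exists>k K. 0 < k \<and> (\<forall>y\<in>P. k \<le> e i y \<and> e i y \<le> K)" if P: "compact P" "P \<subseteq> {0<..}" for P i
  proof (cases "P = {}")
    case False
    have c: "continuous_on P (e i)" by (rule continuous_on_subset[OF e_cont P(2)])
    obtain a b where "a \<in> P" "\<forall>y\<in>P. e i a \<le> e i y" "\<forall>y\<in>P. e i y \<le> e i b"
      using continuous_attains_inf[OF P(1) False c] continuous_attains_sup[OF P(1) False c] by blast
    then show ?thesis using e_pos[of a i] P(2) by (intro exI[of _ "e i a"] exI[of _ "e i b"]) auto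
  qed (auto intro: exI[of _ 1])
  show ?thesis
    unfolding Omega_path_def
  proof (intro conjI allI impI)
    fix i show "class_Kinf (\<sigma> i)" by (rule \<sigma>)
  next
    fix i and r :: real assume r: "0 < r"
    have "{r / 2..3 * r / 2} \<subseteq> {0<..}" using r by auto
    then obtain k K where K: "0 < k" "\<forall>y\<in>{r / 2..3 * r / 2}. k \<le> e i y \<and> e i y \<le> K"
      using e_bounds[of "{r / 2..3 * r / 2}" i] by auto
    have "K-lipschitz_on {r / 2..3 * r / 2} (Kinv (\<sigma> i))"
    proof (rule lipschitz_onI)
      fix x y assume "x \<in> {r / 2..3 * r / 2}" "y \<in> {r / 2..3 * r / 2}"
      then show "dist (Kinv (\<sigma> i) x) (Kinv (\<sigma> i) y) \<le> K * dist x y"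
        unfolding dist_norm
        by (intro field_differentiable_bound[of "{r / 2..3 * r / 2}" _ "e i"])
          (use K r in \<open>force intro!: has_field_derivative_at_within[OF e_deriv]\<close>)+
    next
      have "r \<in> {r / 2..3 * r / 2}" using r by auto
      then show "0 \<le> K" using K(1) bspec[OF K(2), of r] by linarith
    qed
    then show "\<exists>\<delta>>0. \<exists>L. L-lipschitz_on (ball r \<delta> \<inter> {0<..}) (Kinv (\<sigma> i))"
      using r by (intro exI[of _ "r / 2"] conjI exI[of _ K])
        (auto elim!: lipschitz_on_subset simp: dist_real_def abs_if field_simps split: if_splits)
  next
    fix P :: "real set" assume P: "compact P \<and> P \<subseteq> {0<..}"
    then have "\<forall>i. \<exists>k K. 0 < k \<and> (\<forall>y\<in>P. k \<le> e i y \<and> e i y \<le> K)" using e_bounds by blast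
    then obtain k K where K: "\<And>i. 0 < k i" "\<And>i y. y \<in> P \<Longrightarrow> k i \<le> e i y" "\<And>i y. y \<in> P \<Longrightarrow> e i y \<le> K i"
      by metis
    define K1 where "K1 = (MIN i. k i)"
    \<comment> \<open>The second entry ensures \<open>K1 < K2\<close>, also when \<open>P\<close> is
      empty or the bounds coincide.\<close>
    define K2 where "K2 = max (MAX i. K i) (K1 + 1)"
    have "0 < K1" using K(1) Min_range_attained[of k] by (auto simp: K1_def)
    moreover have "K1 < K2" by (simp add: K2_def)
    moreover have "K1 \<le> e i y" "e i y \<le> K2" if "y \<in> P" for i y
      using K(2,3)[OF that, of i] Min_range_le[of k i] Max_range_ge[of K i] unfolding K1_def K2_def by linarith+
    moreover have "deriv (Kinv (\<sigma> i)) y = e i y" if "y \<in> P" for i y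
      using P that by (intro DERIV_imp_deriv e_deriv) auto
    ultimately show "\<exists>K1 K2. 0 < K1 \<and> K1 < K2 \<and> (\<forall>i. \<forall>r\<in>P. Kinv (\<sigma> i) differentiable (at r) \<longrightarrow>
        K1 \<le> deriv (Kinv (\<sigma> i)) r \<and> deriv (Kinv (\<sigma> i)) r \<le> K2)"
      by (intro exI[of _ K1] exI[of _ K2]) simp
  next
    fix r :: real and i assume "0 < r"
    then show "gain_operator \<gamma> (\<chi> j. \<sigma> j r) $ i < \<sigma> i r"
      using less[of r i] by (simp add: gain_operator_def)
  qed
qed

lemma Omega_path_exists:
  assumes "gain_matrix \<gamma>" "no_superfixpoint \<gamma>"
  shows "\<exists>\<sigma>. Omega_path (gain_operator \<gamma>) \<sigma>"
proof -
  obtain \<sigma> \<sigma>' where "\<And>i. class_Kinf (\<sigma> i)"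
    "\<And>i r. 0 < r \<Longrightarrow> (\<sigma> i has_real_derivative \<sigma>' i r) (at r)"
    "\<And>i. continuous_on {0<..} (\<sigma>' i)" "\<And>i r. 0 < r \<Longrightarrow> 0 < \<sigma>' i r"
    "\<And>i r. 0 < r \<Longrightarrow> (MAX j. \<gamma> i j (\<sigma> j r)) < \<sigma> i r"
    by (rule smooth_gain_path[OF assms]) blast
  then have "Omega_path (gain_operator \<gamma>) \<sigma>" by (rule Omega_path_of_smooth)
  then show ?thesis by blast
qed

section \<open>From ISS-Lyapunov functions to ISS\<close>

text \<open>The last point at which the graph lies on or below the line of slope e from the left end
  must be b, since the Dini condition continues the estimate a little further. The slope e is
  arbitrarily small.\<close>

lemma nonincreasing_of_dini:
  fixes g :: "real \<Rightarrow> real"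
  assumes ab: "a \<le> b" and cont: "continuous_on {a..b} g"
    and dini: "\<And>t e. a \<le> t \<Longrightarrow> t < b \<Longrightarrow> 0 < e \<Longrightarrow> \<forall>\<^sub>F h in at_right 0. g (t + h) \<le> g t + e * h"
  shows "g b \<le> g a"
proof (rule field_le_epsilon)
  fix \<epsilon> :: real assume \<epsilon>: "0 < \<epsilon>"
  \<comment> \<open>The summand 1 keeps the denominator positive when a = b.\<close>
  define e where "e = \<epsilon> / (b - a + 1)"
  have e: "0 < e" "e * (b - a) \<le> \<epsilon>" using \<epsilon> ab by (auto simp: e_def field_simps)
  define T where "T = {t \<in> {a..b}. g t \<le> g a + e * (t - a)}"
  have "closed T"
    unfolding T_def by (intro continuous_on_closed_Collect_le[OF cont] continuous_intros closed_atLeastAtMost)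
  moreover have bT: "bdd_above T" and aT: "a \<in> T" using ab by (auto simp: T_def intro: bdd_aboveI)
  ultimately have "Sup T \<in> T" using closed_contains_Sup[of T] by auto
  then have s: "a \<le> Sup T" "Sup T \<le> b" "g (Sup T) \<le> g a + e * (Sup T - a)" by (auto simp: T_def)
  have "Sup T = b"
  proof (rule ccontr)
    assume "Sup T \<noteq> b"
    then have s': "Sup T < b" using s by simp
    have "\<forall>\<^sub>F h in at_right 0. h \<in> {0<..<b - Sup T}"
      by (rule eventually_at_right_real) (use s' in simp)
    with dini[OF s(1) s' e(1)]
    have "\<forall>\<^sub>F h in at_right 0. g (Sup T + h) \<le> g (Sup T) + e * h \<and> 0 < h \<and> h < b - Sup T"
      by eventually_elim auto
    then obtain h where h: "g (Sup T + h) \<le> g (Sup T) + e * h" "0 < h" "h < b - Sup T"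
      using eventually_happens[of _ "at_right (0::real)"] by auto
    have "Sup T + h \<in> T" using h s by (auto simp: T_def algebra_simps)
    then show False using cSup_upper[OF _ bT, of "Sup T + h"] h by auto
  qed
  then show "g b \<le> g a + \<epsilon>" using s(3) e(2) by simp
qed

lemma has_derivative_upper_right:
  fixes H :: "real \<Rightarrow> real"
  assumes "(H has_real_derivative D) (at v)" "0 < e"
  shows "\<forall>\<^sub>F h in at_right 0. H (v + k * h) \<le> H v + (k * D + e) * h"
proof -
  have "((\<lambda>h. H (v + k * h)) has_real_derivative D * (0 + k * 1)) (at 0)"
    by (rule DERIV_chain2[of H]) (auto intro!: derivative_eq_intros simp: assms(1))
  then have "((\<lambda>h. (H (v + k * h) - H v) / h) \<longlongrightarrow> k * D) (at_right 0)"
    by (auto simp: has_field_derivative_iff mult.commute intro: tendsto_mono[OF at_le])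
  then have "\<forall>\<^sub>F h in at_right 0. (H (v + k * h) - H v) / h < k * D + e"
    by (rule order_tendstoD(2)) (use assms(2) in simp)
  moreover have "\<forall>\<^sub>F h in at_right 0. 0 < (h::real)" by (simp add: eventually_at_right_less)
  ultimately show ?thesis
    by eventually_elim (auto simp: field_simps)
qed

text \<open>Together with \<open>lie_derivative_leI\<close> this trades the limes superior for
  estimates with a slack e, which pass through maxima and monotone functions.\<close>

lemma lie_derivative_upper:
  assumes "lie_derivative \<phi> V z w \<le> ereal (- a)" "0 < e"
  shows "\<forall>\<^sub>F h in at_right 0. V (\<phi> h z w) \<le> V z + (- a + e) * h"
proof -
  have "\<forall>\<^sub>F h in at_right 0. ereal ((V (\<phi> h z w) - V z) / h) < ereal (- a + e)"
    by (rule Limsup_lessD, fold lie_derivative_def)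
      (rule le_less_trans[OF assms(1)], use assms(2) in simp)
  moreover have "\<forall>\<^sub>F h in at_right 0. 0 < (h::real)" by (simp add: eventually_at_right_less)
  ultimately show ?thesis
    by eventually_elim (auto simp: field_simps)
qed

lemma lie_derivative_leI:
  assumes "\<And>e. 0 < e \<Longrightarrow> \<forall>\<^sub>F h in at_right 0. V (\<phi> h z w) \<le> V z + (- a + e) * h"
  shows "lie_derivative \<phi> V z w \<le> ereal (- a)"
  unfolding lie_derivative_def Limsup_le_iff
proof (intro allI impI)
  fix y assume "ereal (- a) < y"
  then obtain r where r: "- a < r" "ereal r < y" by (metis ereal_dense2 less_ereal.simps(1) less_trans)
  have "\<forall>\<^sub>F h in at_right 0. V (\<phi> h z w) \<le> V z + (- a + (r + a)) * h"
    by (rule assms) (use r in simp)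
  moreover have "\<forall>\<^sub>F h in at_right 0. 0 < (h::real)" by (simp add: eventually_at_right_less)
  ultimately show "\<forall>\<^sub>F h in at_right 0. ereal ((V (\<phi> h z w) - V z) / h) < y"
  proof eventually_elim
    case (elim h)
    then have "(V (\<phi> h z w) - V z) / h \<le> r" by (simp add: field_simps)
    then show ?case using r(2) by (meson ereal_less_eq(3) le_less_trans)
  qed
qed

text \<open>A comparison principle freed from the control system: \<open>c\<close> stands for the
  gain of the input norm, and decay is asked only above it. As a predicate it lets one
  \<open>\<beta>\<close> be handed out for all curves, times and levels.\<close>

definition decay_bound :: "(real \<Rightarrow> real) \<Rightarrow> (real \<Rightarrow> real \<Rightarrow> real) \<Rightarrow> bool" where
  "decay_bound \<alpha> \<beta> \<longleftrightarrow>
     (\<forall>y \<tau> c. 0 \<le> \<tau> \<longrightarrow> continuous_on {0..\<tau>} y \<longrightarrow> 0 \<le> c \<longrightarrow>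
        (\<forall>t e. 0 \<le> t \<longrightarrow> t < \<tau> \<longrightarrow> c < y t \<longrightarrow> 0 < e \<longrightarrow>
           (\<forall>\<^sub>F h in at_right 0. y (t + h) \<le> y t + (- \<alpha> (y t) + e) * h)) \<longrightarrow>
        y \<tau> \<le> max (\<beta> (y 0) \<tau>) c)"

lemma decay_boundD:
  assumes "decay_bound \<alpha> \<beta>" "0 \<le> \<tau>" "continuous_on {0..\<tau>} y" "0 \<le> c"
    "\<And>t e. 0 \<le> t \<Longrightarrow> t < \<tau> \<Longrightarrow> c < y t \<Longrightarrow> 0 < e \<Longrightarrow>
       \<forall>\<^sub>F h in at_right 0. y (t + h) \<le> y t + (- \<alpha> (y t) + e) * h"
  shows "y \<tau> \<le> max (\<beta> (y 0) \<tau>) c"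
  using assms unfolding decay_bound_def by blast

text \<open>The comparison function solves \<open>y' = - min (\<alpha> y) y\<close>; \<open>H\<close> is the time along its solutions.\<close>

lemma comparison_KL:
  assumes \<alpha>: "pos_def \<alpha>"
  obtains \<beta> where "class_KL \<beta>" "\<And>r t. 0 \<le> r \<Longrightarrow> 0 \<le> t \<Longrightarrow> \<beta> r t \<le> r"
    "decay_bound \<alpha> \<beta>"
proof -
  \<comment> \<open>The cap by the identity provides the bound for \<open>time_change\<close>;
    solutions then never reach 0, and \<open>\<beta> r\<close> is strictly decreasing on the whole
    half-line.\<close>
  define \<alpha>' where "\<alpha>' s = min (\<alpha> s) s" for s
  have cont: "continuous_on {0<..} \<alpha>'"
    unfolding \<alpha>'_def using \<alpha> by (intro continuous_intros) (auto simp: pos_def_def intro: continuous_on_subset)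
  have pos: "0 < \<alpha>' s" and le: "\<alpha>' s \<le> s" if "0 < s" for s
    using \<alpha> that by (auto simp: \<alpha>'_def pos_def_def)
  obtain H p where H: "\<And>x. 0 < x \<Longrightarrow> (H has_real_derivative 1 / \<alpha>' x) (at x)"
    and p: "\<And>x. 0 < x \<Longrightarrow> p (H x) = x" "\<And>t. 0 < p t" "\<And>t. H (p t) = t"
      "continuous_on UNIV p" "strict_mono p" "strict_mono_on {0<..} H"
    by (rule time_change[OF cont pos le], assumption, assumption, rule that) assumption+
  have H_less: "H x < H y \<longleftrightarrow> x < y" and H_le: "H x \<le> H y \<longleftrightarrow> x \<le> y" if "0 < x" "0 < y" for x y
    using strict_mono_onD[OF p(6), of x y] strict_mono_onD[OF p(6), of y x] that
    by (cases x y rule: linorder_cases; force)+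
  have H_cont: "continuous_on {0<..} H"
    using H by (auto intro!: continuous_at_imp_continuous_on DERIV_isCont)
  \<comment> \<open>\<open>p\<close> runs upwards, so decay is motion backwards by the time t; r = 0
    is no point of the flow and gets its own value.\<close>
  define \<beta> where "\<beta> r t = (if 0 < r then p (H r - t) else 0)" for r t
  have \<beta>_le: "\<beta> r t \<le> r" if "0 \<le> r" "0 \<le> t" for r t
  proof (cases "r = 0")
    case False
    then have "p (H r - t) \<le> p (H r)" using that by (simp add: strict_mono_less_eq[OF p(5)])
    then show ?thesis using p(1)[of r] False that by (simp add: \<beta>_def)
  qed (simp add: \<beta>_def)
  have \<beta>_nonneg: "0 \<le> \<beta> r t" for r t using p(2)[of "H r - t"] by (simp add: \<beta>_def)
  have "class_KL \<beta>"
    unfolding class_KL_def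
  proof (intro conjI allI impI)
    fix t :: real assume t: "0 \<le> t"
    show "class_K (\<lambda>r. \<beta> r t)"
    proof (rule class_KI)
      show "\<beta> 0 t = 0" by (simp add: \<beta>_def)
      show "\<beta> x t < \<beta> y t" if "0 \<le> x" "x < y" for x y
        using that p(2) H_less[of x y] by (auto simp: \<beta>_def strict_mono_less[OF p(5)])
      show "continuous_on {0..} (\<lambda>r. \<beta> r t)"
        unfolding continuous_on_eq_continuous_within
      proof
        fix x :: real assume x: "x \<in> {0..}"
        show "continuous (at x within {0..}) (\<lambda>r. \<beta> r t)"
        proof (cases "x = 0")
          case True
          have "((\<lambda>r. \<beta> r t) \<longlongrightarrow> 0) (at 0 within {0..})"
          proof (rule tendsto_sandwich[OF _ _ tendsto_const tendsto_ident_at])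
            show "\<forall>\<^sub>F r in at 0 within {0..}. 0 \<le> \<beta> r t" by (simp add: \<beta>_nonneg)
            show "\<forall>\<^sub>F r in at 0 within {0..}. \<beta> r t \<le> r"
              by (auto simp: eventually_at_filter intro!: always_eventually \<beta>_le t)
          qed
          then show ?thesis by (simp add: True continuous_within \<beta>_def)
        next
          case False
          then have x: "0 < x" using x by simp
          have "continuous_on {0<..} (\<lambda>r. p (H r - t))"
            by (rule continuous_on_compose2[OF p(4)]) (auto intro!: continuous_intros H_cont)
          then have "continuous_on {0<..} (\<lambda>r. \<beta> r t)"
            by (rule continuous_on_eq) (simp add: \<beta>_def)
          then have "isCont (\<lambda>r. \<beta> r t) x"
            using x by (simp add: continuous_on_eq_continuous_at)
          then show ?thesis by (rule continuous_at_imp_continuous_within)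
        qed
      qed
    qed
  next
    fix r :: real assume r: "0 < r"
    show "continuous_on {0..} (\<beta> r)"
      using r by (auto simp: \<beta>_def[abs_def] intro!: continuous_on_compose2[OF p(4)] continuous_intros)
    show "strict_antimono_on {0..} (\<beta> r)"
      using r by (auto simp: \<beta>_def monotone_on_def strict_mono_less[OF p(5)])
    show "(\<beta> r \<longlongrightarrow> 0) at_top"
    proof (rule order_tendstoI)
      fix a :: real assume "a < 0"
      then show "\<forall>\<^sub>F t in at_top. a < \<beta> r t"
        by (auto intro!: always_eventually less_le_trans[OF _ \<beta>_nonneg])
    next
      fix a :: real assume a: "0 < a"
      show "\<forall>\<^sub>F t in at_top. \<beta> r t < a"
        using eventually_gt_at_top[of "H r - H a"]
      proof eventually_elim
        case (elim t)
        then have "p (H r - t) < p (H a)" by (simp add: strict_mono_less[OF p(5)])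
        then show ?case using r a by (simp add: \<beta>_def p(1))
      qed
    qed
  qed
  moreover
  have "y \<tau> \<le> max (\<beta> (y 0) \<tau>) c"
    if \<tau>: "0 \<le> \<tau>" and y: "continuous_on {0..\<tau>} y" and c: "0 \<le> c"
      and dini: "\<And>t e. 0 \<le> t \<Longrightarrow> t < \<tau> \<Longrightarrow> c < y t \<Longrightarrow> 0 < e \<Longrightarrow>
         \<forall>\<^sub>F h in at_right 0. y (t + h) \<le> y t + (- \<alpha> (y t) + e) * h" for y \<tau> c
  proof -
    \<comment> \<open>\<open>H (y t) + t\<close> is constant along exact solutions of y' = -
      \<alpha>'(y), and nonincreasing along curves that decay at least as fast.\<close>
    have decay: "H (y \<tau>) + \<tau> \<le> H (y s) + s"
      if s: "0 \<le> s" "s \<le> \<tau>" and above: "\<And>t. s \<le> t \<Longrightarrow> t \<le> \<tau> \<Longrightarrow> c < y t" for s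
    proof (rule nonincreasing_of_dini[OF s(2), of "\<lambda>t. H (y t) + t"])
      have "continuous_on {s..\<tau>} y" by (rule continuous_on_subset[OF y]) (use s in auto)
      then show "continuous_on {s..\<tau>} (\<lambda>t. H (y t) + t)"
        by (intro continuous_intros continuous_on_compose2[OF H_cont]) (use above c in force)+
    next
      fix t e :: real assume t: "s \<le> t" "t < \<tau>" and e: "0 < e"
      define v where "v = y t"
      have v: "c < v" "0 < v" using above[of t] t c by (auto simp: v_def)
      \<comment> \<open>The slack is scaled by \<open>\<alpha>' v\<close> because \<open>H\<close>
        multiplies slopes by \<open>1 / \<alpha>' v\<close>; it then costs e / 2, and the expansion
        of \<open>H\<close> costs the other half.\<close>
      define k where "k = - \<alpha> v + \<alpha>' v * e / 2"
      have slope: "k * (1 / \<alpha>' v) + e / 2 \<le> - 1 + e"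
        using pos[OF v(2)] by (simp add: k_def field_simps) (simp add: \<alpha>'_def)
      have "\<forall>\<^sub>F h in at_right 0. y (t + h) \<le> v + k * h"
        using dini[of t "\<alpha>' v * e / 2"] s t v e pos[OF v(2)] by (simp add: v_def k_def)
      moreover have "\<forall>\<^sub>F h in at_right 0. H (v + k * h) \<le> H v + (k * (1 / \<alpha>' v) + e / 2) * h"
        by (rule has_derivative_upper_right[OF H[OF v(2)]]) (use e in simp)
      moreover have "\<forall>\<^sub>F h in at_right 0. h \<in> {0<..<\<tau> - t}"
        by (rule eventually_at_right_real) (use t in simp)
      ultimately show "\<forall>\<^sub>F h in at_right 0. H (y (t + h)) + (t + h) \<le> H (y t) + t + e * h"
      proof eventually_elim
        case (elim h)
        have yh: "0 < y (t + h)" using above[of "t + h"] elim(3) t c by force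
        have "H (y (t + h)) \<le> H (v + k * h)" using yh elim(1) pos[OF v(2)] by (subst H_le) auto
        also have "\<dots> \<le> H v + (- 1 + e) * h"
        proof -
          have "(k * (1 / \<alpha>' v) + e / 2) * h \<le> (- 1 + e) * h"
            by (rule mult_right_mono[OF slope]) (use elim(3) in simp)
          with elim(2) show ?thesis by linarith
        qed
        finally show ?case by (simp add: v_def algebra_simps)
      qed
    qed
    show ?thesis
    proof (cases "y \<tau> \<le> c")
      case False
      define T where "T = {t \<in> {0..\<tau>}. y t \<le> c}"
      show ?thesis
      proof (cases "T = {}")
        case True
        then have above: "c < y t" if "0 \<le> t" "t \<le> \<tau>" for t using that by (force simp: T_def)
        have y0: "0 < y 0" "0 < y \<tau>" using above[of 0] above[of \<tau>] \<tau> c by auto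
        have "H (y \<tau>) \<le> H (y 0) - \<tau>" using decay[of 0] \<tau> above by auto
        then have "p (H (y \<tau>)) \<le> p (H (y 0) - \<tau>)" by (simp add: strict_mono_less_eq[OF p(5)])
        then show ?thesis using y0 p(1) by (simp add: \<beta>_def)
      next
        case ne: False
        \<comment> \<open>This case is contradictory: after its last time at or below
          \<open>c\<close> the curve would have to rise to a value above \<open>c\<close> while it
          decays.\<close>
        have "closed T"
          unfolding T_def using continuous_on_closed_Collect_le[OF y continuous_on_const] by auto
        moreover have bT: "bdd_above T" by (auto simp: T_def intro: bdd_aboveI)
        ultimately have "Sup T \<in> T" using closed_contains_Sup[OF ne] by simp
        then have s: "0 \<le> Sup T" "Sup T \<le> \<tau>" "y (Sup T) \<le> c" by (auto simp: T_def)
        then have s': "Sup T < \<tau>" using False by (cases "Sup T = \<tau>") auto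
        have above: "c < y t" if "Sup T < t" "t \<le> \<tau>" for t
          using cSup_upper[OF _ bT, of t] that s by (force simp: T_def)
        have "(y \<longlongrightarrow> y (Sup T)) (at (Sup T) within {0..\<tau>})"
          using y s by (auto simp: continuous_on_def)
        then have "(y \<longlongrightarrow> y (Sup T)) (at_right (Sup T))"
          using s s' by (auto intro: tendsto_mono simp: at_within_Icc_at_right dest: tendsto_within_subset[of _ _ _ _ "{Sup T..\<tau>}"])
        then have "\<forall>\<^sub>F t in at_right (Sup T). y t < y \<tau>"
          by (rule order_tendstoD(2)) (use False s in simp)
        moreover have "\<forall>\<^sub>F t in at_right (Sup T). t \<in> {Sup T<..<\<tau>}"
          by (rule eventually_at_right_real[OF s'])
        ultimately have "\<forall>\<^sub>F t in at_right (Sup T). y t < y \<tau> \<and> Sup T < t \<and> t < \<tau>"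
          by eventually_elim auto
        then obtain t where t: "y t < y \<tau>" "Sup T < t" "t < \<tau>"
          using eventually_happens[of _ "at_right (Sup T)"] by auto
        have "H (y \<tau>) + \<tau> \<le> H (y t) + t" by (rule decay) (use t s above in auto)
        then have "H (y \<tau>) < H (y t)" using t by simp
        then have "y \<tau> < y t" using above[of t] above[of \<tau>] t s' c by (subst (asm) H_less) auto
        with t show ?thesis by simp
      qed
    qed auto
  qed
  then have "decay_bound \<alpha> \<beta>" unfolding decay_bound_def by blast
  ultimately show thesis using \<beta>_le by (intro that)
qed

section \<open>Inputs and their time shifts\<close>

lemma PC_norm_le_sup_norm:
  assumes "w \<in> PC Y" "0 \<le> t" shows "norm (w t) \<le> sup_norm w"
  unfolding sup_norm_def
proof (rule cSUP_upper)
  from assms(1) obtain B where "\<forall>t\<ge>0. norm (w t) \<le> B" by (auto simp: PC_def bounded_iff)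
  then show "bdd_above ((\<lambda>t. norm (w t)) ` {0..})" by (auto intro: bdd_aboveI)
qed (use assms in auto)

lemma filtermap_at_left_shift: "filtermap (\<lambda>x. x - d) (at_left a) = at_left (a - d)" for a d :: real
  by (simp add: filter_eq_iff eventually_filtermap eventually_at_filter filtermap_nhds_shift[symmetric])

text \<open>Serves the cocycle property: at a later state the decay condition is applied with the
  remaining input.\<close>

lemma PC_shift:
  assumes w: "w \<in> PC Y" and s: "0 \<le> s" shows "(\<lambda>r. w (s + r)) \<in> PC Y"
  unfolding PC_def mem_Collect_eq
proof (intro conjI allI impI)
  show "w (s + t) \<in> Y" if "0 \<le> t" for t using w s that by (auto simp: PC_def)
  have "(\<lambda>r. w (s + r)) ` {0..} \<subseteq> w ` {0..}" using s by auto
  then show "bounded ((\<lambda>r. w (s + r)) ` {0..})"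
    using w by (auto simp: PC_def intro: bounded_subset)
  show "continuous (at_right t) (\<lambda>r. w (s + r))" if "0 \<le> t" for t
  proof -
    have "(w \<longlongrightarrow> w (s + t)) (at_right (s + t))"
      using w s that by (auto simp: PC_def continuous_within)
    moreover have eq: "filtermap (\<lambda>x. s + x) (at_right t) = at_right (s + t)"
      using filtermap_at_right_shift[of "- s" t] by (simp add: add.commute)
    ultimately have "(w \<longlongrightarrow> w (s + t)) (filtermap (\<lambda>x. s + x) (at_right t))" by (simp only:)
    then show ?thesis by (simp add: filterlim_filtermap continuous_within)
  qed
  show "\<exists>l. ((\<lambda>r. w (s + r)) \<longlongrightarrow> l) (at_left t)" if "0 < t" for t
  proof -
    have "\<exists>l. (w \<longlongrightarrow> l) (at_left (s + t))" using w s that by (auto simp: PC_def)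
    then obtain l where "(w \<longlongrightarrow> l) (at_left (s + t))" by blast
    moreover have "filtermap (\<lambda>x. s + x) (at_left t) = at_left (s + t)"
      using filtermap_at_left_shift[of "- s" t] by (simp add: add.commute)
    ultimately have "(w \<longlongrightarrow> l) (filtermap (\<lambda>x. s + x) (at_left t))" by (simp only:)
    then show ?thesis by (auto simp: filterlim_filtermap)
  qed
  fix \<tau>
  have "{t \<in> {0<..\<tau>}. \<not> isCont (\<lambda>r. w (s + r)) t} \<subseteq> (\<lambda>x. x - s) ` {t \<in> {0<..\<tau> + s}. \<not> isCont w t}"
  proof
    fix t assume t: "t \<in> {t \<in> {0<..\<tau>}. \<not> isCont (\<lambda>r. w (s + r)) t}"
    have "isCont (\<lambda>r. w (s + r)) t" if "isCont w (s + t)"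
      using isCont_o2[where f = "\<lambda>r. s + r" and a = t and g = w] that by auto
    with t s show "t \<in> (\<lambda>x. x - s) ` {t \<in> {0<..\<tau> + s}. \<not> isCont w t}"
      by (intro image_eqI[of _ _ "s + t"]) auto
  qed
  moreover have "finite {t \<in> {0<..\<tau> + s}. \<not> isCont w t}" using w by (auto simp: PC_def)
  ultimately show "finite {t \<in> {0<..\<tau>}. \<not> isCont (\<lambda>r. w (s + r)) t}"
    by (rule finite_subset[OF _ finite_imageI])
qed

lemma sup_norm_shift_le:
  assumes w: "w \<in> PC Y" and s: "0 \<le> s" shows "sup_norm (\<lambda>r. w (s + r)) \<le> sup_norm w"
  unfolding sup_norm_def[of "\<lambda>r. w (s + r)"]
  by (rule cSUP_least) (use PC_norm_le_sup_norm[OF w] s in auto)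

lemma sup_norm_nonneg:
  assumes w: "w \<in> PC Y" shows "0 \<le> sup_norm w"
  using PC_norm_le_sup_norm[OF w, of 0] norm_ge_zero[of "w 0"] by linarith

section \<open>Lyapunov functions along an abstract control system\<close>

context
  fixes Z :: "'a::real_normed_vector set" and W :: "'w::real_normed_vector set"
    and D :: "real \<Rightarrow> 'a \<Rightarrow> (real \<Rightarrow> 'w) \<Rightarrow> bool" and \<phi>
  assumes cs: "control_system Z W D \<phi>"
    and flow: "\<And>t x w. x \<in> Z \<Longrightarrow> w \<in> PC W \<Longrightarrow> D t x w \<Longrightarrow> 0 \<le> t \<and> \<phi> t x w \<in> Z"
begin

lemma flow_zero: "x \<in> Z \<Longrightarrow> w \<in> PC W \<Longrightarrow> \<phi> 0 x w = x"
  and flow_continuous: "x \<in> Z \<Longrightarrow> w \<in> PC W \<Longrightarrow> continuous_on {t. D t x w} (\<lambda>t. \<phi> t x w)"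
  and flow_local: "x \<in> Z \<Longrightarrow> w \<in> PC W \<Longrightarrow> \<exists>t>0. D t x w"
  using cs unfolding control_system_def by blast+

lemma flow_cocycle:
  assumes "x \<in> Z" "w \<in> PC W" "0 \<le> t" "0 \<le> h" "D (t + h) x w"
  shows "D t x w" "\<phi> h (\<phi> t x w) (\<lambda>s. w (t + s)) = \<phi> (t + h) x w"
  using cs assms unfolding control_system_def by blast+

lemma flow_downward:
  assumes "x \<in> Z" "w \<in> PC W" "0 \<le> s" "s \<le> t" "D t x w" shows "D s x w"
  using flow_cocycle(1)[OF assms(1-3), of "t - s"] assms by simp

text \<open>The cocycle property turns an increment of V at time t into one that starts at the state
  reached, under the shifted input, whose norm has not grown. Decay is assumed for positive V only,
  so that the estimate is available before the zero set of V has been treated.\<close>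

lemma lyapunov_estimate:
  assumes V: "continuous_on Z V" and gain: "class_K gain"
    and decay: "\<And>x w. x \<in> Z \<Longrightarrow> w \<in> PC W \<Longrightarrow> 0 < V x \<Longrightarrow> gain (sup_norm w) \<le> V x \<Longrightarrow>
      lie_derivative \<phi> V x w \<le> ereal (- \<alpha> (V x))"
    and \<beta>: "decay_bound \<alpha> \<beta>"
    and x: "x \<in> Z" and w: "w \<in> PC W" and D: "D \<tau> x w"
  shows "V (\<phi> \<tau> x w) \<le> max (\<beta> (V x) \<tau>) (gain (sup_norm w))"
proof -
  have \<tau>: "0 \<le> \<tau>" using flow[OF x w D] by blast
  have Dt: "D t x w" if "0 \<le> t" "t \<le> \<tau>" for t by (rule flow_downward[OF x w that D])
  have "V (\<phi> \<tau> x w) \<le> max (\<beta> (V (\<phi> 0 x w)) \<tau>) (gain (sup_norm w))"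
  proof (rule decay_boundD[OF \<beta> \<tau>, of "\<lambda>t. V (\<phi> t x w)"])
    have "continuous_on {0..\<tau>} (\<lambda>t. \<phi> t x w)"
      by (rule continuous_on_subset[OF flow_continuous[OF x w]]) (use Dt in auto)
    then show "continuous_on {0..\<tau>} (\<lambda>t. V (\<phi> t x w))"
      by (rule continuous_on_compose2[OF V]) (use flow[OF x w Dt] in auto)
    show "0 \<le> gain (sup_norm w)" by (rule class_K_nonneg[OF gain sup_norm_nonneg[OF w]])
  next
    fix t e :: real
    assume t: "0 \<le> t" "t < \<tau>" and above: "gain (sup_norm w) < V (\<phi> t x w)" and e: "0 < e"
    let ?z = "\<phi> t x w" and ?w = "\<lambda>s. w (t + s)"
    have z: "?z \<in> Z" using flow[OF x w Dt[of t]] t by auto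
    have w': "?w \<in> PC W" by (rule PC_shift[OF w t(1)])
    have "gain (sup_norm ?w) \<le> gain (sup_norm w)"
      by (rule class_K_le[OF gain sup_norm_nonneg[OF w'] sup_norm_shift_le[OF w t(1)]])
    moreover have "0 \<le> gain (sup_norm w)" by (rule class_K_nonneg[OF gain sup_norm_nonneg[OF w]])
    ultimately have "lie_derivative \<phi> V ?z ?w \<le> ereal (- \<alpha> (V ?z))"
      using above by (intro decay z w') auto
    then have "\<forall>\<^sub>F h in at_right 0. V (\<phi> h ?z ?w) \<le> V ?z + (- \<alpha> (V ?z) + e) * h"
      by (rule lie_derivative_upper[OF _ e])
    moreover have "\<forall>\<^sub>F h in at_right 0. h \<in> {0<..<\<tau> - t}"
      by (rule eventually_at_right_real) (use t in simp)
    ultimately show "\<forall>\<^sub>F h in at_right 0. V (\<phi> (t + h) x w) \<le> V ?z + (- \<alpha> (V ?z) + e) * h"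
    proof eventually_elim
      case (elim h)
      have "\<phi> h ?z ?w = \<phi> (t + h) x w"
        using elim(2) t by (intro flow_cocycle(2)[OF x w] Dt) auto
      with elim(1) show ?case by simp
    qed
  qed
  then show ?thesis by (simp add: flow_zero[OF x w])
qed

text \<open>Where \<open>V\<close> vanishes the decay condition is automatic, since the estimate on the rest of the
  state space keeps the trajectory in the zero set.\<close>

lemma ISS_LyapunovI:
  assumes V: "continuous_on Z V" "\<And>x. x \<in> Z \<Longrightarrow> 0 \<le> V x" and gain: "class_K gain"
    and \<psi>: "class_Kinf \<psi>1" "class_Kinf \<psi>2"
      "\<And>x. x \<in> Z \<Longrightarrow> \<psi>1 (N x) \<le> V x \<and> V x \<le> \<psi>2 (N x)"
    and \<alpha>: "pos_def \<alpha>"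
    and decay: "\<And>x w. x \<in> Z \<Longrightarrow> w \<in> PC W \<Longrightarrow> 0 < V x \<Longrightarrow> gain (sup_norm w) \<le> V x \<Longrightarrow>
      lie_derivative \<phi> V x w \<le> ereal (- \<alpha> (V x))"
  shows "ISS_Lyapunov N Z W \<phi> V gain"
proof -
  obtain \<beta> where \<beta>: "class_KL \<beta>" "decay_bound \<alpha> \<beta>"
    by (rule comparison_KL[OF \<alpha>], rule that) assumption+
  have "lie_derivative \<phi> V x w \<le> ereal (- \<alpha> (V x))"
    if x: "x \<in> Z" and w: "w \<in> PC W" and le: "gain (sup_norm w) \<le> V x" for x w
  proof (cases "0 < V x")
    case False
    then have V0: "V x = 0" using V(2)[OF x] by simp
    then have g0: "gain (sup_norm w) = 0"
      using le class_K_nonneg[OF gain sup_norm_nonneg[OF w]] by simp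
    obtain t0 where t0: "0 < t0" "D t0 x w" using flow_local[OF x w] by blast
    have Vt: "V (\<phi> t x w) = 0" if t: "0 < t" "t < t0" for t
    proof -
      have D: "D t x w" by (rule flow_downward[OF x w _ _ t0(2)]) (use t in auto)
      have "V (\<phi> t x w) \<le> max (\<beta> (V x) t) (gain (sup_norm w))"
        by (rule lyapunov_estimate[OF V(1) gain decay \<beta>(2) x w D]) assumption+
      moreover have "\<beta> 0 t = 0"
        using \<beta>(1) t by (auto simp: class_KL_def intro: class_K_zero)
      ultimately show ?thesis using V(2) flow[OF x w D] V0 g0 by force
    qed
    have "lie_derivative \<phi> V x w \<le> ereal (- 0)"
    proof (rule lie_derivative_leI)
      fix e :: real assume e: "0 < e"
      have "\<forall>\<^sub>F h in at_right 0. h \<in> {0<..<t0}" by (rule eventually_at_right_real[OF t0(1)])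
      then show "\<forall>\<^sub>F h in at_right 0. V (\<phi> h x w) \<le> V x + (- 0 + e) * h"
        by eventually_elim (use Vt e V0 in auto)
    qed
    then show ?thesis using \<alpha> V0 by (simp add: pos_def_def)
  qed (use decay x w le in blast)
  then show ?thesis
    unfolding ISS_Lyapunov_def using V gain \<psi> \<alpha> by blast
qed

text \<open>Since \<beta> r t \<le> r, the estimate bounds V, and through \<open>\<psi>1\<close> the
  norm, along the trajectory; the BIC property then excludes finite existence times. The same
  estimate, conjugated by the bounds of V, is the ISS estimate.\<close>

lemma ISS_Lyapunov_imp_ISS:
  assumes bic: "BIC N Z W D \<phi>" and N: "\<And>x. x \<in> Z \<Longrightarrow> 0 \<le> N x"
    and lyap: "ISS_Lyapunov N Z W \<phi> V gain"
  shows "ISS N Z W D \<phi>"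
proof -
  from lyap have gain: "class_K gain" and V: "continuous_on Z V" "\<And>x. x \<in> Z \<Longrightarrow> 0 \<le> V x"
    by (auto simp: ISS_Lyapunov_def)
  from lyap obtain \<psi>1 \<psi>2 \<alpha> where \<psi>: "class_Kinf \<psi>1" "class_Kinf \<psi>2"
      "\<And>x. x \<in> Z \<Longrightarrow> \<psi>1 (N x) \<le> V x" "\<And>x. x \<in> Z \<Longrightarrow> V x \<le> \<psi>2 (N x)"
    and \<alpha>: "pos_def \<alpha>"
    and decay: "\<And>x w. x \<in> Z \<Longrightarrow> w \<in> PC W \<Longrightarrow> gain (sup_norm w) \<le> V x \<Longrightarrow>
      lie_derivative \<phi> V x w \<le> ereal (- \<alpha> (V x))"
    unfolding ISS_Lyapunov_def by blast
  obtain \<beta> where \<beta>: "class_KL \<beta>" "\<And>r t. 0 \<le> r \<Longrightarrow> 0 \<le> t \<Longrightarrow> \<beta> r t \<le> r"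
      "decay_bound \<alpha> \<beta>"
    by (rule comparison_KL[OF \<alpha>], rule that) assumption+
  note \<psi>K = class_Kinf_imp_K[OF \<psi>(1)] class_Kinf_imp_K[OF \<psi>(2)]
  note \<psi>i = class_Kinf_Kinv[OF \<psi>(1)]
  note \<psi>iK = class_Kinf_imp_K[OF \<psi>i]
  have \<beta>K: "class_K (\<lambda>r. \<beta> r t)" if "0 \<le> t" for t using \<beta>(1) that by (simp add: class_KL_def)
  have est: "V (\<phi> t x w) \<le> max (\<beta> (V x) t) (gain (sup_norm w))"
    if "x \<in> Z" "w \<in> PC W" "D t x w" for x w t
    by (rule lyapunov_estimate[OF V(1) gain decay \<beta>(3) that]) assumption+
  have N_le: "N (\<phi> t x w) \<le> Kinv \<psi>1 (V (\<phi> t x w))" if x: "x \<in> Z" "w \<in> PC W" "D t x w" for x w t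
    using flow[OF x] \<psi>(3) N V(2) by (subst le_Kinv_iff[OF \<psi>(1)]) auto
  define \<beta>' where "\<beta>' r t = Kinv \<psi>1 (\<beta> (\<psi>2 r) t)" for r t
  define \<gamma>' where "\<gamma>' r = Kinv \<psi>1 (gain r)" for r
  have global: "D t x w" if x: "x \<in> Z" "w \<in> PC W" and t: "0 \<le> t" for x w t
  proof -
    have "\<not> bdd_above {t. D t x w}"
    proof
      assume "bdd_above {t. D t x w}"
      then have unb: "\<exists>t. D t x w \<and> N (\<phi> t x w) > M" for M using bic x by (auto simp: BIC_def)
      obtain s where s: "D s x w" "N (\<phi> s x w) > Kinv \<psi>1 (max (V x) (gain (sup_norm w)))"
        using unb by blast
      have s0: "0 \<le> s" using flow[OF x s(1)] by blast
      have "V (\<phi> s x w) \<le> max (V x) (gain (sup_norm w))"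
        using est[OF x s(1)] \<beta>(2)[OF V(2)[OF x(1)] s0] by linarith
      then have "Kinv \<psi>1 (V (\<phi> s x w)) \<le> Kinv \<psi>1 (max (V x) (gain (sup_norm w)))"
        using flow[OF x s(1)] V(2) by (intro class_K_le[OF \<psi>iK]) auto
      then show False using s(2) N_le[OF x s(1)] by linarith
    qed
    then obtain s where "D s x w" "t \<le> s" unfolding bdd_above_def by (metis mem_Collect_eq linear)
    then show ?thesis using flow_downward[OF x t] by blast
  qed
  show ?thesis
    unfolding ISS_def
  proof (intro exI[of _ \<beta>'] exI[of _ \<gamma>'] conjI ballI allI impI)
    show "class_K \<gamma>'" unfolding \<gamma>'_def by (rule class_K_compose[OF \<psi>iK gain])
    show "class_KL \<beta>'"
      unfolding class_KL_def
    proof (intro conjI allI impI)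
      show "class_K (\<lambda>r. \<beta>' r t)" if "0 \<le> t" for t
        unfolding \<beta>'_def by (rule class_K_compose[OF \<psi>iK class_K_compose[OF \<beta>K[OF that] \<psi>K(2)]])
      fix r :: real assume r: "0 < r"
      have p: "0 < \<psi>2 r" by (rule class_K_pos[OF \<psi>K(2) r])
      have nn: "0 \<le> \<beta> (\<psi>2 r) t" if "0 \<le> t" for t by (rule class_K_nonneg[OF \<beta>K[OF that] less_imp_le[OF p]])
      have c: "continuous_on {0..} (\<beta> (\<psi>2 r))" and m: "strict_antimono_on {0..} (\<beta> (\<psi>2 r))"
        and l: "(\<beta> (\<psi>2 r) \<longlongrightarrow> 0) at_top"
        using \<beta>(1) p by (auto simp: class_KL_def)
      show "continuous_on {0..} (\<beta>' r)"
        unfolding \<beta>'_def by (rule continuous_on_compose2[OF class_K_continuous[OF \<psi>iK] c]) (use nn in auto)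
      show "strict_antimono_on {0..} (\<beta>' r)"
      proof (rule monotone_onI)
        fix s t :: real assume st: "s \<in> {0..}" "t \<in> {0..}" "s < t"
        then show "\<beta>' r t < \<beta>' r s"
          unfolding \<beta>'_def using m nn by (intro class_K_less[OF \<psi>iK]) (auto simp: monotone_on_def)
      qed
      have "\<forall>\<^sub>F t in at_top. \<beta> (\<psi>2 r) t \<in> {0..}"
        using eventually_ge_at_top[of "0::real"] by eventually_elim (simp add: nn)
      then have "(\<beta>' r \<longlongrightarrow> Kinv \<psi>1 0) at_top"
        unfolding \<beta>'_def by (intro continuous_on_tendsto_compose[OF class_K_continuous[OF \<psi>iK] l]) auto
      then show "(\<beta>' r \<longlongrightarrow> 0) at_top" by (simp add: class_K_zero[OF \<psi>iK])
    qed
  next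
    fix x w and t :: real assume x: "x \<in> Z" "w \<in> PC W" and t: "0 \<le> t"
    show D: "D t x w" by (rule global[OF x t])
    have Vx: "0 \<le> V x" "V x \<le> \<psi>2 (N x)" using V(2) \<psi>(4) x by auto
    have b: "\<beta> (V x) t \<le> \<beta> (\<psi>2 (N x)) t" by (rule class_K_le[OF \<beta>K[OF t] Vx])
    have nb: "0 \<le> \<beta> (\<psi>2 (N x)) t" by (rule class_K_nonneg[OF \<beta>K[OF t]]) (use Vx in simp)
    have ng: "0 \<le> gain (sup_norm w)" by (rule class_K_nonneg[OF gain sup_norm_nonneg[OF x(2)]])
    have nV: "0 \<le> V (\<phi> t x w)" using flow[OF x D] V(2) by blast
    have pos: "0 \<le> \<beta>' (N x) t" "0 \<le> \<gamma>' (sup_norm w)"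
      unfolding \<beta>'_def \<gamma>'_def using Kinv_nonneg[OF \<psi>(1)] nb ng by auto
    \<comment> \<open>The maximum is kept as an alternative, since \<open>Kinv \<psi>1\<close> is
      monotone but need not be subadditive; the sum enters only at the end, with nonnegative
      terms.\<close>
    have "V (\<phi> t x w) \<le> \<beta> (\<psi>2 (N x)) t \<or> V (\<phi> t x w) \<le> gain (sup_norm w)"
      using est[OF x D] b by linarith
    then have "Kinv \<psi>1 (V (\<phi> t x w)) \<le> \<beta>' (N x) t \<or> Kinv \<psi>1 (V (\<phi> t x w)) \<le> \<gamma>' (sup_norm w)"
      unfolding \<beta>'_def \<gamma>'_def using class_K_le[OF \<psi>iK nV] by blast
    then show "N (\<phi> t x w) \<le> \<beta>' (N x) t + \<gamma>' (sup_norm w)"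
      using N_le[OF x D] pos by linarith
  qed
qed

end

section \<open>Lyapunov function of the interconnection\<close>

text \<open>The witness \<open>k y\<close> is half the distance of \<open>(0, y, y)\<close> to the set of all triples
  (slope of the chord over \<open>[a, b]\<close>, \<open>a\<close>, \<open>b\<close>).\<close>

lemma slope_minorant:
  fixes \<tau> :: "real \<Rightarrow> real"
  assumes mono: "\<And>x y. 0 < x \<Longrightarrow> x \<le> y \<Longrightarrow> \<tau> x \<le> \<tau> y"
    and lip: "\<And>r. 0 < r \<Longrightarrow> \<exists>\<delta>>0. \<exists>L. L-lipschitz_on (ball r \<delta> \<inter> {0<..}) \<tau>"
    and deriv: "\<And>P. compact P \<Longrightarrow> P \<subseteq> {0<..} \<Longrightarrow>
      \<exists>K>0. \<forall>r\<in>P. \<tau> differentiable (at r) \<longrightarrow> K \<le> deriv \<tau> r"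
  obtains k where "continuous_on UNIV k" "\<And>y. 0 < y \<Longrightarrow> 0 < k y"
    "\<And>y a. 0 < y \<Longrightarrow> 0 \<le> a \<Longrightarrow> \<forall>\<^sub>F h in at_right 0. \<tau> (y - a * h) \<le> \<tau> y - k y * a * h"
proof -
  define S where "S = {((\<tau> b - \<tau> a) / (b - a), a, b) | a b. 0 < a \<and> a < b}"
  have "((\<tau> 2 - \<tau> 1) / (2 - 1), 1, 2) \<in> S"
    unfolding S_def mem_Collect_eq by (intro exI[of _ "1::real"] exI[of _ "2::real"]) simp
  then have S: "S \<noteq> {}" by blast
  define k where "k y = infdist (0, y, y) S / 2" for y
  have "continuous_on UNIV k" unfolding k_def by (intro continuous_intros) auto
  moreover have "0 < k y" if y: "0 < y" for y
  proof -
    obtain \<delta> L where \<delta>: "\<delta> > 0" "L-lipschitz_on (ball y \<delta> \<inter> {0<..}) \<tau>" using lip[OF y] by blast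
    have "{y / 2..3 * y / 2} \<subseteq> {0<..}" using y by auto
    then obtain K where K: "K > 0"
      "\<And>r. r \<in> {y / 2..3 * y / 2} \<Longrightarrow> \<tau> differentiable (at r) \<Longrightarrow> K \<le> deriv \<tau> r"
      using deriv[of "{y / 2..3 * y / 2}"] by auto
    define d where "d = min \<delta> (y / 2)"
    have d: "0 < d" "d \<le> \<delta>" "d \<le> y / 2" using \<delta> y by (auto simp: d_def)
    \<comment> \<open>Chords near y are at least as steep as \<open>K\<close>, so a triple in
      \<open>S\<close> differs from (0, y, y) by \<open>K\<close> in the slope or by
      \<open>d\<close> in an end point.\<close>
    have slope: "K \<le> (\<tau> b - \<tau> a) / (b - a)" if ab: "a < b" "\<bar>a - y\<bar> < d" "\<bar>b - y\<bar> < d" for a b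
    proof -
      have sub: "{a..b} \<subseteq> ball y \<delta> \<inter> {0<..}" "{a..b} \<subseteq> {y / 2..3 * y / 2}"
        using ab d y by (auto simp: dist_real_def abs_if split: if_splits)
      have "K * (b - a) \<le> \<tau> b - \<tau> a"
      proof (rule lipschitz_mono_slope_ge[OF ab(1)])
        show "L-lipschitz_on {a..b} \<tau>" by (rule lipschitz_on_subset[OF \<delta>(2) sub(1)])
        show "mono_on {a..b} \<tau>" using sub(1) mono by (auto simp: mono_on_def subset_iff)
      qed (use K(2) sub(2) in auto)
      then show ?thesis using ab by (simp add: field_simps)
    qed
    have "min K d \<le> infdist (0, y, y) S"
      unfolding infdist_notempty[OF S]
    proof (rule cINF_greatest[OF S])
      fix z assume "z \<in> S"
      then obtain a b where z: "z = ((\<tau> b - \<tau> a) / (b - a), a, b)" "0 < a" "a < b" by (auto simp: S_def)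
      have "\<bar>fst z\<bar> \<le> dist (0, y, y) z" using dist_fst_le[of "(0, y, y)" z] by (simp add: dist_real_def)
      then have d1: "\<bar>(\<tau> b - \<tau> a) / (b - a)\<bar> \<le> dist (0, y, y) z" by (simp only: z(1) fst_conv)
      have d2: "dist (y, y) (a, b) \<le> dist (0, y, y) z" using dist_snd_le[of "(0, y, y)" z] z by simp
      have "\<bar>a - y\<bar> \<le> dist (y, y) (a, b)" "\<bar>b - y\<bar> \<le> dist (y, y) (a, b)"
        using dist_fst_le[of "(y, y)" "(a, b)"] dist_snd_le[of "(y, y)" "(a, b)"]
        by (auto simp: dist_real_def)
      then show "min K d \<le> dist (0, y, y) z"
        using slope[OF z(3)] d1 d2 by linarith
    qed
    then show ?thesis using K(1) d(1) by (simp add: k_def)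
  qed
  moreover have "\<forall>\<^sub>F h in at_right 0. \<tau> (y - a * h) \<le> \<tau> y - k y * a * h"
    if y: "0 < y" and a: "0 \<le> a" and ky: "0 < k y" for y a
  proof (cases "a = 0")
    case False
    then have a: "0 < a" using a by simp
    have "\<forall>\<^sub>F h in at_right 0. h \<in> {0<..<min (y / a) (k y / a)}"
      by (rule eventually_at_right_real) (use a y ky in simp)
    then show ?thesis
    proof eventually_elim
      case (elim h)
      \<comment> \<open>The triple of the chord over [y - t, y] has distance at most s + t from (0,
        y, y), so 2 * k y \<le> s + t. As t < k y, this leaves k y \<le> s: the factor 1 / 2 in
        \<open>k\<close> pays for the length of the chord.\<close>
      define t where "t = a * h"
      have t: "0 < t" "t < y" "t < k y" using elim a by (auto simp: t_def field_simps)
      define s where "s = (\<tau> y - \<tau> (y - t)) / (y - (y - t))"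
      have s: "0 \<le> s" using mono[of "y - t" y] t by (simp add: s_def)
      have "(s, y - t, y) \<in> S" unfolding S_def s_def using t by force
      then have "infdist (0, y, y) S \<le> dist (0, y, y) (s, y - t, y)" by (rule infdist_le)
      also have "\<dots> \<le> dist 0 s + dist (y, y) (y - t, y)"
        unfolding dist_Pair_Pair[of 0 "(y, y)"] by (rule sqrt_sum_squares_le_sum) auto
      also have "\<dots> \<le> s + t" using s t by (simp add: dist_Pair_Pair dist_real_def)
      finally have "k y \<le> s" using t by (simp add: k_def)
      then show ?case using t by (simp add: s_def t_def field_simps)
    qed
  qed simp
  ultimately show thesis by (intro that) blast+
qed

section \<open>Trajectories of the whole system and of its subsystems\<close>

lemma transition_map_eq:
  assumes "unique_mild_solutions T Z F W" "x \<in> Z" "w \<in> PC W" "0 \<le> t" "mild_solution T Z F x w t \<xi>"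
  shows "transition_map T Z F t x w = \<xi> t"
  unfolding transition_map_def
proof (rule the_equality)
  show "\<exists>\<eta>. mild_solution T Z F x w t \<eta> \<and> \<eta> t = \<xi> t" using assms(5) by blast
  fix y assume "\<exists>\<eta>. mild_solution T Z F x w t \<eta> \<and> \<eta> t = y"
  then obtain \<eta> where \<eta>: "mild_solution T Z F x w t \<eta>" "\<eta> t = y" by blast
  have "\<forall>s\<in>{0..t}. \<eta> s = \<xi> s"
    using assms(1)[unfolded unique_mild_solutions_def] assms(2-5) \<eta>(1) by blast
  then show "y = \<xi> t" using assms(4) \<eta>(2) by auto
qed

lemma mild_solution_restrict:
  assumes "mild_solution T Z F x w \<tau> \<xi>" "t \<le> \<tau>" shows "mild_solution T Z F x w t \<xi>"
  using assms unfolding mild_solution_def by (auto intro: continuous_on_subset)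

lemma exists_until_flow:
  assumes "unique_mild_solutions T Z F W" "x \<in> Z" "w \<in> PC W" "exists_until T Z F t x w"
  shows "0 \<le> t \<and> transition_map T Z F t x w \<in> Z"
proof -
  from assms(4) obtain \<xi> where t: "0 \<le> t" and \<xi>: "mild_solution T Z F x w t \<xi>"
    by (auto simp: exists_until_def)
  then have "\<xi> t \<in> Z" by (auto simp: mild_solution_def)
  then show ?thesis using t transition_map_eq[OF assms(1-3) t \<xi>] by simp
qed

text \<open>The form of a subsystem input: the other components vary continuously, and only the
  external input may jump.\<close>

lemma PC_Pair:
  assumes c: "continuous_on UNIV v" and b: "bounded (range v)" and u: "u \<in> PC U"
    and Y: "\<And>t. 0 \<le> t \<Longrightarrow> (v t, u t) \<in> Y"
  shows "(\<lambda>t. (v t, u t)) \<in> PC Y"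
  unfolding PC_def mem_Collect_eq
proof (intro conjI allI impI)
  show "(v t, u t) \<in> Y" if "0 \<le> t" for t by (rule Y[OF that])
  have "bounded (range v \<times> u ` {0..})" using b u by (intro bounded_Times) (auto simp: PC_def)
  then show "bounded ((\<lambda>t. (v t, u t)) ` {0..})" by (rule bounded_subset) auto
  have vc: "isCont v t" for t using c by (simp add: continuous_on_eq_continuous_at)
  show "continuous (at_right t) (\<lambda>t. (v t, u t))" if "0 \<le> t" for t
    using u that by (intro continuous_Pair continuous_at_imp_continuous_within[OF vc]) (auto simp: PC_def)
  show "\<exists>l. ((\<lambda>t. (v t, u t)) \<longlongrightarrow> l) (at_left t)" if "0 < t" for t
  proof -
    have "\<exists>l. (u \<longlongrightarrow> l) (at_left t)" using u that by (auto simp: PC_def)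
    then obtain l where "(u \<longlongrightarrow> l) (at_left t)" by blast
    moreover have "(v \<longlongrightarrow> v t) (at_left t)"
      using continuous_at_imp_continuous_within[OF vc] by (simp add: continuous_within)
    ultimately show ?thesis using tendsto_Pair by blast
  qed
  fix \<tau>
  have "{t \<in> {0<..\<tau>}. \<not> isCont (\<lambda>t. (v t, u t)) t} \<subseteq> {t \<in> {0<..\<tau>}. \<not> isCont u t}"
    using continuous_Pair[OF vc] by auto
  moreover have "finite {t \<in> {0<..\<tau>}. \<not> isCont u t}" using u by (auto simp: PC_def)
  ultimately show "finite {t \<in> {0<..\<tau>}. \<not> isCont (\<lambda>t. (v t, u t)) t}" by (rule finite_subset)
qed

lemma fill_in_fill_in: "fill_in i (y $ i) (fill_in i z y) = y"
  by (simp add: fill_in_def vec_eq_iff)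

text \<open>A component of a solution of the whole system solves the subsystem whose input consists of
  the other components; they are frozen after the existence time to make the input global.\<close>

lemma subsystem_trajectory:
  fixes X :: "'n::finite \<Rightarrow> 'a::real_normed_vector set"
    and f :: "'n \<Rightarrow> 'a ^ 'n \<Rightarrow> 'u::real_normed_vector \<Rightarrow> 'a"
  assumes sub: "unique_mild_solutions (T i) (X i) (sub_rhs f i) (sub_input_space X i)"
    and whole: "unique_mild_solutions (product_semigroup T) (product_space X) (whole_rhs f) UNIV"
    and init: "transition_map (product_semigroup T) (product_space X) (whole_rhs f) 0 x u = x"
    and x: "x \<in> product_space X" and u: "u \<in> PC UNIV"
    and ex: "exists_until (product_semigroup T) (product_space X) (whole_rhs f) \<tau> x u"
    and X0: "0 \<in> X i"
  obtains v where "v \<in> PC (sub_input_space X i)" "v 0 = (fill_in i 0 x, u 0)"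
    "\<And>t. 0 \<le> t \<Longrightarrow> t \<le> \<tau> \<Longrightarrow> transition_map (T i) (X i) (sub_rhs f i) t (x $ i) v
       = transition_map (product_semigroup T) (product_space X) (whole_rhs f) t x u $ i"
proof -
  from ex obtain \<xi> where \<tau>: "0 \<le> \<tau>"
    and \<xi>: "mild_solution (product_semigroup T) (product_space X) (whole_rhs f) x u \<tau> \<xi>"
    by (auto simp: exists_until_def)
  have \<xi>_eq: "transition_map (product_semigroup T) (product_space X) (whole_rhs f) t x u = \<xi> t"
    if "0 \<le> t" "t \<le> \<tau>" for t
    by (rule transition_map_eq[OF whole x u that(1) mild_solution_restrict[OF \<xi> that(2)]])
  have \<xi>0: "\<xi> 0 = x" using \<xi>_eq[of 0] init \<tau> by simp
  have \<xi>c: "continuous_on {0..\<tau>} \<xi>" using \<xi> by (simp add: mild_solution_def)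
  have \<xi>X: "\<xi> t $ j \<in> X j" if "t \<in> {0..\<tau>}" for t j
    using \<xi> that by (auto simp: mild_solution_def product_space_def)
  define cl where "cl s = max 0 (min s \<tau>)" for s
  have cl: "cl s \<in> {0..\<tau>}" for s using \<tau> by (auto simp: cl_def)
  define w where "w s = fill_in i 0 (\<xi> (cl s))" for s
  define v where "v s = (w s, u s)" for s
  have fc: "continuous_on {0..\<tau>} (\<lambda>s. fill_in i 0 (\<xi> s))"
    unfolding fill_in_def
  proof (rule continuous_on_vec_lambda)
    fix j
    show "continuous_on {0..\<tau>} (\<lambda>s. if j = i then 0 else \<xi> s $ j)"
      by (cases "j = i") (auto intro!: continuous_on_component \<xi>c)
  qed
  have "continuous_on UNIV cl" unfolding cl_def by (intro continuous_intros)
  then have wc: "continuous_on UNIV w"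
    unfolding w_def by (rule continuous_on_compose2[OF fc]) (use cl in auto)
  have "bounded ((\<lambda>s. fill_in i 0 (\<xi> s)) ` {0..\<tau>})"
    by (intro compact_imp_bounded compact_continuous_image fc compact_Icc)
  then have wb: "bounded (range w)"
    by (rule bounded_subset) (use cl in \<open>auto simp: w_def\<close>)
  have vPC: "v \<in> PC (sub_input_space X i)"
    unfolding v_def
    by (rule PC_Pair[OF wc wb u]) (use \<xi>X[OF cl] in \<open>auto simp: sub_input_space_def w_def fill_in_def\<close>)
  have xi: "x $ i \<in> X i" using x by (simp add: product_space_def)
  have sol: "mild_solution (T i) (X i) (sub_rhs f i) (x $ i) v \<tau> (\<lambda>s. \<xi> s $ i)"
    unfolding mild_solution_def
  proof (intro conjI ballI)
    show "continuous_on {0..\<tau>} (\<lambda>s. \<xi> s $ i)" by (rule continuous_on_component[OF \<xi>c])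
    fix t assume t: "t \<in> {0..\<tau>}"
    show "\<xi> t $ i \<in> X i" by (rule \<xi>X[OF t])
    have "((\<lambda>s. product_semigroup T (t - s) (whole_rhs f (\<xi> s) (u s))) has_integral
        (\<xi> t - product_semigroup T t x)) {0..t}"
      using \<xi> t by (simp add: mild_solution_def)
    then have "((\<lambda>z. z $ i) \<circ> (\<lambda>s. product_semigroup T (t - s) (whole_rhs f (\<xi> s) (u s))) has_integral
        (\<xi> t - product_semigroup T t x) $ i) {0..t}"
      by (rule has_integral_linear) (rule bounded_linear_vec_nth)
    \<comment> \<open>Up to time t the clamp is the identity, and putting the \<open>i\<close>-th
      component back undoes its replacement by 0.\<close>
    moreover have "((\<lambda>z. z $ i) \<circ> (\<lambda>s. product_semigroup T (t - s) (whole_rhs f (\<xi> s) (u s)))) s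
        = T i (t - s) (sub_rhs f i (\<xi> s $ i) (v s))" if "s \<in> {0..t}" for s
      using that t
      by (simp add: product_semigroup_def whole_rhs_def sub_rhs_def v_def w_def cl_def fill_in_fill_in)
    ultimately have "((\<lambda>s. T i (t - s) (sub_rhs f i (\<xi> s $ i) (v s))) has_integral
        (\<xi> t - product_semigroup T t x) $ i) {0..t}"
      by (rule has_integral_eq[rotated])
    then show "((\<lambda>s. T i (t - s) (sub_rhs f i (\<xi> s $ i) (v s))) has_integral
        (\<xi> t $ i - T i t (x $ i))) {0..t}"
      by (simp add: product_semigroup_def)
  qed
  have "v 0 = (fill_in i 0 x, u 0)" using \<tau> \<xi>0 by (simp add: v_def w_def cl_def)
  moreover have "transition_map (T i) (X i) (sub_rhs f i) t (x $ i) v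
       = transition_map (product_semigroup T) (product_space X) (whole_rhs f) t x u $ i"
    if "0 \<le> t" "t \<le> \<tau>" for t
    using transition_map_eq[OF sub xi vPC that(1) mild_solution_restrict[OF sol that(2)]] \<xi>_eq[OF that]
    by simp
  ultimately show thesis using vPC by (intro that)
qed

section \<open>The sum norm and its components\<close>

lemma sum_of_norms_nonneg: "0 \<le> sum_of_norms x"
  by (simp add: sum_of_norms_def sum_nonneg)

lemma norm_component_le_sum_of_norms: "norm (x $ i) \<le> sum_of_norms x"
  unfolding sum_of_norms_def by (rule member_le_sum) auto

text \<open>Some component carries at least the average; this is the origin of the division by
  \<open>CARD('n)\<close> in the lower bound of the composite function.\<close>

lemma sum_of_norms_le_component:
  fixes x :: "'a::real_normed_vector ^ 'n::finite"
  shows "\<exists>i. sum_of_norms x / real CARD('n) \<le> norm (x $ i)"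
proof (rule ccontr)
  assume "\<not> ?thesis"
  then have "norm (x $ i) < sum_of_norms x / real CARD('n)" for i by (simp add: not_le)
  then have "sum_of_norms x < (\<Sum>i\<in>(UNIV::'n set). sum_of_norms x / real CARD('n))"
    unfolding sum_of_norms_def[of x] by (intro sum_strict_mono) auto
  then show False by simp
qed

text \<open>Only the subsystems attaining the maximum matter for the derivative; there \<open>V i = \<sigma> i V\<close>,
  so that the inequality \<open>\<Gamma>(\<sigma>(r)) < \<sigma>(r)\<close> is exactly what activates the decay of \<open>V i\<close>.\<close>

lemma max_lyapunov_decay:
  fixes \<sigma> :: "'n::finite \<Rightarrow> real \<Rightarrow> real"
  assumes \<sigma>: "\<And>i. class_Kinf (\<sigma> i)"
    and k: "\<And>i y. 0 < y \<Longrightarrow> 0 < k i y"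
      "\<And>i y a. 0 < y \<Longrightarrow> 0 \<le> a \<Longrightarrow>
         \<forall>\<^sub>F h in at_right 0. Kinv (\<sigma> i) (y - a * h) \<le> Kinv (\<sigma> i) y - k i y * a * h"
    and r: "0 < r" "(MAX i. Kinv (\<sigma> i) (W i 0)) = r"
    and W: "\<And>i. \<forall>\<^sub>F h in at_right 0. 0 \<le> W i h" "\<And>i. 0 \<le> W i (0::real)"
      "\<And>i. (W i \<longlongrightarrow> W i 0) (at_right 0)"
    and active: "\<And>i e. W i 0 = \<sigma> i r \<Longrightarrow> 0 < e \<Longrightarrow>
      \<forall>\<^sub>F h in at_right 0. W i h \<le> W i 0 + (- \<alpha> i (W i 0) + e) * h"
    and \<alpha>: "\<And>i. 0 < \<alpha> i (\<sigma> i r)" "\<And>i. c \<le> k i (\<sigma> i r) * \<alpha> i (\<sigma> i r)"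
    and e: "0 < e"
  shows "\<forall>\<^sub>F h in at_right 0. (MAX i. Kinv (\<sigma> i) (W i h)) \<le> r + (- c + e) * h"
proof -
  have pos_h: "\<forall>\<^sub>F h in at_right 0. 0 < (h::real)" by (simp add: eventually_at_right_less)
  have "\<forall>\<^sub>F h in at_right 0. Kinv (\<sigma> i) (W i h) \<le> r + (- c + e) * h" for i
  proof (cases "Kinv (\<sigma> i) (W i 0) = r")
    case True
    then have y: "W i 0 = \<sigma> i r" using Kinv_right[OF \<sigma> W(2)] by metis
    define y where "y = \<sigma> i r"
    have y0: "0 < y" unfolding y_def by (rule class_K_pos[OF class_Kinf_imp_K[OF \<sigma>] r(1)])
    \<comment> \<open>Small enough that \<open>a\<close> is nonnegative, as the slope minorant
      requires, and that the slack times the slope is at most e.\<close>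
    define e' where "e' = min (\<alpha> i y) (e / k i y)"
    have e': "0 < e'" "e' \<le> \<alpha> i y" "k i y * e' \<le> e"
      using \<alpha>(1)[of i] e k(1)[OF y0] by (auto simp: e'_def y_def field_simps min_def)
    define a where "a = \<alpha> i y - e'"
    have a: "0 \<le> a" using e' by (simp add: a_def)
    have "k i y * a = k i y * \<alpha> i y - k i y * e'" by (simp add: a_def algebra_simps)
    then have ka: "c - e \<le> k i y * a" using \<alpha>(2)[of i] e'(3) unfolding y_def by linarith
    have "\<forall>\<^sub>F h in at_right 0. W i h \<le> y - a * h"
      using active[OF y e'(1)] by (simp add: y y_def[symmetric] a_def algebra_simps)
    then show ?thesis
      using k(2)[OF y0 a, of i] W(1)[of i] pos_h
    proof eventually_elim
      case (elim h)
      have "Kinv (\<sigma> i) (W i h) \<le> Kinv (\<sigma> i) (y - a * h)"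
        by (rule class_K_le[OF class_Kinf_imp_K[OF class_Kinf_Kinv[OF \<sigma>]] elim(3,1)])
      also have "\<dots> \<le> r - k i y * a * h" using elim(2) True y by (simp add: y_def)
      also have "\<dots> \<le> r + (- c + e) * h"
      proof -
        have "(c - e) * h \<le> k i y * a * h" by (rule mult_right_mono[OF ka]) (use elim(4) in simp)
        then show ?thesis by (simp add: algebra_simps)
      qed
      finally show ?case .
    qed
  next
    case False
    moreover have "Kinv (\<sigma> i) (W i 0) \<le> r"
      unfolding r(2)[symmetric] by (rule Max_range_ge[of "\<lambda>i. Kinv (\<sigma> i) (W i 0)" i])
    \<comment> \<open>An inactive component starts strictly below r and stays below the required
      bound for small h by continuity alone.\<close>
    ultimately have less: "Kinv (\<sigma> i) (W i 0) < r" by simp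
    have lim: "((\<lambda>h. Kinv (\<sigma> i) (W i h)) \<longlongrightarrow> Kinv (\<sigma> i) (W i 0)) (at_right 0)"
    proof (rule continuous_on_tendsto_compose[OF class_K_continuous[OF class_Kinf_imp_K[OF class_Kinf_Kinv[OF \<sigma>]]] W(3)])
      show "\<forall>\<^sub>F h in at_right 0. W i h \<in> {0..}" using W(1)[of i] by simp
    qed (use W(2) in simp)
    have "((\<lambda>h. r + (- c + e) * h) \<longlongrightarrow> r + (- c + e) * 0) (at_right 0)"
      by (intro tendsto_intros)
    then have lim': "((\<lambda>h. r + (- c + e) * h) \<longlongrightarrow> r) (at_right 0)" by simp
    obtain m where m: "Kinv (\<sigma> i) (W i 0) < m" "m < r" using dense[OF less] by blast
    show ?thesis
      using order_tendstoD(2)[OF lim m(1)] order_tendstoD(1)[OF lim' m(2)]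
      by eventually_elim simp
  qed
  then have "\<forall>\<^sub>F h in at_right 0. \<forall>i\<in>UNIV. Kinv (\<sigma> i) (W i h) \<le> r + (- c + e) * h"
    by (intro eventually_ball_finite) auto
  then show ?thesis by (simp add: Max_range_le_iff)
qed

lemma Omega_path_slope_minorant:
  assumes "Omega_path \<Gamma> \<sigma>"
  shows "\<exists>k. continuous_on UNIV k \<and> (\<forall>y>0. 0 < k y) \<and>
    (\<forall>y a. 0 < y \<longrightarrow> 0 \<le> a \<longrightarrow>
       (\<forall>\<^sub>F h in at_right 0. Kinv (\<sigma> i) (y - a * h) \<le> Kinv (\<sigma> i) y - k y * a * h))"
proof -
  have \<sigma>: "class_Kinf (\<sigma> i)" using assms by (simp add: Omega_path_def)
  show ?thesis
  proof (rule slope_minorant[of "Kinv (\<sigma> i)"])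
    show "Kinv (\<sigma> i) x \<le> Kinv (\<sigma> i) y" if "0 < x" "x \<le> y" for x y
      by (rule class_K_le[OF class_Kinf_imp_K[OF class_Kinf_Kinv[OF \<sigma>]]]) (use that in auto)
    show "\<exists>\<delta>>0. \<exists>L. L-lipschitz_on (ball r \<delta> \<inter> {0<..}) (Kinv (\<sigma> i))" if "0 < r" for r
      using assms that by (simp add: Omega_path_def)
    show "\<exists>K>0. \<forall>r\<in>P. Kinv (\<sigma> i) differentiable at r \<longrightarrow> K \<le> deriv (Kinv (\<sigma> i)) r"
      if "compact P" "P \<subseteq> {0<..}" for P
    proof -
      have "\<exists>K1 K2. 0 < K1 \<and> K1 < K2 \<and> (\<forall>i. \<forall>r\<in>P. Kinv (\<sigma> i) differentiable (at r) \<longrightarrow>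
              K1 \<le> deriv (Kinv (\<sigma> i)) r \<and> deriv (Kinv (\<sigma> i)) r \<le> K2)"
        using assms that unfolding Omega_path_def by blast
      then show ?thesis by blast
    qed
  qed blast
qed

text \<open>Decay has to be checked at states with positive V only, the others being supplied by
  \<open>ISS_LyapunovI\<close>; there r = V(x) > 0 is a point of the path where all its strict
  inequalities hold.\<close>

lemma interconnection_ISS_Lyapunov:
  fixes X :: "'n::finite \<Rightarrow> 'a::banach set"
    and T :: "'n \<Rightarrow> real \<Rightarrow> 'a \<Rightarrow> 'a"
    and f :: "'n \<Rightarrow> 'a ^ 'n \<Rightarrow> 'u::banach \<Rightarrow> 'a"
  defines "D \<equiv> exists_until (product_semigroup T) (product_space X) (whole_rhs f)"
    and "\<phi> \<equiv> transition_map (product_semigroup T) (product_space X) (whole_rhs f)"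
  assumes X0: "\<And>i. 0 \<in> X i"
    and sub: "\<And>i. unique_mild_solutions (T i) (X i) (sub_rhs f i) (sub_input_space X i)"
    and whole: "unique_mild_solutions (product_semigroup T) (product_space X) (whole_rhs f) UNIV"
      "control_system (product_space X) UNIV D \<phi>"
    and lyapunov: "\<And>i. sub_ISS_Lyapunov X T f V \<gamma> \<gamma>u i"
    and omega: "Omega_path (gain_operator \<gamma>) \<sigma>"
  shows "ISS_Lyapunov sum_of_norms (product_space X) UNIV \<phi>
           (\<lambda>x. MAX i. Kinv (\<sigma> i) (V i (x $ i))) (\<lambda>r. MAX i. Kinv (\<sigma> i) (\<gamma>u i r))"
proof -
  have flow: "0 \<le> t \<and> \<phi> t x w \<in> product_space X" if "x \<in> product_space X" "w \<in> PC UNIV" "D t x w" for t x w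
    using exists_until_flow[OF whole(1) that(1,2)] that(3) by (simp add: D_def \<phi>_def)
  have \<sigma>: "class_Kinf (\<sigma> i)" for i using omega by (simp add: Omega_path_def)
  note \<sigma>K = class_Kinf_imp_K[OF \<sigma>]
  note \<tau> = class_Kinf_Kinv[OF \<sigma>]
  note \<tau>K = class_Kinf_imp_K[OF \<tau>]
  have less: "(MAX j. \<gamma> i j (\<sigma> j r)) < \<sigma> i r" if "0 < r" for i r
    using omega that by (simp add: Omega_path_def gain_operator_def)
  have Vc: "continuous_on (X i) (V i)" and V0: "\<And>x. x \<in> X i \<Longrightarrow> 0 \<le> V i x"
    and gK: "\<And>j. j \<noteq> i \<Longrightarrow> class_K (\<gamma> i j)" and g0: "\<And>r. 0 \<le> r \<Longrightarrow> \<gamma> i i r = 0"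
    and guK: "class_K (\<gamma>u i)" for i
    using lyapunov[of i] by (simp_all add: sub_ISS_Lyapunov_def)
  have gm: "gain_matrix \<gamma>" unfolding gain_matrix_def using gK g0 by metis
  \<comment> \<open>The existential statements are named so that their witnesses can be chosen as
    functions of \<open>i\<close>.\<close>
  define Q where "Q i \<psi>1 \<psi>2 \<alpha> \<longleftrightarrow> class_Kinf \<psi>1 \<and> class_Kinf \<psi>2 \<and> pos_def \<alpha> \<and>
        (\<forall>x\<in>X i. \<psi>1 (norm x) \<le> V i x \<and> V i x \<le> \<psi>2 (norm x)) \<and>
        (\<forall>x\<in>X i. \<forall>z\<in>sub_input_space X i. \<forall>v\<in>PC (sub_input_space X i). v 0 = z \<longrightarrow>
           V i x \<ge> max (MAX j. \<gamma> i j (V j (fill_in i x (fst z) $ j))) (\<gamma>u i (norm (snd z))) \<longrightarrow>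
           lie_derivative (transition_map (T i) (X i) (sub_rhs f i)) (V i) x v
             \<le> ereal (- \<alpha> (V i x)))" for i \<psi>1 \<psi>2 \<alpha>
  have "\<exists>\<psi>1 \<psi>2 \<alpha>. Q i \<psi>1 \<psi>2 \<alpha>" for i
    using lyapunov[of i] unfolding sub_ISS_Lyapunov_def Q_def by (elim conjE)
  then obtain \<psi>1 \<psi>2 \<alpha> where "\<And>i. Q i (\<psi>1 i) (\<psi>2 i) (\<alpha> i)" by metis
  note Q = this[unfolded Q_def]
  from Q have \<psi>: "\<And>i. class_Kinf (\<psi>1 i)" "\<And>i. class_Kinf (\<psi>2 i)"
      "\<And>i x. x \<in> X i \<Longrightarrow> \<psi>1 i (norm x) \<le> V i x" "\<And>i x. x \<in> X i \<Longrightarrow> V i x \<le> \<psi>2 i (norm x)"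
    and \<alpha>: "\<And>i. pos_def (\<alpha> i)"
    and decay: "\<And>i x v. x \<in> X i \<Longrightarrow> v 0 \<in> sub_input_space X i \<Longrightarrow> v \<in> PC (sub_input_space X i) \<Longrightarrow>
           (MAX j. \<gamma> i j (V j (fill_in i x (fst (v 0)) $ j))) \<le> V i x \<Longrightarrow> \<gamma>u i (norm (snd (v 0))) \<le> V i x \<Longrightarrow>
           lie_derivative (transition_map (T i) (X i) (sub_rhs f i)) (V i) x v \<le> ereal (- \<alpha> i (V i x))"
    by simp_all
  define R where "R i k \<longleftrightarrow> continuous_on UNIV k \<and> (\<forall>y>0. 0 < k y) \<and>
    (\<forall>y a. 0 < y \<longrightarrow> 0 \<le> a \<longrightarrow>
       (\<forall>\<^sub>F h in at_right 0. Kinv (\<sigma> i) (y - a * h) \<le> Kinv (\<sigma> i) y - k y * a * h))" for i k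
  have "\<exists>k. R i k" for i
    unfolding R_def by (rule Omega_path_slope_minorant[OF omega])
  then obtain k where "\<And>i. R i (k i)" by metis
  note R = this[unfolded R_def]
  from R have kc: "\<And>i. continuous_on UNIV (k i)" and k: "\<And>i y. 0 < y \<Longrightarrow> 0 < k i y"
      "\<And>i y a. 0 < y \<Longrightarrow> 0 \<le> a \<Longrightarrow>
         \<forall>\<^sub>F h in at_right 0. Kinv (\<sigma> i) (y - a * h) \<le> Kinv (\<sigma> i) y - k i y * a * h"
    by simp_all
  define VV where "VV x = (MAX i. Kinv (\<sigma> i) (V i (x $ i)))" for x
  define gain where "gain r = (MAX i. Kinv (\<sigma> i) (\<gamma>u i r))" for r
  \<comment> \<open>As in the chain rule: slope of the inverse times decay rate of the subsystem, at
    the value \<open>\<sigma> i r\<close> that an active \<open>V i\<close> takes. The minimum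
    serves every index that may be active.\<close>
  define A where "A r = (MIN i. k i (\<sigma> i r) * \<alpha> i (\<sigma> i r))" for r
  have comp: "x $ i \<in> X i" if "x \<in> product_space X" for x i using that by (simp add: product_space_def)
  have gainK: "class_K gain"
    unfolding gain_def by (rule class_K_Max[OF class_K_compose[OF \<tau>K guK]])
  have VV_ge: "Kinv (\<sigma> i) (V i (x $ i)) \<le> VV x" for i x
    unfolding VV_def by (rule Max_range_ge[of "\<lambda>i. Kinv (\<sigma> i) (V i (x $ i))" i])
  have VV0: "0 \<le> VV x" if "x \<in> product_space X" for x
    using Kinv_nonneg[OF \<sigma> V0[OF comp[OF that]]] VV_ge order_trans by blast
  have VVc: "continuous_on (product_space X) VV"
    unfolding VV_def
  proof (rule continuous_on_Max_image)
    fix i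
    have "continuous_on (product_space X) (\<lambda>x. V i (x $ i))"
      by (rule continuous_on_compose2[OF Vc]) (auto intro: continuous_on_component continuous_on_id comp)
    then show "continuous_on (product_space X) (\<lambda>x. Kinv (\<sigma> i) (V i (x $ i)))"
      by (rule continuous_on_compose2[OF class_K_continuous[OF \<tau>K]]) (use V0 comp in auto)
  qed auto
  have "class_Kinf (\<lambda>r. r / real CARD('n))"
  proof (rule class_KinfI[OF class_KI])
    show "\<exists>r\<ge>0. M \<le> r / real CARD('n)" for M
      by (intro exI[of _ "\<bar>M\<bar> * real CARD('n)"]) auto
  qed (auto intro!: continuous_intros divide_strict_right_mono)
  note scale = this
  \<comment> \<open>Any index may be the one with at least the average norm, hence the minimum; the
    upper bound has to dominate all of them.\<close>
  define \<Psi>1 where "\<Psi>1 r = (MIN i. Kinv (\<sigma> i) (\<psi>1 i (r / real CARD('n))))" for r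
  define \<Psi>2 where "\<Psi>2 r = (MAX i. Kinv (\<sigma> i) (\<psi>2 i r))" for r
  have \<Psi>1: "class_Kinf \<Psi>1"
    unfolding \<Psi>1_def by (rule class_Kinf_Min[OF class_Kinf_compose[OF \<tau> class_Kinf_compose[OF \<psi>(1) scale]]])
  have \<Psi>2: "class_Kinf \<Psi>2"
    unfolding \<Psi>2_def by (rule class_Kinf_Max[OF class_Kinf_compose[OF \<tau> \<psi>(2)]])
  have bounds: "\<Psi>1 (sum_of_norms x) \<le> VV x" "VV x \<le> \<Psi>2 (sum_of_norms x)" if x: "x \<in> product_space X" for x
  proof -
    note nn = sum_of_norms_nonneg[of x]
    obtain i where i: "sum_of_norms x / real CARD('n) \<le> norm (x $ i)"
      using sum_of_norms_le_component[of x] by blast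
    have s0: "0 \<le> sum_of_norms x / real CARD('n)" using nn by simp
    have "\<Psi>1 (sum_of_norms x) \<le> Kinv (\<sigma> i) (\<psi>1 i (sum_of_norms x / real CARD('n)))"
      unfolding \<Psi>1_def by (rule Min_range_le)
    also have "\<dots> \<le> Kinv (\<sigma> i) (V i (x $ i))"
    proof (rule class_K_le[OF \<tau>K])
      show "0 \<le> \<psi>1 i (sum_of_norms x / real CARD('n))"
        by (rule class_K_nonneg[OF class_Kinf_imp_K[OF \<psi>(1)] s0])
      have "\<psi>1 i (sum_of_norms x / real CARD('n)) \<le> \<psi>1 i (norm (x $ i))"
        by (rule class_K_le[OF class_Kinf_imp_K[OF \<psi>(1)] s0 i])
      then show "\<psi>1 i (sum_of_norms x / real CARD('n)) \<le> V i (x $ i)"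
        using \<psi>(3)[OF comp[OF x]] order_trans by blast
    qed
    also have "\<dots> \<le> VV x" by (rule VV_ge)
    finally show "\<Psi>1 (sum_of_norms x) \<le> VV x" .
    have "Kinv (\<sigma> j) (V j (x $ j)) \<le> \<Psi>2 (sum_of_norms x)" for j
    proof -
      have "\<psi>2 j (norm (x $ j)) \<le> \<psi>2 j (sum_of_norms x)"
        by (rule class_K_le[OF class_Kinf_imp_K[OF \<psi>(2)]]) (auto simp: norm_component_le_sum_of_norms)
      then have "V j (x $ j) \<le> \<psi>2 j (sum_of_norms x)"
        using \<psi>(4)[OF comp[OF x, of j]] by linarith
      then have "Kinv (\<sigma> j) (V j (x $ j)) \<le> Kinv (\<sigma> j) (\<psi>2 j (sum_of_norms x))"
        by (rule class_K_le[OF \<tau>K V0[OF comp[OF x]]])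
      also have "\<dots> \<le> \<Psi>2 (sum_of_norms x)"
        unfolding \<Psi>2_def by (rule Max_range_ge[of "\<lambda>j. Kinv (\<sigma> j) (\<psi>2 j (sum_of_norms x))" j])
      finally show ?thesis .
    qed
    then show "VV x \<le> \<Psi>2 (sum_of_norms x)" unfolding VV_def Max_range_le_iff by blast
  qed
  have \<sigma>pos: "0 < \<sigma> i r" if "0 < r" for i r by (rule class_K_pos[OF \<sigma>K that])
  have \<alpha>pos: "0 < \<alpha> i y" if "0 < y" for i y using \<alpha>[of i] that by (simp add: pos_def_def)
  have A: "pos_def A"
    unfolding pos_def_def
  proof (intro conjI allI impI)
    have "continuous_on {0..} (\<lambda>r. \<alpha> i (\<sigma> i r))" for i
      by (rule continuous_on_compose2[OF _ class_K_continuous[OF \<sigma>K], of "{0..}"])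
        (use \<alpha> in \<open>auto simp: pos_def_def intro: class_K_nonneg[OF \<sigma>K]\<close>)
    moreover have "continuous_on {0..} (\<lambda>r. k i (\<sigma> i r))" for i
      by (rule continuous_on_compose2[OF kc class_K_continuous[OF \<sigma>K]]) auto
    ultimately show "continuous_on {0..} A"
      unfolding A_def by (intro continuous_on_Min_image continuous_on_mult) auto
    show "A 0 = 0" using \<alpha> by (simp add: A_def class_K_zero[OF \<sigma>K] pos_def_def)
    fix r :: real assume r: "0 < r"
    obtain i where "A r = k i (\<sigma> i r) * \<alpha> i (\<sigma> i r)"
      using Min_range_attained[of "\<lambda>i. k i (\<sigma> i r) * \<alpha> i (\<sigma> i r)"] by (auto simp: A_def)
    then show "0 < A r" using k(1)[OF \<sigma>pos[OF r]] \<alpha>pos[OF \<sigma>pos[OF r]] by simp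
  qed
  have "lie_derivative \<phi> VV x u \<le> ereal (- A (VV x))"
    if x: "x \<in> product_space X" and u: "u \<in> PC UNIV" and pos: "0 < VV x" and ge: "gain (sup_norm u) \<le> VV x"
    for x u
  proof -
    have init: "\<phi> 0 x u = x" using flow_zero[OF whole(2) flow x u] .
    obtain t0 where t0: "0 < t0" "D t0 x u" using flow_local[OF whole(2) flow x u] by blast
    have Dt: "D t x u" if "0 \<le> t" "t \<le> t0" for t
      by (rule flow_downward[OF whole(2) flow x u that t0(2)])
    have in_t0: "\<forall>\<^sub>F h in at_right 0. h \<in> {0<..<t0}" by (rule eventually_at_right_real[OF t0(1)])
    define r where "r = VV x"
    have r: "0 < r" using pos by (simp add: r_def)
    have V_le: "V i (x $ i) \<le> \<sigma> i r" for i
      using VV_ge[of i x] Kinv_le_iff[OF \<sigma> less_imp_le[OF r] V0[OF comp[OF x]]] by (simp add: r_def)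
    define W where "W i h = V i (\<phi> h x u $ i)" for i h
    have W0: "W i 0 = V i (x $ i)" for i by (simp add: W_def init)
    have "continuous_on {0..t0} (\<lambda>t. \<phi> t x u)"
      by (rule continuous_on_subset[OF flow_continuous[OF whole(2) flow x u]]) (use Dt in auto)
    then have "continuous_on {0..t0} (\<lambda>t. \<phi> t x u $ i)" for i by (rule continuous_on_component)
    then have Wc: "continuous_on {0..t0} (W i)" for i
      unfolding W_def by (rule continuous_on_compose2[OF Vc]) (use flow[OF x u Dt] comp in auto)
    have "(W i \<longlongrightarrow> W i 0) (at 0 within {0..t0})" for i
      using Wc[of i] t0(1) by (auto simp: continuous_on_def)
    then have W_lim: "(W i \<longlongrightarrow> W i 0) (at_right 0)" for i
      using t0(1) by (simp add: at_within_Icc_at_right)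
    have W_nonneg: "\<forall>\<^sub>F h in at_right 0. 0 \<le> W i h" for i
      using in_t0 by eventually_elim (use flow[OF x u Dt] V0 comp in \<open>auto simp: W_def\<close>)
    have active: "\<forall>\<^sub>F h in at_right 0. W i h \<le> W i 0 + (- \<alpha> i (W i 0) + e) * h"
      if act: "W i 0 = \<sigma> i r" and e: "0 < e" for i e
    proof -
      obtain v where v: "v \<in> PC (sub_input_space X i)" "v 0 = (fill_in i 0 x, u 0)"
        and traj: "\<And>t. 0 \<le> t \<Longrightarrow> t \<le> t0 \<Longrightarrow>
          transition_map (T i) (X i) (sub_rhs f i) t (x $ i) v = \<phi> t x u $ i"
        using subsystem_trajectory[OF sub whole(1) init[unfolded \<phi>_def] x u t0(2)[unfolded D_def] X0]
        unfolding \<phi>_def by blast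
      have Vi: "V i (x $ i) = \<sigma> i r" using act W0 by simp
      have "(MAX j. \<gamma> i j (V j (x $ j))) \<le> (MAX j. \<gamma> i j (\<sigma> j r))"
        by (rule gain_row_mono[OF gm V0[OF comp[OF x]] V_le])
      also have "\<dots> \<le> V i (x $ i)" using less[OF r, of i] Vi by simp
      finally have int: "(MAX j. \<gamma> i j (V j (fill_in i (x $ i) (fst (v 0)) $ j))) \<le> V i (x $ i)"
        by (simp add: v(2) fill_in_fill_in)
      have "Kinv (\<sigma> i) (\<gamma>u i (sup_norm u)) \<le> gain (sup_norm u)"
        unfolding gain_def by (rule Max_range_ge[of "\<lambda>i. Kinv (\<sigma> i) (\<gamma>u i (sup_norm u))" i])
      then have "Kinv (\<sigma> i) (\<gamma>u i (sup_norm u)) \<le> r" using ge by (simp add: r_def)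
      then have "\<gamma>u i (sup_norm u) \<le> \<sigma> i r"
        by (subst (asm) Kinv_le_iff[OF \<sigma> less_imp_le[OF r] class_K_nonneg[OF guK sup_norm_nonneg[OF u]]])
      \<comment> \<open>The subsystems compare with the input value at time 0, the whole system with
        the supremum norm, which is at least as large.\<close>
      moreover have "\<gamma>u i (norm (u 0)) \<le> \<gamma>u i (sup_norm u)"
        by (rule class_K_le[OF guK norm_ge_zero PC_norm_le_sup_norm[OF u order_refl]])
      ultimately have ext: "\<gamma>u i (norm (snd (v 0))) \<le> V i (x $ i)" by (simp add: v(2) Vi)
      have v0: "v 0 \<in> sub_input_space X i" using v(1) by (simp add: PC_def)
      have "\<forall>\<^sub>F h in at_right 0. V i (transition_map (T i) (X i) (sub_rhs f i) h (x $ i) v)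
          \<le> V i (x $ i) + (- \<alpha> i (V i (x $ i)) + e) * h"
        by (rule lie_derivative_upper[OF decay[OF comp[OF x] v0 v(1) int ext] e])
      then show ?thesis
        using in_t0 by eventually_elim (simp add: W_def init traj)
    qed
    show ?thesis
    proof (rule lie_derivative_leI)
      fix e :: real assume e: "0 < e"
      have "\<forall>\<^sub>F h in at_right 0. (MAX i. Kinv (\<sigma> i) (W i h)) \<le> r + (- A r + e) * h"
      proof (rule max_lyapunov_decay[where \<alpha> = \<alpha> and k = k])
        show "(MAX i. Kinv (\<sigma> i) (W i 0)) = r" by (simp add: W0 r_def VV_def)
        show "0 \<le> W i 0" for i by (simp add: W0 V0[OF comp[OF x]])
        show "0 < \<alpha> i (\<sigma> i r)" for i by (rule \<alpha>pos[OF \<sigma>pos[OF r]])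
        show "A r \<le> k i (\<sigma> i r) * \<alpha> i (\<sigma> i r)" for i
          unfolding A_def by (rule Min_range_le[of "\<lambda>i. k i (\<sigma> i r) * \<alpha> i (\<sigma> i r)" i])
      qed (fact \<sigma> k r W_nonneg W_lim active e)+
      then show "\<forall>\<^sub>F h in at_right 0. VV (\<phi> h x u) \<le> VV x + (- A (VV x) + e) * h"
        by (simp add: VV_def W_def r_def)
    qed
  qed
  then have "ISS_Lyapunov sum_of_norms (product_space X) UNIV \<phi> VV gain"
    using ISS_LyapunovI[OF whole(2) flow VVc VV0 gainK \<Psi>1 \<Psi>2 _ A, of sum_of_norms] bounds by blast
  then show ?thesis by (simp add: VV_def[abs_def] gain_def[abs_def])
qed

theorem theorem4:
  fixes X :: "'n::finite \<Rightarrow> 'a::banach set"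
    and dom_A :: "'n \<Rightarrow> 'a set"
    and A :: "'n \<Rightarrow> 'a \<Rightarrow> 'a"
    and T :: "'n \<Rightarrow> real \<Rightarrow> 'a \<Rightarrow> 'a"
    and f :: "'n \<Rightarrow> 'a ^ 'n \<Rightarrow> 'u::banach \<Rightarrow> 'a"
    and V :: "'n \<Rightarrow> 'a \<Rightarrow> real"
    and \<gamma> :: "'n \<Rightarrow> 'n \<Rightarrow> real \<Rightarrow> real"
    and \<gamma>u :: "'n \<Rightarrow> real \<Rightarrow> real"
  defines "D \<equiv> exists_until (product_semigroup T) (product_space X) (whole_rhs f)"
    and "\<phi> \<equiv> transition_map (product_semigroup T) (product_space X) (whole_rhs f)"
  assumes banach: "\<And>i. subspace (X i)" "\<And>i. closed (X i)"
    and generator: "\<And>i. generates_C0 (X i) (dom_A i) (A i) (T i)"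
    and f_range: "\<And>i x u. x \<in> product_space X \<Longrightarrow> f i x u \<in> X i"
    and sub_well_posed:
      "\<And>i. well_posed norm (T i) (X i) (sub_rhs f i) (sub_input_space X i)"
    and whole_well_posed:
      "well_posed sum_of_norms (product_semigroup T) (product_space X) (whole_rhs f) UNIV"
    and lyapunov: "\<And>i. sub_ISS_Lyapunov X T f V \<gamma> \<gamma>u i"
    and small_gain: "small_gain (gain_operator \<gamma>)"
  shows "ISS sum_of_norms (product_space X) UNIV D \<phi>
    \<and> (\<exists>\<sigma>. Omega_path (gain_operator \<gamma>) \<sigma>)
    \<and> (\<forall>\<sigma>. Omega_path (gain_operator \<gamma>) \<sigma> \<longrightarrow>
         ISS_Lyapunov sum_of_norms (product_space X) UNIV \<phi>
           (\<lambda>x. MAX i. Kinv (\<sigma> i) (V i (x $ i)))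
           (\<lambda>r. MAX i. Kinv (\<sigma> i) (\<gamma>u i r)))"
proof -
  have X0: "0 \<in> X i" for i by (rule subspace_0[OF banach(1)])
  have sub: "unique_mild_solutions (T i) (X i) (sub_rhs f i) (sub_input_space X i)" for i
    using sub_well_posed[of i] by (simp add: well_posed_def)
  have whole: "unique_mild_solutions (product_semigroup T) (product_space X) (whole_rhs f) UNIV"
      "control_system (product_space X) UNIV D \<phi>" "BIC sum_of_norms (product_space X) UNIV D \<phi>"
    using whole_well_posed by (simp_all add: well_posed_def D_def \<phi>_def)
  have lyap: "ISS_Lyapunov sum_of_norms (product_space X) UNIV \<phi>
      (\<lambda>x. MAX i. Kinv (\<sigma> i) (V i (x $ i))) (\<lambda>r. MAX i. Kinv (\<sigma> i) (\<gamma>u i r))"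
    if "Omega_path (gain_operator \<gamma>) \<sigma>" for \<sigma>
    unfolding \<phi>_def
    by (rule interconnection_ISS_Lyapunov[OF X0 sub whole(1) whole(2)[unfolded D_def \<phi>_def] lyapunov that])
  have "class_K (\<gamma> i j)" if "j \<noteq> i" for i j
    using lyapunov[of i] that by (simp add: sub_ISS_Lyapunov_def)
  moreover have "\<gamma> i i r = 0" if "0 \<le> r" for i r
    using lyapunov[of i] that by (simp add: sub_ISS_Lyapunov_def)
  ultimately have "gain_matrix \<gamma>" unfolding gain_matrix_def by metis
  then have "\<exists>\<sigma>. Omega_path (gain_operator \<gamma>) \<sigma>"
    by (rule Omega_path_exists[OF _ small_gain_imp_no_superfixpoint[OF small_gain]])
  then obtain \<sigma> where \<sigma>: "Omega_path (gain_operator \<gamma>) \<sigma>" by blast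
  have flow: "0 \<le> t \<and> \<phi> t x w \<in> product_space X"
    if "x \<in> product_space X" "w \<in> PC UNIV" "D t x w" for t x w
    using exists_until_flow[OF whole(1) that(1,2)] that(3) by (simp add: D_def \<phi>_def)
  \<comment> \<open>ISS does not mention the path, so a single one is enough.\<close>
  have "ISS sum_of_norms (product_space X) UNIV D \<phi>"
    by (rule ISS_Lyapunov_imp_ISS[OF whole(2) flow whole(3) sum_of_norms_nonneg lyap[OF \<sigma>]])
  with \<sigma> lyap show ?thesis by blast
qed

end
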